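(* Let $p$ be a prime, $\mathbf{F}$ a field of characteristic $p$ and $G\cong\mathbf{Z}/p^2$. Let $a_1(n),\dots,a_p(n)$ and $b_1(n),\dots,b_p(n)$ be the multiplicity functions defined in the context, and let $A_i(x)=\sum_{n\ge0}a_i(n)x^n$ and $B_i(x)=\sum_{n\ge 0}b_i(n)x^n$ for $1\le i\le p$. Then $$A_1(x)=\frac{-x}{1-x^p}+\frac{1-x}{p(1-x^p)}\left(\frac{1}{(1-x)^p}-\frac{1-(p+1)x^{p^2}+px^{p^2+p}}{(1-x^p)(1-x^{p^2})}\right),$$ $$A_i(x)=x^{i-1}A_1(x)\quad\text{for } 1\le i\le p-1,$$ $$A_p(x)=\frac{1}{p(1-x^p)}\left(\frac{x^{p-1}}{(1-x)^p}-\frac{x^{p-1}-(p+1)x^{p^2+p-1}+px^{p^2+2p-1}}{(1-x^p)(1-x^{p^2})}\right),$$ and $$B_i(x)=A_i(x)+\frac{x^{p^2-p+i-1}}{1-x^{p^2}}\quad\text{for } 1\le i\le p.$$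
   Context: For $1\le m\le p^2$, $V_m$ is the indecomposable $\mathbf{F}G$-module of dimension $m$ on which a generator of $G$ acts by a single Jordan block with eigenvalue $1$; these are, up to isomorphism, all the indecomposable $\mathbf{F}G$-modules. $V_m$ is induced from a representation of a proper subgroup if and only if $p$ divides $m$. $\mathbf{F}[V_{p+1}]:=S(V_{p+1}^* )$ with $G$ acting by algebra automorphisms, and $\mathbf{F}[V_{p+1}]_n$ is the homogeneous component of degree $n$. For $n\ge 0$ write $n=\alpha p^2+\beta p+\gamma$ with $\alpha\ge 0$ and $0\le\beta,\gamma\le p-1$, and put $d(n)=\gamma p+\beta+1$. If $\beta\ne p-1$, then $\mathbf{F}[V_{p+1}]_n$ contains exactly one non-induced indecomposable summand, isomorphic to $V_{d(n)}$; if $\beta=p-1$ then $\mathbf{F}[V_{p+1}]_n$ is an induced module and $d(n)=(\gamma+1)p$. The integers $a_i(n)$ are defined by $$\mathbf{F}[V_{p+1}]_n\cong V_{d(n)}\oplus a_1(n)V_p\oplus a_2(n)V_{2p}\oplus\cdots\oplus a_p(n)V_{p^2},$$ and $b_i(n)$ is the total multiplicity of $V_{ip}$ as a summand in $\mathbf{F}[V_{p+1}]_n$, i.e. the induced part of $\mathbf{F}[V_{p+1}]_n$ is isomorphic to $b_1(n)V_p\oplus b_2(n)V_{2p}\oplus\cdots\oplus b_p(n)V_{p^2}$. Here $kV$ denotes the direct sum of $k$ copies of $V$. *)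

theory Defs
  imports
    "HOL-Algebra.Elementary_Groups"
    "HOL-Computational_Algebra.Formal_Power_Series"
    "HOL-Library.Poly_Mapping"
    "Jordan_Normal_Form.Jordan_Normal_Form"
    "Jordan_Normal_Form.VS_Connect"
begin

hide_const (open) Multiset.mult

section \<open>Modules over the group algebra\<close>

text \<open>
  The field is a type of class \<^class>\<open>field\<close>, and vector spaces over it are the modules over
  \<^term>\<open>class_ring\<close>. As in \<^const>\<open>module_vec\<close>, the ring fields \<open>mult\<close> and \<open>one\<close>, which the module
  record inherits, are irrelevant and left undefined below.
\<close>

record ('k, 'v, 'g) fg_module = "('k, 'v) module" +
  action :: "'g \<Rightarrow> 'v \<Rightarrow> 'v"

definition fg_iso ::
  "('g, 'x) monoid_scheme \<Rightarrow> ('k :: field, 'v, 'g) fg_module \<Rightarrow> ('k, 'w, 'g) fg_module \<Rightarrow> bool" where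
  "fg_iso G M N \<longleftrightarrow>
     (\<exists>\<phi> \<in> module_hom class_ring M N.
        bij_betw \<phi> (carrier M) (carrier N) \<and>
        (\<forall>g \<in> carrier G. \<forall>v \<in> carrier M. \<phi> (action M g v) = action N g (\<phi> v)))"

definition direct_sum ::
  "('k :: field, 'v, 'g) fg_module list \<Rightarrow> ('k, nat \<Rightarrow> 'v, 'g) fg_module" where
  "direct_sum Ms =
    \<lparr> carrier = (\<Pi>\<^sub>E j\<in>{..<length Ms}. carrier (Ms ! j)),
      mult = undefined,
      one = undefined,
      zero = (\<lambda>j\<in>{..<length Ms}. \<zero>\<^bsub>Ms ! j\<^esub>),
      add = (\<lambda>u v. \<lambda>j\<in>{..<length Ms}. u j \<oplus>\<^bsub>Ms ! j\<^esub> v j),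
      smult = (\<lambda>c v. \<lambda>j\<in>{..<length Ms}. c \<odot>\<^bsub>Ms ! j\<^esub> v j),
      action = (\<lambda>g v. \<lambda>j\<in>{..<length Ms}. action (Ms ! j) g (v j)) \<rparr>"


section \<open>The modules \<open>V\<^sub>m\<close>\<close>

text \<open>
  Here \<open>s\<close> is a generator of \<open>G\<close>, acting on column vectors by the Jordan block of size \<open>m\<close> with
  eigenvalue 1. An element \<open>g\<close> is written as \<open>s\<^sup>k\<close> with the least possible \<open>k\<close>. If \<open>G\<close> is cyclic of
  order \<open>p\<^sup>2\<close> and the field has characteristic \<open>p\<close>, this is a representation for \<open>m \<le> p\<^sup>2\<close>, since
  then the \<open>p\<^sup>2\<close>-th power of the block is the identity.
\<close>

definition jordan_rep ::
  "('g, 'x) monoid_scheme \<Rightarrow> 'g \<Rightarrow> nat \<Rightarrow> 'g \<Rightarrow> 'k :: field mat" where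
  "jordan_rep G s m g = jordan_block m 1 ^\<^sub>m (LEAST k :: nat. g = s [^]\<^bsub>G\<^esub> k)"

definition jordan_module ::
  "('g, 'x) monoid_scheme \<Rightarrow> 'g \<Rightarrow> nat \<Rightarrow> ('k :: field, 'k vec, 'g) fg_module" where
  "jordan_module G s m =
    \<lparr> carrier = carrier_vec m,
      mult = undefined,
      one = undefined,
      zero = 0\<^sub>v m,
      add = (+),
      smult = (\<cdot>\<^sub>v),
      action = (\<lambda>g v. jordan_rep G s m g *\<^sub>v v) \<rparr>"


section \<open>The graded pieces of \<open>S(V\<^sub>m\<^sup>*)\<close>\<close>

text \<open>
  \<open>S(V\<^sub>m\<^sup>*)\<close> is the polynomial ring in the coordinate functions \<open>x\<^sub>0, \<dots>, x\<^sub>m\<^sub>-\<^sub>1\<close> of \<open>V\<^sub>m\<close>. A polynomial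
  is a finitely supported function on exponent vectors.
\<close>

type_synonym 'k mpoly = "(nat \<Rightarrow>\<^sub>0 nat) \<Rightarrow>\<^sub>0 'k"

definition mconst :: "'k :: field \<Rightarrow> 'k mpoly" where
  "mconst c = Poly_Mapping.single 0 c"

definition mvar :: "nat \<Rightarrow> 'k :: field mpoly" where
  "mvar i = Poly_Mapping.single (Poly_Mapping.single i 1) 1"

definition msubst :: "(nat \<Rightarrow> 'k :: field mpoly) \<Rightarrow> 'k mpoly \<Rightarrow> 'k mpoly" where
  "msubst \<theta> f =
     (\<Sum>e \<in> Poly_Mapping.keys f. mconst (Poly_Mapping.lookup f e) *
        (\<Prod>i \<in> Poly_Mapping.keys e. \<theta> i ^ Poly_Mapping.lookup e i))"

text \<open>
  The contragredient action on \<open>V\<^sub>m\<^sup>*\<close> is \<open>(g \<cdot> x\<^sub>i)(v) = x\<^sub>i(g\<^sup>-\<^sup>1 v) = \<Sum>\<^sub>j \<rho>(g\<^sup>-\<^sup>1)\<^sub>i\<^sub>j v\<^sub>j\<close>.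
\<close>

definition coord_action ::
  "('g, 'x) monoid_scheme \<Rightarrow> 'g \<Rightarrow> nat \<Rightarrow> 'g \<Rightarrow> nat \<Rightarrow> 'k :: field mpoly" where
  "coord_action G s m g i =
     (\<Sum>j<m. mconst (jordan_rep G s m (inv\<^bsub>G\<^esub> g) $$ (i, j)) * mvar j)"

definition sym_dual ::
  "('g, 'x) monoid_scheme \<Rightarrow> 'g \<Rightarrow> nat \<Rightarrow> nat \<Rightarrow> ('k :: field, 'k mpoly, 'g) fg_module" where
  "sym_dual G s m n =
    \<lparr> carrier = {f. \<forall>e \<in> Poly_Mapping.keys f.
                   Poly_Mapping.keys e \<subseteq> {..<m} \<and>
                   (\<Sum>i \<in> Poly_Mapping.keys e. Poly_Mapping.lookup e i) = n},
      mult = undefined,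
      one = undefined,
      zero = 0,
      add = (+),
      smult = (\<lambda>c f. mconst c * f),
      action = (\<lambda>g. msubst (coord_action G s m g)) \<rparr>"


section \<open>Multiplicities\<close>

definition summand_dim :: "nat \<Rightarrow> nat \<Rightarrow> nat" where
  "summand_dim p n = (n mod p) * p + (n div p) mod p + 1"

text \<open>
  The field does not occur in the type of the multiplicities, so it is passed as a type argument.
  Both descriptions below determine the multiplicities uniquely by the Krull-Schmidt theorem.
\<close>

definition a_mult ::
  "'k :: field itself \<Rightarrow> ('g, 'x) monoid_scheme \<Rightarrow> 'g \<Rightarrow> nat \<Rightarrow> nat \<Rightarrow> nat \<Rightarrow> nat" where
  "a_mult _ G s p n =
     (THE a. (\<forall>i. i \<notin> {1..p} \<longrightarrow> a i = 0) \<and>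
        fg_iso G (sym_dual G s (p + 1) n :: ('k, 'k mpoly, 'g) fg_module)
          (direct_sum (jordan_module G s (summand_dim p n) #
             concat (map (\<lambda>i. replicate (a i) (jordan_module G s (i * p))) [1..<p + 1]))))"

text \<open>
  The multiplicity of each \<open>V\<^sub>m\<close> in \<open>M\<close>, for \<open>M\<close> a finite-dimensional module of the cyclic group
  \<open>G\<close> of order \<open>p\<^sup>2\<close>, whose indecomposable modules are \<open>V\<^sub>1, \<dots>, V\<^bsub>p\<^sup>2\<^esub>\<close>.
\<close>

definition summand_mult ::
  "('g, 'x) monoid_scheme \<Rightarrow> 'g \<Rightarrow> nat \<Rightarrow> ('k :: field, 'v, 'g) fg_module \<Rightarrow> nat \<Rightarrow> nat" where
  "summand_mult G s p M =
     (THE c. (\<forall>m. m \<notin> {1..p\<^sup>2} \<longrightarrow> c m = 0) \<and>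
        fg_iso G M (direct_sum (concat (map (\<lambda>m. replicate (c m) (jordan_module G s m)) [1..<p\<^sup>2 + 1]))))"

definition b_mult ::
  "'k :: field itself \<Rightarrow> ('g, 'x) monoid_scheme \<Rightarrow> 'g \<Rightarrow> nat \<Rightarrow> nat \<Rightarrow> nat \<Rightarrow> nat" where
  "b_mult _ G s p n i =
     summand_mult G s p (sym_dual G s (p + 1) n :: ('k, 'k mpoly, 'g) fg_module) (i * p)"

definition A_series ::
  "'k :: field itself \<Rightarrow> ('g, 'x) monoid_scheme \<Rightarrow> 'g \<Rightarrow> nat \<Rightarrow> nat \<Rightarrow> rat fps" where
  "A_series K G s p i = Abs_fps (\<lambda>n. of_nat (a_mult K G s p n i))"

definition B_series ::
  "'k :: field itself \<Rightarrow> ('g, 'x) monoid_scheme \<Rightarrow> 'g \<Rightarrow> nat \<Rightarrow> nat \<Rightarrow> rat fps" where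
  "B_series K G s p i = Abs_fps (\<lambda>n. of_nat (b_mult K G s p n i))"

end

(*
Let t = s - 1. Over a suitable basis of the dual module, F[V_{p+1}] becomes F[w_0, ..., w_{p-1}][Y],
where s permutes the w_i cyclically and sends Y to Y + w_0. Put z = w_0 + ... + w_{p-1} and u = t^p,
which is the difference operator Y -> Y + z minus the identity, and let T = ker u.

Falling factorials in Y with step z show that (im u^a) /\ (ker u) = z^a T for a < p. So the number of
blocks of size at least ap + j (1 <= j <= p) in degree n is the number of blocks of size at least j
in T_{n-a}, where T is a module for F[t]/(t^p).

Furthermore T = A[N] with A = F[w_0, ..., w_{p-1}] and N = Y^p - z^{p-1} Y. As A is a permutation
module, A_d is free if p does not divide d, and free plus a trivial summand otherwise. Filter T by
the degree in N. An invariant with leading coefficient nu^j, nu = w_0 ... w_{p-1}, and N-degree k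
must have p | k: the coefficient of nu in tN is -(p-1)!, hence nonzero (it is 1 by Wilson). So every p
consecutive layers contribute at most one non-free summand, and a dimension count modulo p shows
that they contribute none. Hence T_m has at most one non-free summand and its block sizes are
determined by dim T_m alone, whose generating function is 1 / ((1-x)^p (1-x^p)).
*)

theory Submission
  imports Defs "HOL-Algebra.Multiplicative_Group"
begin

section \<open>Jordan chains of a nilpotent operator\<close>

text \<open>Y is the coordinate function \<open>x_0\<close>, which generates the dual module, and
  w_0 = tY. The subspace im t has dimension p and is killed by t^p, so it is the regular module of
  the quotient of order p, with the w_i as the orbit of w_0. On A, t^(p-1) is the sum over the
  rotations.

  The obstacle is that the layers of T_m do not determine T_m: if p divides m, each of them has a
  trivial summand, and these need not split off. So no decomposition of T_m is constructed. Only the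
  quotient ker t / im t^(p-1) is followed through the filtration, because a bound of 1 on its
  dimension leaves room for a single chain shorter than p, whose length is then the dimension modulo
  p.

  The multiplicities are defined by descriptions that presuppose the Krull-Schmidt theorem. In its
  place stands the fact that the dimension of the intersection of im t^k and ker t counts the Jordan
  blocks longer than k in any decomposition. That number involves no choice of basis, so the block
  sizes are unique.\<close>

locale linear_operator = vector_space scale
  for scale :: "'k::field \<Rightarrow> 'v::ab_group_add \<Rightarrow> 'v" (infixr \<open>*s\<close> 75) +
  fixes t :: "'v \<Rightarrow> 'v"
  assumes t_add: "t (x + y) = t x + t y"
    and t_scale: "t (c *s x) = c *s t x"
begin

lemma funpow_add: "(t ^^ n) (x + y) = (t ^^ n) x + (t ^^ n) y"
  by (induction n) (simp_all add: t_add)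

lemma funpow_scale: "(t ^^ n) (c *s x) = c *s (t ^^ n) x"
  by (induction n) (simp_all add: t_scale)

lemma funpow_zero: "(t ^^ n) 0 = 0"
  using funpow_scale[of n 0 0] by simp

lemma t_zero: "t 0 = 0"
  using funpow_zero[of 1] by simp

lemma funpow_uminus: "(t ^^ n) (- x) = - (t ^^ n) x"
  using funpow_scale[of n "- 1" x] by simp

lemma funpow_diff: "(t ^^ n) (x - y) = (t ^^ n) x - (t ^^ n) y"
  using funpow_add[of n x "- y"] by (simp add: funpow_uminus)

lemma t_diff: "t (x - y) = t x - t y"
  using funpow_diff[of 1] by simp

lemma funpow_sum: "(t ^^ n) (sum f I) = (\<Sum>i\<in>I. (t ^^ n) (f i))"
  by (induction I rule: infinite_finite_induct) (simp_all add: funpow_zero funpow_add)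

lemma t_sum: "t (sum f I) = (\<Sum>i\<in>I. t (f i))"
  using funpow_sum[of 1] by simp

lemma funpow_eq_0_mono: "(t ^^ m) x = 0 \<Longrightarrow> m \<le> n \<Longrightarrow> (t ^^ n) x = 0"
  using Nat.funpow_add[of "n - m" m t] by (simp add: funpow_zero)

definition chain_sum :: "'v set \<Rightarrow> ('v \<Rightarrow> nat) \<Rightarrow> ('v \<Rightarrow> nat \<Rightarrow> 'k) \<Rightarrow> 'v" where
  "chain_sum H l c = (\<Sum>v\<in>H. \<Sum>k<l v. c v k *s (t ^^ k) v)"

text \<open>A Jordan basis, encoded by the heads of its chains and their lengths. Independence is
  over index pairs (v, k), so it also forces the vectors \<open>(t ^^ k) v\<close> with
  \<open>k < l v\<close> to be distinct and nonzero.\<close>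

definition chain_basis :: "'v set \<Rightarrow> 'v set \<Rightarrow> ('v \<Rightarrow> nat) \<Rightarrow> bool" where
  "chain_basis W H l \<longleftrightarrow> finite H \<and> (\<forall>v\<in>H. v \<in> W \<and> l v \<ge> 1 \<and> (t ^^ l v) v = 0) \<and>
     (\<forall>c. chain_sum H l c = 0 \<longrightarrow> (\<forall>v\<in>H. \<forall>k<l v. c v k = 0)) \<and>
     (\<forall>w\<in>W. \<exists>c. w = chain_sum H l c)"

definition invariant_subspace :: "'v set \<Rightarrow> bool" where
  "invariant_subspace W \<longleftrightarrow> subspace W \<and> t ` W \<subseteq> W"

lemma invariant_funpow: "invariant_subspace W \<Longrightarrow> w \<in> W \<Longrightarrow> (t ^^ n) w \<in> W"
  by (induction n) (auto simp: invariant_subspace_def)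

lemma chain_sum_in: "invariant_subspace W \<Longrightarrow> H \<subseteq> W \<Longrightarrow> chain_sum H l c \<in> W"
  unfolding chain_sum_def
  by (intro subspace_sum subspace_scale invariant_funpow) (auto simp: invariant_subspace_def)

lemma chain_sum_cong:
  "(\<And>v k. v \<in> H \<Longrightarrow> k < l v \<Longrightarrow> c v k = d v k) \<Longrightarrow> chain_sum H l c = chain_sum H l d"
  unfolding chain_sum_def by (intro sum.cong) auto

lemma chain_sum_diff: "chain_sum H l c - chain_sum H l d = chain_sum H l (\<lambda>v k. c v k - d v k)"
  by (simp add: chain_sum_def sum_subtractf scale_left_diff_distrib)

lemma chain_sum_add: "chain_sum H l c + chain_sum H l d = chain_sum H l (\<lambda>v k. c v k + d v k)"
  by (simp add: chain_sum_def sum.distrib scale_left_distrib)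

lemma chain_sum_scale: "a *s chain_sum H l c = chain_sum H l (\<lambda>v k. a * c v k)"
  by (simp add: chain_sum_def scale_sum_right)

lemma funpow_chain_sum:
  assumes "chain_basis W H l"
  shows "(t ^^ j) (chain_sum H l c) = (\<Sum>v\<in>H. \<Sum>k<l v. (if j \<le> k then c v (k - j) else 0) *s (t ^^ k) v)"
proof -
  have "(\<Sum>k<l v. (t ^^ j) (c v k *s (t ^^ k) v)) = (\<Sum>k<l v. (if j \<le> k then c v (k - j) else 0) *s (t ^^ k) v)"
    if v: "v \<in> H" for v
  proof -
    have z: "(t ^^ k) v = 0" if "k \<ge> l v" for k
      using assms v that funpow_eq_0_mono unfolding chain_basis_def by blast
    have "(\<Sum>k<l v. (t ^^ j) (c v k *s (t ^^ k) v)) = (\<Sum>k<l v. c v k *s (t ^^ (k + j)) v)"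
      by (simp add: funpow_scale Nat.funpow_add add.commute[of _ j])
    also have "\<dots> = (\<Sum>k\<in>{j..<l v + j}. c v (k - j) *s (t ^^ k) v)"
      by (rule sum.reindex_bij_witness[of _ "\<lambda>k. k - j" "\<lambda>k. k + j"]) auto
    also have "\<dots> = (\<Sum>k\<in>{j..<l v}. c v (k - j) *s (t ^^ k) v)"
      by (rule sum.mono_neutral_right) (auto simp: z)
    also have "\<dots> = (\<Sum>k<l v. (if j \<le> k then c v (k - j) else 0) *s (t ^^ k) v)"
      by (rule sum.mono_neutral_cong_left) auto
    finally show ?thesis .
  qed
  then show ?thesis by (simp add: chain_sum_def funpow_sum)
qed

lemma chain_basis_coeff_0:
  "chain_basis W H l \<Longrightarrow> chain_sum H l c = 0 \<Longrightarrow> v \<in> H \<Longrightarrow> k < l v \<Longrightarrow> c v k = 0"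
  unfolding chain_basis_def by blast

lemma chain_basis_coeff_unique:
  assumes "chain_basis W H l" "chain_sum H l c = chain_sum H l d" "v \<in> H" "k < l v"
  shows "c v k = d v k"
proof -
  have "chain_sum H l (\<lambda>v k. c v k - d v k) = 0"
    using assms(2) by (simp flip: chain_sum_diff)
  from chain_basis_coeff_0[OF assms(1) this assms(3,4)] show ?thesis by simp
qed

lemma chain_basis_in: "chain_basis W H l \<Longrightarrow> H \<subseteq> W"
  by (auto simp: chain_basis_def)

text \<open>Induction on \<open>N\<close>: each chain of the image of \<open>W\<close> under t is
  lengthened by a preimage of its head. The last vectors of these chains are then completed to a
  basis of ker t in \<open>W\<close>, and every new basis vector is a chain of length 1.\<close>

lemma ex_chain_basis:
  assumes "invariant_subspace W" "finite F" "W \<subseteq> span F" "\<And>w. w \<in> W \<Longrightarrow> (t ^^ N) w = 0"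
  shows "\<exists>H l. chain_basis W H l"
  using assms
proof (induction N arbitrary: W F)
  case 0
  then have "w = 0" if "w \<in> W" for w using that by auto
  then have "chain_basis W {} (\<lambda>_. 0)" by (auto simp: chain_basis_def chain_sum_def)
  then show ?case by blast
next
  case (Suc N)
  have W: "subspace W" "\<And>w. w \<in> W \<Longrightarrow> t w \<in> W" using Suc.prems(1) by (auto simp: invariant_subspace_def)
  define W' where "W' = t ` W"
  have W'sub: "W' \<subseteq> W" using W by (auto simp: W'_def)
  have "subspace W'" unfolding W'_def
  proof (rule subspaceI)
    show "0 \<in> t ` W" using W(1) t_zero subspace_0 by (metis imageI)
  next
    fix x y assume "x \<in> t ` W" "y \<in> t ` W"
    then show "x + y \<in> t ` W" using W(1) subspace_add t_add by (metis (no_types, lifting) image_iff)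
  next
    fix c x assume "x \<in> t ` W" then show "c *s x \<in> t ` W" using W(1) subspace_scale t_scale
      by (metis (no_types, lifting) image_iff)
  qed
  then have inv': "invariant_subspace W'" using W'sub W by (auto simp: invariant_subspace_def W'_def)
  have "(t ^^ N) w = 0" if "w \<in> W'" for w
    using that Suc.prems(4) by (auto simp: W'_def funpow_swap1)
  then obtain H' l' where cb: "chain_basis W' H' l'"
    using Suc.IH[OF inv' Suc.prems(2)] W'sub Suc.prems(3) by blast
  have H': "finite H'" "\<And>v. v \<in> H' \<Longrightarrow> v \<in> W'" "\<And>v. v \<in> H' \<Longrightarrow> l' v \<ge> 1" "\<And>v. v \<in> H' \<Longrightarrow> (t ^^ l' v) v = 0"
    and ind': "\<And>c v k. chain_sum H' l' c = 0 \<Longrightarrow> v \<in> H' \<Longrightarrow> k < l' v \<Longrightarrow> c v k = 0"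
    and span': "\<And>w. w \<in> W' \<Longrightarrow> \<exists>c. w = chain_sum H' l' c"
    using cb unfolding chain_basis_def by blast+
  have "\<forall>v\<in>H'. \<exists>u. u \<in> W \<and> t u = v" using H'(2) unfolding W'_def by blast
  then obtain g where "\<forall>v\<in>H'. g v \<in> W \<and> t (g v) = v" by (rule bchoice[THEN exE])
  then have g: "\<And>v. v \<in> H' \<Longrightarrow> g v \<in> W \<and> t (g v) = v" by blast
  have tg: "t (g v) = v" "g v \<in> W" if "v \<in> H'" for v using g that by auto
  have ginj: "inj_on g H'" by (metis inj_onI tg(1))
  have tgk: "(t ^^ Suc k) (g v) = (t ^^ k) v" if "v \<in> H'" for v k using tg(1)[OF that] by (simp add: funpow_swap1)
  have nz: "v \<noteq> 0" if "v \<in> H'" for v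
  proof
    assume v0: "v = 0"
    define c where "c = (\<lambda>w k::nat. if w = v then 1 else 0 :: 'k)"
    have "chain_sum H' l' c = 0" unfolding chain_sum_def c_def using v0 funpow_zero
      by (intro sum.neutral ballI) auto
    from ind'[OF this that, of 0] H'(3)[OF that] show False by (simp add: c_def)
  qed
  let ?K = "{w\<in>W. t w = 0}"
  \<comment> \<open>The last vector of the lengthened chain. It is also the last vector of the old
    chain, so independence is inherited from \<open>H'\<close>.\<close>
  define top where "top v = (t ^^ (l' v)) (g v)" for v
  have top: "top v = (t ^^ (l' v - 1)) v" if "v \<in> H'" for v
    using tgk[OF that, of "l' v - 1"] H'(3)[OF that] by (simp add: top_def)
  have comb: "(\<Sum>v\<in>H'. a v *s top v) = chain_sum H' l' (\<lambda>v k. if k = l' v - 1 then a v else 0)" for a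
    unfolding chain_sum_def
  proof (intro sum.cong refl)
    fix v assume v: "v \<in> H'"
    have "(\<Sum>k<l' v. (if k = l' v - 1 then a v else 0) *s (t ^^ k) v)
       = (\<Sum>k<l' v. if k = l' v - 1 then a v *s (t ^^ k) v else 0)" by (intro sum.cong) auto
    also have "\<dots> = a v *s top v" using H'(3)[OF v] by (simp add: top[OF v])
    finally show "a v *s top v = (\<Sum>k<l' v. (if k = l' v - 1 then a v else 0) *s (t ^^ k) v)" by simp
  qed
  have topind: "a v = 0" if "(\<Sum>v\<in>H'. a v *s top v) = 0" "v \<in> H'" for a v
    using ind'[OF that(1)[unfolded comb] that(2), of "l' v - 1"] H'(3)[OF that(2)] by auto
  have topinj: "inj_on top H'"
  proof (rule inj_onI, rule ccontr)
    fix v w assume vw: "v \<in> H'" "w \<in> H'" "top v = top w" "v \<noteq> w"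
    define a where "a = (\<lambda>u. if u = v then 1 else if u = w then -1 else 0 :: 'k)"
    have "(\<Sum>u\<in>H'. a u *s top u) = (\<Sum>u\<in>{v,w}. a u *s top u)"
      by (rule sum.mono_neutral_right) (use H'(1) vw in \<open>auto simp: a_def\<close>)
    also have "\<dots> = 0" using vw by (simp add: a_def)
    finally have "a v = 0" using topind vw by blast
    then show False by (simp add: a_def)
  qed
  have topI: "independent (top ` H')"
  proof (rule independent_if_scalars_zero)
    show "finite (top ` H')" using H'(1) by simp
    fix f x assume s: "(\<Sum>x\<in>top ` H'. f x *s x) = 0" and x: "x \<in> top ` H'"
    have "(\<Sum>v\<in>H'. f (top v) *s top v) = 0" using s by (simp add: sum.reindex[OF topinj])
    then show "f x = 0" using topind[of "\<lambda>v. f (top v)"] x by auto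
  qed
  have topK: "top ` H' \<subseteq> ?K"
  proof safe
    fix v assume v: "v \<in> H'"
    show "top v \<in> W" unfolding top_def by (rule invariant_funpow[OF Suc.prems(1) tg(2)[OF v]])
    have "t (top v) = (t ^^ Suc (l' v)) (g v)" by (simp add: top_def)
    then show "t (top v) = 0" using tgk[OF v] H'(4)[OF v] by simp
  qed
  obtain B where B: "top ` H' \<subseteq> B" "B \<subseteq> ?K" "independent B" "?K \<subseteq> span B"
    by (rule maximal_independent_subset_extend[OF topK topI])
  have "finite B" using independent_span_bound[OF Suc.prems(2) B(3)] B(2) Suc.prems(3) by blast
  define U where "U = B - top ` H'"
  have U: "finite U" "U \<subseteq> ?K" "U \<inter> top ` H' = {}" using \<open>finite B\<close> B by (auto simp: U_def)
  define H where "H = g ` H' \<union> U"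
  define l where "l u = (if u \<in> g ` H' then Suc (l' (t u)) else 1)" for u
  \<comment> \<open>t sends a lifted head to a head in \<open>H'\<close>, which is nonzero, but it
    kills \<open>U\<close>.\<close>
  have disj: "g ` H' \<inter> U = {}" using U(2) tg nz by auto
  have lg: "l (g v) = Suc (l' v)" if "v \<in> H'" for v using that tg(1) by (simp add: l_def)
  have lU: "l u = 1" if "u \<in> U" for u using that disj by (auto simp: l_def)
  have split: "chain_sum H l c = (\<Sum>v\<in>H'. \<Sum>k<Suc (l' v). c (g v) k *s (t ^^ k) (g v)) + (\<Sum>u\<in>U. c u 0 *s u)" for c
  proof -
    have "chain_sum H l c = (\<Sum>v\<in>g ` H'. \<Sum>k<l v. c v k *s (t ^^ k) v) + (\<Sum>v\<in>U. \<Sum>k<l v. c v k *s (t ^^ k) v)"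
      unfolding chain_sum_def H_def by (rule sum.union_disjoint) (use H'(1) U(1) disj in auto)
    moreover have "(\<Sum>v\<in>g ` H'. \<Sum>k<l v. c v k *s (t ^^ k) v) = (\<Sum>v\<in>H'. \<Sum>k<Suc (l' v). c (g v) k *s (t ^^ k) (g v))"
      unfolding sum.reindex[OF ginj] comp_def by (intro sum.cong) (simp_all add: lg)
    moreover have "(\<Sum>v\<in>U. \<Sum>k<l v. c v k *s (t ^^ k) v) = (\<Sum>u\<in>U. c u 0 *s u)"
      by (intro sum.cong) (simp_all add: lU)
    ultimately show ?thesis by simp
  qed
  have tsplit: "t (chain_sum H l c) = chain_sum H' l' (\<lambda>v k. c (g v) k)" for c
  proof -
    have "t (\<Sum>u\<in>U. c u 0 *s u) = 0" using U(2) by (auto simp: t_sum t_scale intro!: sum.neutral)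
    moreover have "t (\<Sum>k<Suc (l' v). c (g v) k *s (t ^^ k) (g v)) = (\<Sum>k<l' v. c (g v) k *s (t ^^ k) v)"
      if v: "v \<in> H'" for v
    proof -
      have "t (\<Sum>k<Suc (l' v). c (g v) k *s (t ^^ k) (g v)) = (\<Sum>k<Suc (l' v). c (g v) k *s (t ^^ k) v)"
        using tgk[OF v] by (simp add: t_sum t_scale t_add)
      then show ?thesis using H'(4)[OF v] by simp
    qed
    ultimately show ?thesis
      unfolding split t_add t_sum[of _ H'] chain_sum_def[of H'] by (simp del: sum.lessThan_Suc)
  qed
  have "chain_basis W H l"
    unfolding chain_basis_def
  proof (intro conjI ballI allI impI)
    show "finite H" using H'(1) U(1) by (simp add: H_def)
  next
    fix v assume "v \<in> H" then show "v \<in> W" using tg U by (auto simp: H_def)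
  next
    fix v assume "v \<in> H" then show "1 \<le> l v" by (auto simp: l_def)
  next
    fix v assume "v \<in> H"
    then consider v' where "v' \<in> H'" "v = g v'" | "v \<in> U" by (auto simp: H_def)
    then show "(t ^^ l v) v = 0"
    proof cases
      case 1 then show ?thesis using tgk[OF 1(1)] H'(4)[OF 1(1)] lg[OF 1(1)] by simp
    next
      case 2 then show ?thesis using lU U by auto
    qed
  next
    fix c v k assume s0: "chain_sum H l c = 0" and v: "v \<in> H" and k: "k < l v"
    \<comment> \<open>Applying t leaves a relation among the old chains. It settles all coefficients
      except those of the last vectors and of \<open>U\<close>, and these form a relation over the
      basis \<open>B\<close> of the kernel.\<close>
    have "chain_sum H' l' (\<lambda>v k. c (g v) k) = 0" using tsplit[of c] s0 t_zero by simp
    then have low: "c (g v) k = 0" if "v \<in> H'" "k < l' v" for v k using ind' that by blast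
    have "(\<Sum>v\<in>H'. \<Sum>k<Suc (l' v). c (g v) k *s (t ^^ k) (g v)) = (\<Sum>v\<in>H'. c (g v) (l' v) *s top v)"
      by (intro sum.cong refl) (simp add: top_def low)
    then have e: "(\<Sum>v\<in>H'. c (g v) (l' v) *s top v) + (\<Sum>u\<in>U. c u 0 *s u) = 0" using s0 split by simp
    define f where "f x = (if x \<in> U then c x 0 else c (g (the_inv_into H' top x)) (l' (the_inv_into H' top x)))" for x
    have ft: "f (top v) = c (g v) (l' v)" if "v \<in> H'" for v
      using that U(3) by (auto simp: f_def the_inv_into_f_f[OF topinj])
    have Beq: "B = top ` H' \<union> U" using B(1) by (auto simp: U_def)
    have "(\<Sum>x\<in>B. f x *s x) = (\<Sum>x\<in>top ` H'. f x *s x) + (\<Sum>x\<in>U. f x *s x)"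
      unfolding Beq by (rule sum.union_disjoint) (use H'(1) U in auto)
    also have "\<dots> = 0"
      using e by (simp add: sum.reindex[OF topinj] ft) (simp add: f_def)
    finally have f0: "f x = 0" if "x \<in> B" for x
      using independentD[OF B(3) \<open>finite B\<close>] that by blast
    from v consider v' where "v' \<in> H'" "v = g v'" | "v \<in> U" by (auto simp: H_def)
    then show "c v k = 0"
    proof cases
      case 1
      then show ?thesis using low[OF 1(1)] k lg[OF 1(1)] f0[of "top v'"] ft[OF 1(1)] B(1)
        by (cases "k = l' v'") auto
    next
      case 2
      then show ?thesis using k lU f0[of v] by (auto simp: f_def Beq)
    qed
  next
    fix w assume w: "w \<in> W"
    then obtain c' where c': "t w = chain_sum H' l' c'" using span'[of "t w"] by (auto simp: W'_def)
    \<comment> \<open>The coefficients of \<open>t w\<close>, placed on the lifted heads, give an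
      element with the same image under t as \<open>w\<close>. The difference is expanded over
      \<open>B\<close>; a vector \<open>top v\<close> in it belongs to the last place of its
      chain.\<close>
    define c where "c u k = (if u \<in> g ` H' then c' (t u) k else 0)" for u k
    have cg: "c (g v) k = c' v k" if "v \<in> H'" for v k using that tg by (simp add: c_def)
    have HW: "H \<subseteq> W" using tg U by (auto simp: H_def)
    have "t (chain_sum H l c) = t w" unfolding tsplit c' by (rule chain_sum_cong) (simp add: cg)
    then have "t (w - chain_sum H l c) = 0" by (simp add: t_diff)
    moreover have "w - chain_sum H l c \<in> W" using w W(1) chain_sum_in[OF Suc.prems(1) HW] subspace_diff by blast
    ultimately have "w - chain_sum H l c \<in> span B" using B(4) by blast
    then obtain f where f: "w - chain_sum H l c = (\<Sum>x\<in>B. f x *s x)" 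
      using \<open>finite B\<close> by (auto simp: span_finite)
    define d where "d u k = (if u \<in> g ` H' then if k = l' (t u) then f (top (t u)) else 0 else f u)" for u k
    have "chain_sum H l d = (\<Sum>v\<in>H'. f (top v) *s top v) + (\<Sum>u\<in>U. f u *s u)"
    proof -
      have "(\<Sum>k<Suc (l' v). d (g v) k *s (t ^^ k) (g v)) = f (top v) *s top v" if v: "v \<in> H'" for v
        using v tg by (simp add: d_def top_def)
      moreover have "d u 0 = f u" if "u \<in> U" for u using that disj by (auto simp: d_def)
      ultimately show ?thesis by (simp add: split)
    qed
    also have "\<dots> = (\<Sum>x\<in>B. f x *s x)"
    proof -
      have Beq: "B = top ` H' \<union> U" using B(1) by (auto simp: U_def)
      have "(\<Sum>x\<in>B. f x *s x) = (\<Sum>x\<in>top ` H'. f x *s x) + (\<Sum>x\<in>U. f x *s x)"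
        unfolding Beq by (rule sum.union_disjoint) (use H'(1) U in auto)
      then show ?thesis by (simp add: sum.reindex[OF topinj])
    qed
    finally have "w = chain_sum H l (\<lambda>v k. c v k + d v k)" using f chain_sum_add by (metis add.commute diff_add_cancel)
    then show "\<exists>c. w = chain_sum H l c" by blast
  qed
  then show ?case by blast
qed

text \<open>For a basis given as an indexed family. Injectivity of the indexing is derived from the
  independence, so no user has to show it.\<close>

lemma dim_family:
  assumes fin: "finite I" and ind: "\<And>a x. (\<Sum>x\<in>I. a x *s b x) = 0 \<Longrightarrow> x \<in> I \<Longrightarrow> a x = 0"
    and sub: "b ` I \<subseteq> W" and span: "\<And>w. w \<in> W \<Longrightarrow> \<exists>a. w = (\<Sum>x\<in>I. a x *s b x)"
  shows "dim W = card I" "finite (b ` I)" "W \<subseteq> local.span (b ` I)"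
proof -
  have binj: "inj_on b I"
  proof (rule inj_onI, rule ccontr)
    fix v w assume vw: "v \<in> I" "w \<in> I" "b v = b w" "v \<noteq> w"
    define a where "a = (\<lambda>u. if u = v then 1 else if u = w then -1 else 0 :: 'k)"
    have "(\<Sum>u\<in>I. a u *s b u) = (\<Sum>u\<in>{v,w}. a u *s b u)"
      by (rule sum.mono_neutral_right) (use fin vw in \<open>auto simp: a_def\<close>)
    also have "\<dots> = 0" using vw by (simp add: a_def)
    finally have "a v = 0" by (rule ind) (fact vw(1))
    then show False by (simp add: a_def)
  qed
  have ib: "independent (b ` I)"
  proof (rule independent_if_scalars_zero)
    show "finite (b ` I)" using fin by simp
    fix f x assume s: "(\<Sum>x\<in>b ` I. f x *s x) = 0" and x: "x \<in> b ` I"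
    have "(\<Sum>v\<in>I. f (b v) *s b v) = 0" using s by (simp add: sum.reindex[OF binj])
    with ind[of "\<lambda>v. f (b v)"] have "\<And>v. v \<in> I \<Longrightarrow> f (b v) = 0" .
    then show "f x = 0" using x by auto
  qed
  show sp: "W \<subseteq> local.span (b ` I)"
  proof
    fix w assume "w \<in> W"
    then obtain a where "w = (\<Sum>x\<in>I. a x *s b x)" using span by blast
    also have "\<dots> \<in> local.span (b ` I)" by (intro span_sum span_scale span_base) auto
    finally show "w \<in> local.span (b ` I)" .
  qed
  show "finite (b ` I)" using fin by simp
  have "dim W = card (b ` I)" using basis_card_eq_dim[OF sub sp ib] by simp
  then show "dim W = card I" by (simp add: card_image[OF binj])
qed

text \<open>The last vectors of the chains longer than \<open>j\<close> are a basis of this space.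
  The left-hand side does not mention the chains, so the block sizes do not depend on the choice of
  a Jordan basis.\<close>

lemma card_chains_longer:
  assumes inv: "invariant_subspace W" and cb: "chain_basis W H l"
  shows "dim {x \<in> (t ^^ j) ` W. t x = 0} = card {v\<in>H. j < l v}"
proof -
  let ?X = "{x \<in> (t ^^ j) ` W. t x = 0}" and ?J = "{v\<in>H. j < l v}"
  define top where "top v = (t ^^ (l v - 1)) v" for v
  have fin: "finite H" and l1: "\<And>v. v \<in> H \<Longrightarrow> l v \<ge> 1" and end0: "\<And>v. v \<in> H \<Longrightarrow> (t ^^ l v) v = 0"
    and HW: "\<And>v. v \<in> H \<Longrightarrow> v \<in> W"
    using cb unfolding chain_basis_def by blast+
  have comb: "(\<Sum>v\<in>?J. a v *s top v) = chain_sum H l (\<lambda>v k. if j < l v \<and> k = l v - 1 then a v else 0)" for a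
  proof -
    have "(\<Sum>k<l v. (if j < l v \<and> k = l v - 1 then a v else 0) *s (t ^^ k) v) = (if j < l v then a v *s top v else 0)"
      if "v \<in> H" for v
    proof -
      have "(\<Sum>k<l v. (if j < l v \<and> k = l v - 1 then a v else 0) *s (t ^^ k) v)
         = (\<Sum>k<l v. if k = l v - 1 then (if j < l v then a v *s (t ^^ k) v else 0) else 0)" by (intro sum.cong) auto
      then show ?thesis using l1[OF that] by (simp add: top_def)
    qed
    then show ?thesis by (simp add: chain_sum_def sum.inter_filter[OF fin])
  qed
  have ind: "a v = 0" if "(\<Sum>v\<in>?J. a v *s top v) = 0" "v \<in> ?J" for a v
    using chain_basis_coeff_0[OF cb that(1)[unfolded comb], of v "l v - 1"] that(2) l1[of v] by auto
  have sub: "top ` ?J \<subseteq> ?X"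
  proof safe
    fix v assume v: "v \<in> H" "j < l v"
    have "top v = (t ^^ j) ((t ^^ (l v - 1 - j)) v)" using v(2) 
      by (simp add: top_def flip: comp_apply[of "t ^^ j"] Nat.funpow_add)
    then show "top v \<in> (t ^^ j) ` W" using invariant_funpow[OF inv HW[OF v(1)]] by blast
    have "t (top v) = (t ^^ Suc (l v - 1)) v" by (simp add: top_def)
    then show "t (top v) = 0" using end0[OF v(1)] l1[OF v(1)] by simp
  qed
  have span: "\<exists>a. x = (\<Sum>v\<in>?J. a v *s top v)" if "x \<in> ?X" for x
  proof -
    obtain w where x: "x = (t ^^ j) w" and w: "w \<in> W" and t0: "t ((t ^^ j) w) = 0" using \<open>x \<in> ?X\<close> by blast
    obtain c where c: "w = chain_sum H l c" using cb w unfolding chain_basis_def by blast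
    \<comment> \<open>After one more t all shifted coefficients vanish. In \<open>(t ^^ j) w\<close>
      this leaves only the last place of each chain.\<close>
    have "(t ^^ Suc j) w = 0" using t0 by simp
    then have "chain_sum H l (\<lambda>v k. if Suc j \<le> k then c v (k - Suc j) else 0) = 0"
      using funpow_chain_sum[OF cb, of "Suc j" c] by (simp add: c chain_sum_def)
    then have z: "c v (k - Suc j) = 0" if "v \<in> H" "k < l v" "Suc j \<le> k" for v k
      using chain_basis_coeff_0[OF cb] that by fastforce
    have "(t ^^ j) w = chain_sum H l (\<lambda>v k. if j \<le> k then c v (k - j) else 0)"
      using funpow_chain_sum[OF cb, of j c] by (simp add: c chain_sum_def)
    also have "\<dots> = chain_sum H l (\<lambda>v k. if j < l v \<and> k = l v - 1 then c v (l v - 1 - j) else 0)"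
    proof (rule chain_sum_cong)
      fix v k assume v: "v \<in> H" and k: "k < l v"
      show "(if j \<le> k then c v (k - j) else 0) = (if j < l v \<and> k = l v - 1 then c v (l v - 1 - j) else 0)"
      proof (cases "k = l v - 1")
        case True then show ?thesis using k by auto
      next
        case False
        then have "Suc k < l v" using k by simp
        then show ?thesis using z[OF v, of "Suc k"] False by simp
      qed
    qed
    also have "\<dots> = (\<Sum>v\<in>?J. c v (l v - 1 - j) *s top v)" by (rule comb[symmetric])
    finally show ?thesis unfolding x by (rule exI[of _ "\<lambda>v. c v (l v - 1 - j)"])
  qed
  have finJ: "finite ?J" using fin by simp
  show ?thesis
    by (rule dim_family(1)[where b = top]; (rule finJ sub | (erule ind, assumption) | erule span))
qed

lemma dim_chain_basis:
  assumes inv: "invariant_subspace W" and cb: "chain_basis W H l"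
  shows "dim W = (\<Sum>v\<in>H. l v)"
proof -
  define I where "I = (SIGMA v:H. {..<l v})"
  define b where "b = (\<lambda>(v,k). (t ^^ k) v)"
  have fin: "finite H" using cb by (simp add: chain_basis_def)
  have finI: "finite I" using fin by (simp add: I_def)
  have sumI: "(\<Sum>x\<in>I. a x *s b x) = chain_sum H l (\<lambda>v k. a (v,k))" for a
    unfolding I_def chain_sum_def b_def using sum.Sigma[OF fin, of "\<lambda>v. {..<l v}" "\<lambda>v k. a (v, k) *s (t ^^ k) v"]
    by (simp add: split_def)
  have ind: "a x = 0" if "(\<Sum>x\<in>I. a x *s b x) = 0" "x \<in> I" for a x
    using chain_basis_coeff_0[OF cb that(1)[unfolded sumI]] that(2) by (auto simp: I_def)
  have sub: "b ` I \<subseteq> W" using invariant_funpow[OF inv] chain_basis_in[OF cb] by (auto simp: I_def b_def)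
  have span: "\<exists>a. w = (\<Sum>x\<in>I. a x *s b x)" if "w \<in> W" for w
  proof -
    obtain c where "w = chain_sum H l c" using cb \<open>w \<in> W\<close> unfolding chain_basis_def by blast
    also have "\<dots> = (\<Sum>x\<in>I. (\<lambda>(v,k). c v k) x *s b x)" unfolding sumI by simp
    finally show ?thesis by blast
  qed
  have "dim W = card I"
    by (rule dim_family(1)[where b = b]; (rule finI sub | (erule ind, assumption) | erule span))
  then show ?thesis by (simp add: I_def fin)
qed

end

section \<open>Polynomials in several variables\<close>

abbreviation keys where "keys \<equiv> Poly_Mapping.keys"
abbreviation lookup where "lookup \<equiv> Poly_Mapping.lookup"
abbreviation single where "single \<equiv> Poly_Mapping.single"

lemma CHAR_poly_mapping: "CHAR(('a::comm_monoid_add) \<Rightarrow>\<^sub>0 'b::comm_semiring_1) = CHAR('b)"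
proof (rule CHAR_eqI)
  have "(of_nat n :: 'a \<Rightarrow>\<^sub>0 'b) = 0 \<longleftrightarrow> (of_nat n :: 'b) = 0" for n
  proof
    assume "(of_nat n :: 'a \<Rightarrow>\<^sub>0 'b) = 0"
    then have "lookup (of_nat n :: 'a \<Rightarrow>\<^sub>0 'b) 0 = 0" by simp
    then show "(of_nat n :: 'b) = 0" by (simp add: lookup_of_nat)
  next
    assume "(of_nat n :: 'b) = 0"
    then show "(of_nat n :: 'a \<Rightarrow>\<^sub>0 'b) = 0" by (simp flip: single_of_nat)
  qed
  then show "of_nat CHAR('b) = (0 :: 'a \<Rightarrow>\<^sub>0 'b)" "\<And>x. of_nat x = (0 :: 'a \<Rightarrow>\<^sub>0 'b) \<Longrightarrow> CHAR('b) dvd x"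
    by (simp_all add: of_nat_eq_0_iff_char_dvd)
qed

lemma poly_mapping_as_sum: "f = (\<Sum>e\<in>keys f. single e (lookup f e))"
proof (rule poly_mapping_eqI)
  fix k
  have "lookup (\<Sum>e\<in>keys f. single e (lookup f e)) k = (\<Sum>e\<in>keys f. if e = k then lookup f e else 0)"
    unfolding lookup_sum by (intro sum.cong) (auto simp: lookup_single when_def)
  then show "lookup f k = lookup (\<Sum>e\<in>keys f. single e (lookup f e)) k"
    by (simp add: in_keys_iff)
qed

lemma lookup_single_mult:
  fixes f :: "'a::cancel_comm_monoid_add \<Rightarrow>\<^sub>0 'b::comm_semiring_1"
  shows "lookup (single a c * f) (a + b) = c * lookup f b"
proof -
  have eq: "single a c * f = (\<Sum>e\<in>keys f. single (a + e) (c * lookup f e))"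
  proof -
    have "single a c * f = single a c * (\<Sum>e\<in>keys f. single e (lookup f e))"
      by (rule arg_cong[OF poly_mapping_as_sum])
    then show ?thesis by (simp add: sum_distrib_left mult_single)
  qed
  have "lookup (single a c * f) (a + b) = (\<Sum>e\<in>keys f. if e = b then c * lookup f e else 0)"
    unfolding eq lookup_sum by (auto simp: lookup_single when_def intro!: sum.cong)
  then show ?thesis by (simp add: in_keys_iff)
qed

lemma lookup_mconst_mult: "lookup (mconst c * f) e = c * lookup f e"
  using lookup_single_mult[of 0 c f e] by (simp add: mconst_def)

lemma mconst_simps [simp]:
  "mconst 0 = 0" "mconst 1 = 1" "mconst (a + b) = mconst a + mconst b" "mconst (a * b) = mconst a * mconst b"
  by (simp_all add: mconst_def single_add mult_single)

lemma mconst_uminus: "mconst (- a) = - mconst a"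
  by (simp add: mconst_def single_uminus)

lemma mconst_of_nat: "mconst (of_nat n) = of_nat n"
  by (simp add: mconst_def)

lemma mconst_eq_0_iff [simp]: "mconst c = 0 \<longleftrightarrow> c = 0"
proof
  assume "mconst c = 0"
  then have "lookup (mconst c) 0 = 0" by simp
  then show "c = 0" by (simp add: mconst_def)
qed simp

subsection \<open>Evaluation of polynomials\<close>

definition monom_value :: "(nat \<Rightarrow> 'b::comm_ring_1) \<Rightarrow> (nat \<Rightarrow>\<^sub>0 nat) \<Rightarrow> 'b" where
  "monom_value \<theta> e = (\<Prod>i\<in>keys e. \<theta> i ^ lookup e i)"

text \<open>Evaluation with the coefficients sent through \<open>h\<close>, because polynomials of
  type \<open>mpoly\<close> as well as univariate polynomials over them occur as values. The case
  \<open>h = mconst\<close> is \<open>msubst\<close>.\<close>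

definition meval :: "('k::field \<Rightarrow> 'b::comm_ring_1) \<Rightarrow> (nat \<Rightarrow> 'b) \<Rightarrow> 'k mpoly \<Rightarrow> 'b" where
  "meval h \<theta> f = (\<Sum>e\<in>keys f. h (lookup f e) * monom_value \<theta> e)"

lemma msubst_eq_meval: "msubst \<theta> = meval mconst \<theta>"
  by (simp add: msubst_def meval_def monom_value_def fun_eq_iff)

lemma monom_value_superset:
  assumes "finite A" "keys e \<subseteq> A"
  shows "monom_value \<theta> e = (\<Prod>i\<in>A. \<theta> i ^ lookup e i)"
  unfolding monom_value_def by (rule prod.mono_neutral_left) (use assms in \<open>auto simp: in_keys_iff\<close>)

lemma monom_value_0 [simp]: "monom_value \<theta> 0 = 1"
  by (simp add: monom_value_def)

lemma monom_value_add: "monom_value \<theta> (a + b) = monom_value \<theta> a * monom_value \<theta> b"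
proof -
  let ?A = "keys a \<union> keys b"
  have "keys (a + b) \<subseteq> ?A" by (rule keys_add)
  then show ?thesis
    using monom_value_superset[of ?A "a + b" \<theta>] monom_value_superset[of ?A a \<theta>] monom_value_superset[of ?A b \<theta>]
    by (simp add: lookup_add power_add prod.distrib)
qed

lemma monom_value_single: "monom_value \<theta> (single i n) = \<theta> i ^ n"
  by (cases "n = 0") (simp_all add: monom_value_def)

locale coeff_hom =
  fixes h :: "'k::field \<Rightarrow> 'b::comm_ring_1"
  assumes h_add: "h (a + b) = h a + h b" and h_mult: "h (a * b) = h a * h b" and h_1: "h 1 = 1"
begin

lemma h_0: "h 0 = 0"
  using h_add[of 0 0] by simp

lemma meval_superset:
  assumes "finite A" "keys f \<subseteq> A"
  shows "meval h \<theta> f = (\<Sum>e\<in>A. h (lookup f e) * monom_value \<theta> e)"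
  unfolding meval_def by (rule sum.mono_neutral_left) (use assms in \<open>auto simp: in_keys_iff h_0\<close>)

lemma meval_0 [simp]: "meval h \<theta> 0 = 0"
  by (simp add: meval_def)

lemma meval_add: "meval h \<theta> (f + g) = meval h \<theta> f + meval h \<theta> g"
proof -
  let ?A = "keys f \<union> keys g"
  have "keys (f + g) \<subseteq> ?A" by (rule keys_add)
  then show ?thesis
    using meval_superset[of ?A "f + g" \<theta>] meval_superset[of ?A f \<theta>] meval_superset[of ?A g \<theta>]
    by (simp add: lookup_add h_add ring_distribs sum.distrib)
qed

lemma meval_sum: "meval h \<theta> (sum f I) = (\<Sum>i\<in>I. meval h \<theta> (f i))"
  by (induction I rule: infinite_finite_induct) (simp_all add: meval_add)

lemma meval_single: "meval h \<theta> (single e c) = h c * monom_value \<theta> e"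
  by (cases "c = 0") (simp_all add: meval_def h_0)

lemma meval_mult: "meval h \<theta> (f * g) = meval h \<theta> f * meval h \<theta> g"
proof -
  have "f * g = (\<Sum>a\<in>keys f. \<Sum>b\<in>keys g. single (a + b) (lookup f a * lookup g b))"
  proof -
    have "f * g = (\<Sum>a\<in>keys f. single a (lookup f a)) * (\<Sum>b\<in>keys g. single b (lookup g b))"
      by (intro arg_cong2[where f="(*)"] poly_mapping_as_sum)
    then show ?thesis by (simp add: sum_product mult_single)
  qed
  then have "meval h \<theta> (f * g) = (\<Sum>a\<in>keys f. \<Sum>b\<in>keys g. (h (lookup f a) * monom_value \<theta> a) * (h (lookup g b) * monom_value \<theta> b))"
    by (simp add: meval_sum meval_single monom_value_add h_mult mult_ac)
  then show ?thesis by (simp add: meval_def sum_product)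
qed

lemma meval_1 [simp]: "meval h \<theta> 1 = 1"
  using meval_single[of \<theta> 0 1] by (simp add: h_1)

lemma meval_power: "meval h \<theta> (f ^ n) = meval h \<theta> f ^ n"
  by (induction n) (simp_all add: meval_mult)

lemma meval_mconst [simp]: "meval h \<theta> (mconst c) = h c"
  by (simp add: mconst_def meval_single)

lemma meval_mvar [simp]: "meval h \<theta> (mvar i) = \<theta> i"
  by (simp add: mvar_def meval_single monom_value_single h_1)

text \<open>Together with \<open>meval_cong\<close> this is how ring homomorphisms out of the
  polynomial ring are shown to agree: by their values on coefficients and variables.\<close>

lemma meval_comp:
  assumes "\<And>a b. H (a + b) = H a + H b" "\<And>a b. H (a * b) = H a * H b" "H 1 = 1"
  shows "H (meval h \<theta> f) = meval (H \<circ> h) (H \<circ> \<theta>) f"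
proof -
  have H0: "H 0 = 0" using assms(1)[of 0 0] by simp
  have Hs: "H (sum g A) = (\<Sum>x\<in>A. H (g x))" for g and A :: "(nat \<Rightarrow>\<^sub>0 nat) set"
    by (induction A rule: infinite_finite_induct) (simp_all add: H0 assms(1))
  have Hp: "H (x ^ n) = H x ^ n" for x n by (induction n) (simp_all add: assms(2,3))
  have Hpr: "H (prod g A) = (\<Prod>x\<in>A. H (g x))" for g and A :: "nat set"
    by (induction A rule: infinite_finite_induct) (simp_all add: assms(2,3))
  show ?thesis by (simp add: meval_def monom_value_def Hs assms(2) Hpr Hp)
qed

end

lemma coeff_hom_mconst: "coeff_hom (mconst :: 'k::field \<Rightarrow> 'k mpoly)"
  by unfold_locales simp_all

interpretation mconst: coeff_hom "mconst :: 'k::field \<Rightarrow> 'k mpoly"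
  by (rule coeff_hom_mconst)

lemma monom_value_mvar: "monom_value (mvar :: nat \<Rightarrow> 'k::field mpoly) e = single e 1"
proof -
  have p: "(single (single i 1) 1 :: 'k mpoly) ^ n = single (single i n) 1" for i n
    by (induction n) (simp_all add: mult_single single_add[symmetric])
  have "(\<Prod>i\<in>A. single (single i (g i)) 1) = (single (\<Sum>i\<in>A. single i (g i)) 1 :: 'k mpoly)" if "finite A" for A g
    using that by (induction A rule: finite_induct) (simp_all add: mult_single)
  then show ?thesis
    unfolding monom_value_def mvar_def p by (simp flip: poly_mapping_as_sum)
qed

lemma meval_mvar_id: "meval mconst mvar f = f"
proof -
  have "meval mconst mvar f = (\<Sum>e\<in>keys f. single e (lookup f e))"
    by (simp add: meval_def monom_value_mvar mconst_def mult_single)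
  then show ?thesis by (simp flip: poly_mapping_as_sum)
qed

lemma meval_cong:
  assumes "\<And>e i. e \<in> keys f \<Longrightarrow> i \<in> keys e \<Longrightarrow> \<theta> i = \<theta>' i"
  shows "meval h \<theta> f = meval h \<theta>' f"
  unfolding meval_def monom_value_def using assms by (intro sum.cong prod.cong arg_cong2[where f="(*)"] refl) auto

subsection \<open>Homogeneous polynomials\<close>

definition monomials :: "nat \<Rightarrow> nat \<Rightarrow> (nat \<Rightarrow>\<^sub>0 nat) set" where
  "monomials v d = {e. keys e \<subseteq> {..<v} \<and> (\<Sum>i\<in>keys e. lookup e i) = d}"

definition homogeneous :: "nat \<Rightarrow> nat \<Rightarrow> 'k::field mpoly set" where
  "homogeneous v d = {f. keys f \<subseteq> monomials v d}"

lemma monomials_iff: "e \<in> monomials v d \<longleftrightarrow> keys e \<subseteq> {..<v} \<and> (\<Sum>i<v. lookup e i) = d"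
proof -
  have "(\<Sum>i\<in>keys e. lookup e i) = (\<Sum>i<v. lookup e i)" if "keys e \<subseteq> {..<v}"
    by (rule sum.mono_neutral_left) (use that in \<open>auto simp: in_keys_iff\<close>)
  then show ?thesis by (auto simp: monomials_def)
qed

lemma monomials_add: "a \<in> monomials v d \<Longrightarrow> b \<in> monomials v d' \<Longrightarrow> a + b \<in> monomials v (d + d')"
  using keys_add[of a b] by (auto simp: monomials_iff lookup_add sum.distrib)

text \<open>Turns exponent vectors into lists, to which the stars-and-bars count applies.\<close>

lemma bij_monomials:
  "bij_betw (\<lambda>e. map (lookup e) [0..<v]) (monomials v d) {l. length l = v \<and> sum_list l = d}"
proof (rule bij_betwI)
  show "(\<lambda>e. map (lookup e) [0..<v]) \<in> monomials v d \<rightarrow> {l. length l = v \<and> sum_list l = d}"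
    by (auto simp: monomials_iff interv_sum_list_conv_sum_set_nat lessThan_atLeast0)
  define g where "g l = (\<Sum>i<v. single i (l ! i))" for l :: "nat list"
  have g: "lookup (g l) i = (if i < v then l ! i else 0)" for l i
  proof -
    have "lookup (g l) i = (\<Sum>j<v. if j = i then l ! j else 0)"
      unfolding g_def lookup_sum by (intro sum.cong) (auto simp: lookup_single when_def)
    then show ?thesis by simp
  qed
  show "g \<in> {l. length l = v \<and> sum_list l = d} \<rightarrow> monomials v d"
  proof
    fix l assume l: "l \<in> {l. length l = v \<and> sum_list l = d}"
    have "keys (g l) \<subseteq> {..<v}" by (auto simp: in_keys_iff g split: if_splits)
    moreover have "(\<Sum>i<v. lookup (g l) i) = d" using l by (auto simp: g sum_list_sum_nth lessThan_atLeast0)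
    ultimately show "g l \<in> monomials v d" by (simp add: monomials_iff)
  qed
  show "g (map (lookup e) [0..<v]) = e" if "e \<in> monomials v d" for e
    by (rule poly_mapping_eqI) (use that in \<open>auto simp: g monomials_iff in_keys_iff not_less\<close>)
  show "map (lookup (g l)) [0..<v] = l" if "l \<in> {l. length l = v \<and> sum_list l = d}" for l
    by (rule nth_equalityI) (use that in \<open>auto simp: g\<close>)
qed

lemma card_monomials: "v > 0 \<Longrightarrow> card (monomials v d) = (d + v - 1) choose d"
  using bij_betw_same_card[OF bij_monomials[of v d]] card_length_sum_list[of v d] by simp

lemma finite_monomials: "finite (monomials v d)"
proof -
  have "finite {l. length l = v \<and> sum_list l = d}"
  proof (rule finite_subset)
    show "{l. length l = v \<and> sum_list l = d} \<subseteq> {l. set l \<subseteq> {..d} \<and> length l = v}"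
      using member_le_sum_list by fastforce
  qed (rule finite_lists_length_eq, simp)
  then show ?thesis using bij_betw_finite[OF bij_monomials] by blast
qed

lemma homogeneousI: "(\<And>e. lookup f e \<noteq> 0 \<Longrightarrow> e \<in> monomials v d) \<Longrightarrow> f \<in> homogeneous v d"
  by (auto simp: homogeneous_def in_keys_iff)

lemma homogeneousD: "f \<in> homogeneous v d \<Longrightarrow> lookup f e \<noteq> 0 \<Longrightarrow> e \<in> monomials v d"
  by (auto simp: homogeneous_def in_keys_iff)

lemma homogeneous_0 [simp]: "0 \<in> homogeneous v d"
  by (simp add: homogeneous_def)

lemma homogeneous_add: "f \<in> homogeneous v d \<Longrightarrow> g \<in> homogeneous v d \<Longrightarrow> f + g \<in> homogeneous v d"
  using keys_add[of f g] by (auto simp: homogeneous_def)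

lemma homogeneous_uminus: "f \<in> homogeneous v d \<Longrightarrow> - f \<in> homogeneous v d"
  by (simp add: homogeneous_def in_keys_iff subset_iff)

lemma homogeneous_diff: "f \<in> homogeneous v d \<Longrightarrow> g \<in> homogeneous v d \<Longrightarrow> f - g \<in> homogeneous v d"
  using homogeneous_add[of f v d "- g"] homogeneous_uminus[of g] by simp

lemma homogeneous_sum: "(\<And>i. i \<in> I \<Longrightarrow> f i \<in> homogeneous v d) \<Longrightarrow> sum f I \<in> homogeneous v d"
  by (induction I rule: infinite_finite_induct) (simp_all add: homogeneous_add)

lemma homogeneous_mult: "f \<in> homogeneous v d \<Longrightarrow> g \<in> homogeneous v d' \<Longrightarrow> f * g \<in> homogeneous v (d + d')"
  using keys_mult[of f g] monomials_add by (fastforce simp: homogeneous_def)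

lemma homogeneous_single: "e \<in> monomials v d \<Longrightarrow> single e c \<in> homogeneous v d"
  by (simp add: homogeneous_def)

lemma homogeneous_mconst: "mconst c \<in> homogeneous v 0"
  unfolding mconst_def by (rule homogeneous_single) (simp add: monomials_def)

lemma homogeneous_1: "1 \<in> homogeneous v 0"
  using homogeneous_mconst[of 1] by simp

lemma homogeneous_scale: "f \<in> homogeneous v d \<Longrightarrow> mconst c * f \<in> homogeneous v d"
  using homogeneous_mult[OF homogeneous_mconst] by fastforce

lemma homogeneous_mvar: "i < v \<Longrightarrow> mvar i \<in> homogeneous v 1"
  unfolding mvar_def by (rule homogeneous_single) (simp add: monomials_def)

lemma homogeneous_power: "f \<in> homogeneous v d \<Longrightarrow> f ^ n \<in> homogeneous v (n * d)"
  by (induction n) (auto simp: homogeneous_1 intro: homogeneous_mult)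

lemma carrier_sym_dual: "carrier (sym_dual G s v n) = homogeneous v n"
  by (auto simp: sym_dual_def homogeneous_def monomials_def)

section \<open>Chains in characteristic \<open>p\<close>\<close>

context linear_operator
begin

lemma invariantD: "invariant_subspace W \<Longrightarrow> subspace W" "invariant_subspace W \<Longrightarrow> x \<in> W \<Longrightarrow> t x \<in> W"
  by (auto simp: invariant_subspace_def)

section \<open>The binomial theorem for 1 + t in characteristic p\<close>

lemma funpow_one_plus:
  "((\<lambda>x. x + t x) ^^ n) x = (\<Sum>k\<le>n. of_nat (n choose k) *s (t ^^ k) x)"
proof (induction n)
  case 0 then show ?case by simp
next
  case (Suc n)
  have "((\<lambda>x. x + t x) ^^ Suc n) x = (\<Sum>k\<le>n. of_nat (n choose k) *s (t ^^ k) x) + (\<Sum>k\<le>n. of_nat (n choose k) *s (t ^^ Suc k) x)"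
    by (simp add: Suc t_sum t_scale)
  also have "(\<Sum>k\<le>n. of_nat (n choose k) *s (t ^^ k) x) = x + (\<Sum>k\<le>n. of_nat (n choose Suc k) *s (t ^^ Suc k) x)"
  proof -
    have "(\<Sum>k\<le>n. of_nat (n choose k) *s (t ^^ k) x) = (\<Sum>k\<le>Suc n. of_nat (n choose k) *s (t ^^ k) x)"
      by (simp add: binomial_eq_0)
    also have "\<dots> = x + (\<Sum>k\<le>n. of_nat (n choose Suc k) *s (t ^^ Suc k) x)"
      by (subst sum.atMost_Suc_shift) simp
    finally show ?thesis .
  qed
  also have "x + (\<Sum>k\<le>n. of_nat (n choose Suc k) *s (t ^^ Suc k) x) + (\<Sum>k\<le>n. of_nat (n choose k) *s (t ^^ Suc k) x)
     = x + (\<Sum>k\<le>n. of_nat (Suc n choose Suc k) *s (t ^^ Suc k) x)"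
    by (simp add: scale_left_distrib sum.distrib add_ac del: funpow.simps)
  also have "\<dots> = (\<Sum>k\<le>Suc n. of_nat (Suc n choose k) *s (t ^^ k) x)"
    by (subst sum.atMost_Suc_shift) simp
  finally show ?case .
qed

lemma char_funpow_one_plus:
  assumes "prime p" "CHAR('k) = p"
  shows "((\<lambda>x. x + t x) ^^ p) x = x + (t ^^ p) x"
proof -
  have p0: "p > 0" using assms(1) prime_gt_0_nat by blast
  have z: "(of_nat (p choose k) :: 'k) = 0" if "0 < k" "k < p" for k
    using that assms dvd_choose_prime[of k p] by (simp add: of_nat_eq_0_iff_char_dvd)
  have "((\<lambda>x. x + t x) ^^ p) x = (\<Sum>k\<le>p. of_nat (p choose k) *s (t ^^ k) x)" by (rule funpow_one_plus)
  also have "\<dots> = (\<Sum>k\<in>{0,p}. of_nat (p choose k) *s (t ^^ k) x)"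
    by (rule sum.mono_neutral_right) (use z in auto)
  finally show ?thesis using p0 by simp
qed

text \<open>With s = 1 + t this is (s^p - 1) / (s - 1) = t^(p-1). In the computation the
  hockey-stick identity gives t^k the coefficient \<open>p choose Suc k\<close>, which p divides
  unless k = p - 1.\<close>

lemma char_sum_funpow_one_plus:
  assumes "prime p" "CHAR('k) = p"
  shows "(\<Sum>i<p. ((\<lambda>x. x + t x) ^^ i) x) = (t ^^ (p - 1)) x"
proof -
  have p0: "p > 0" using assms(1) prime_gt_0_nat by blast
  then have l: "{..<p} = {..p - 1}" by auto
  have z: "(of_nat (p choose Suc k) :: 'k) = 0" if "k < p - 1" for k
    using that assms dvd_choose_prime[of "Suc k" p] by (simp add: of_nat_eq_0_iff_char_dvd)
  have "((\<lambda>x. x + t x) ^^ i) x = (\<Sum>k\<le>p - 1. of_nat (i choose k) *s (t ^^ k) x)" if "i \<in> {..p - 1}" for i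
    unfolding funpow_one_plus by (rule sum.mono_neutral_left) (use that in \<open>auto simp: binomial_eq_0\<close>)
  then have "(\<Sum>i<p. ((\<lambda>x. x + t x) ^^ i) x) = (\<Sum>i\<le>p - 1. \<Sum>k\<le>p - 1. of_nat (i choose k) *s (t ^^ k) x)"
    unfolding l by (intro sum.cong) auto
  also have "\<dots> = (\<Sum>k\<le>p - 1. \<Sum>i\<le>p - 1. of_nat (i choose k) *s (t ^^ k) x)" by (rule sum.swap)
  also have "\<dots> = (\<Sum>k\<le>p - 1. of_nat (p choose Suc k) *s (t ^^ k) x)"
  proof (rule sum.cong[OF refl])
    fix k
    have "(\<Sum>i\<le>p - 1. of_nat (i choose k) *s (t ^^ k) x) = (of_nat (\<Sum>i\<le>p - 1. i choose k) :: 'k) *s (t ^^ k) x"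
      by (simp add: scale_sum_left)
    then show "(\<Sum>i\<le>p - 1. of_nat (i choose k) *s (t ^^ k) x) = of_nat (p choose Suc k) *s (t ^^ k) x"
      unfolding sum_choose_upper using p0 by simp
  qed
  also have "\<dots> = (\<Sum>k\<in>{p - 1}. of_nat (p choose Suc k) *s (t ^^ k) x)"
    by (rule sum.mono_neutral_right) (use z in auto)
  finally show ?thesis using p0 by simp
qed

lemma chain_length_le:
  assumes cb: "chain_basis W H l" and nil: "\<And>w. w \<in> W \<Longrightarrow> (t ^^ N) w = 0" and v: "v \<in> H"
  shows "l v \<le> N"
proof (rule ccontr)
  assume "\<not> l v \<le> N"
  then have N: "N < l v" by simp
  have fin: "finite H" and vW: "v \<in> W" using cb v by (auto simp: chain_basis_def)
  define c where "c u k = (if u = v \<and> k = N then 1 else 0 :: 'k)" for u k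
  have "(\<Sum>k<l u. c u k *s (t ^^ k) u) = (if u = v then (t ^^ N) v else 0)" for u
  proof -
    have "(\<Sum>k<l u. c u k *s (t ^^ k) u) = (\<Sum>k<l u. if k = N then (if u = v then (t ^^ k) u else 0) else 0)"
      by (intro sum.cong) (auto simp: c_def)
    then show ?thesis using N by auto
  qed
  then have "chain_sum H l c = (t ^^ N) v" unfolding chain_sum_def using fin v by simp
  then have "chain_sum H l c = 0" using nil vW by simp
  from chain_basis_coeff_0[OF cb this v N] show False by (simp add: c_def)
qed

text \<open>
  On a module killed by \<open>t\<^sup>p\<close>, the dimension of \<open>ker t / im t\<^sup>p\<^sup>-\<^sup>1\<close> is the number of non-free
  summands; \<open>tate_cyclic\<close> says that it is at most 1, and \<open>tate_trivial\<close> that it is 0.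
\<close>

definition tate_cyclic :: "nat \<Rightarrow> 'v set \<Rightarrow> bool" where
  "tate_cyclic p W \<longleftrightarrow> (\<exists>x0\<in>W. t x0 = 0 \<and> (\<forall>f\<in>W. t f = 0 \<longrightarrow> (\<exists>a. f - a *s x0 \<in> (t ^^ (p - 1)) ` W)))"

definition tate_trivial :: "nat \<Rightarrow> 'v set \<Rightarrow> bool" where
  "tate_trivial p W \<longleftrightarrow> (\<forall>f\<in>W. t f = 0 \<longrightarrow> f \<in> (t ^^ (p - 1)) ` W)"

lemma tate_trivial_imp_cyclic: "subspace W \<Longrightarrow> tate_trivial p W \<Longrightarrow> tate_cyclic p W"
  unfolding tate_cyclic_def tate_trivial_def by (rule bexI[of _ 0]) (auto simp: t_zero subspace_0)

text \<open>The last vectors of two short chains lie in ker t, and their classes modulo im t^(p-1)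
  are dependent. So a nontrivial combination of them lies in im t^(p-1). But elements of that image
  have coefficients only at places from p - 1 on, and the last place of a chain shorter than p comes
  earlier.\<close>

lemma short_chain_unique:
  assumes inv: "invariant_subspace W" and cb: "chain_basis W H l" and cyc: "tate_cyclic p W"
    and v: "v1 \<in> H" "l v1 < p" and v2: "v2 \<in> H" "l v2 < p"
  shows "v1 = v2"
proof (rule ccontr)
  assume ne: "v1 \<noteq> v2"
  have fin: "finite H" and HW: "\<And>v. v \<in> H \<Longrightarrow> v \<in> W" and l1: "\<And>v. v \<in> H \<Longrightarrow> l v \<ge> 1"
    and end0: "\<And>v. v \<in> H \<Longrightarrow> (t ^^ l v) v = 0"
    using cb unfolding chain_basis_def by blast+
  define top where "top v = (t ^^ (l v - 1)) v" for v
  have topW: "top v \<in> W" if "v \<in> H" for v unfolding top_def by (rule invariant_funpow[OF inv HW[OF that]])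
  have ttop: "t (top v) = 0" if "v \<in> H" for v
  proof -
    have "t (top v) = (t ^^ Suc (l v - 1)) v" by (simp add: top_def)
    then show ?thesis using end0[OF that] l1[OF that] by simp
  qed
  obtain x0 where x0: "\<And>f. f \<in> W \<Longrightarrow> t f = 0 \<Longrightarrow> \<exists>a. f - a *s x0 \<in> (t ^^ (p - 1)) ` W"
    using cyc unfolding tate_cyclic_def by blast
  obtain a1 g1 where a1: "top v1 - a1 *s x0 = (t ^^ (p - 1)) g1" "g1 \<in> W" 
    using x0[OF topW[OF v(1)] ttop[OF v(1)]] by blast
  obtain a2 g2 where a2: "top v2 - a2 *s x0 = (t ^^ (p - 1)) g2" "g2 \<in> W" 
    using x0[OF topW[OF v2(1)] ttop[OF v2(1)]] by blast
  \<comment> \<open>A nontrivial combination in which the multiples of \<open>x0\<close>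
    cancel.\<close>
  obtain b1 b2 :: 'k where b: "b1 * a1 + b2 * a2 = 0" "b1 \<noteq> 0 \<or> b2 \<noteq> 0"
  proof (cases "a1 = 0 \<and> a2 = 0")
    case True then show ?thesis using that[of 1 0] by simp
  next
    case False then show ?thesis using that[of a2 "- a1"] by auto
  qed
  have "b1 *s top v1 + b2 *s top v2 = b1 *s (top v1 - a1 *s x0) + b2 *s (top v2 - a2 *s x0) + (b1 * a1 + b2 * a2) *s x0"
    by (simp add: scale_right_diff_distrib scale_left_distrib)
  also have "\<dots> = (t ^^ (p - 1)) (b1 *s g1 + b2 *s g2)" unfolding a1 a2 b by (simp add: funpow_add funpow_scale)
  finally have eq: "b1 *s top v1 + b2 *s top v2 = (t ^^ (p - 1)) (b1 *s g1 + b2 *s g2)" .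
  have "b1 *s g1 + b2 *s g2 \<in> W" using a1(2) a2(2) invariantD(1)[OF inv] by (simp add: subspace_add subspace_scale)
  then obtain c where c: "b1 *s g1 + b2 *s g2 = chain_sum H l c" using cb unfolding chain_basis_def by blast
  define d where "d v k = (if v = v1 \<and> k = l v1 - 1 then b1 else if v = v2 \<and> k = l v2 - 1 then b2 else 0)" for v k
  have "(\<Sum>k<l v. d v k *s (t ^^ k) v) = (if v = v1 then b1 *s top v1 else if v = v2 then b2 *s top v2 else 0)"
    if "v \<in> H" for v
  proof -
    have "(\<Sum>k<l v. d v k *s (t ^^ k) v) = (\<Sum>k<l v. if k = l v - 1 then d v k *s (t ^^ k) v else 0)"
      by (intro sum.cong) (auto simp: d_def)
    also have "\<dots> = d v (l v - 1) *s (t ^^ (l v - 1)) v" using l1[OF that] by simp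
    finally show ?thesis using ne by (auto simp: d_def top_def)
  qed
  then have "chain_sum H l d = (\<Sum>v\<in>H. if v = v1 then b1 *s top v1 else if v = v2 then b2 *s top v2 else 0)"
    unfolding chain_sum_def by (rule sum.cong[OF refl])
  also have "\<dots> = (\<Sum>v\<in>{v1,v2}. if v = v1 then b1 *s top v1 else if v = v2 then b2 *s top v2 else 0)"
    by (rule sum.mono_neutral_right) (use fin v v2 in auto)
  also have "\<dots> = b1 *s top v1 + b2 *s top v2" using ne by simp
  also have "\<dots> = chain_sum H l (\<lambda>v k. if p - 1 \<le> k then c v (k - (p - 1)) else 0)"
    unfolding eq c funpow_chain_sum[OF cb] by (simp add: chain_sum_def)
  finally have "chain_sum H l d = chain_sum H l (\<lambda>v k. if p - 1 \<le> k then c v (k - (p - 1)) else 0)" .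
  note u = chain_basis_coeff_unique[OF cb this]
  have "b1 = 0" using u[OF v(1), of "l v1 - 1"] l1[OF v(1)] v(2) by (auto simp: d_def split: if_splits)
  moreover have "b2 = 0" using u[OF v2(1), of "l v2 - 1"] l1[OF v2(1)] v2(2) ne by (auto simp: d_def split: if_splits)
  ultimately show False using b by simp
qed

text \<open>All chains have length p except at most one shorter one. Division of the dimension by p
  therefore gives the number of the former and the length of the latter.\<close>

lemma tate_cyclic_dim_image:
  assumes inv: "invariant_subspace W" and fd: "finite F" "W \<subseteq> span F" and nil: "\<And>w. w \<in> W \<Longrightarrow> (t ^^ p) w = 0"
    and cyc: "tate_cyclic p W" and j: "j < p"
  shows "dim {x \<in> (t ^^ j) ` W. t x = 0} = dim W div p + (if j < dim W mod p then 1 else 0)"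
proof -
  obtain H l where cb: "chain_basis W H l" using ex_chain_basis[OF inv fd nil] by blast
  have fin: "finite H" and l1: "\<And>v. v \<in> H \<Longrightarrow> l v \<ge> 1" using cb unfolding chain_basis_def by blast+
  have lp: "l v \<le> p" if "v \<in> H" for v by (rule chain_length_le[OF cb nil that])
  define Hf where "Hf = {v\<in>H. l v = p}"
  define Hs where "Hs = {v\<in>H. l v < p}"
  have HH: "H = Hf \<union> Hs" "Hf \<inter> Hs = {}" "finite Hf" "finite Hs" using lp fin by (auto simp: Hf_def Hs_def order.strict_iff_order)
  have d: "dim W = p * card Hf + (\<Sum>v\<in>Hs. l v)"
  proof -
    have "dim W = (\<Sum>v\<in>Hf. l v) + (\<Sum>v\<in>Hs. l v)"
      unfolding dim_chain_basis[OF inv cb] using HH by (simp add: sum.union_disjoint)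
    also have "(\<Sum>v\<in>Hf. l v) = p * card Hf" by (simp add: Hf_def)
    finally show ?thesis .
  qed
  have c: "card {v\<in>H. j < l v} = card Hf + card {v\<in>Hs. j < l v}"
  proof -
    have "{v\<in>H. j < l v} = Hf \<union> {v\<in>Hs. j < l v}" using HH(1) j by (auto simp: Hf_def)
    then show ?thesis using HH by (simp add: card_Un_disjoint disjoint_iff)
  qed
  show ?thesis
  proof (cases "Hs = {}")
    case True
    then show ?thesis using card_chains_longer[OF inv cb, of j] c d j by simp
  next
    case False
    then obtain v where v: "v \<in> Hs" by blast
    have Hs: "Hs = {v}" using v short_chain_unique[OF inv cb cyc] by (auto simp: Hs_def)
    have lv: "l v < p" using v by (simp add: Hs_def)
    have "{u\<in>Hs. j < l u} = (if j < l v then {v} else {})" unfolding Hs by auto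
    then have "card {u\<in>Hs. j < l u} = (if j < l v then 1 else 0)" by simp
    moreover have "dim W = p * card Hf + l v" using d unfolding Hs by simp
    then have "dim W div p = card Hf" "dim W mod p = l v" using lv by simp_all
    ultimately show ?thesis using card_chains_longer[OF inv cb, of j] c by simp
  qed
qed

text \<open>A single short chain would have a length divisible by p but strictly between 0 and p.
  Hence all chains have length p, and an element of ker t has coefficients only at their last
  places.\<close>

lemma tate_cyclic_dim_dvd_imp_trivial:
  assumes inv: "invariant_subspace W" and fd: "finite F" "W \<subseteq> span F" and nil: "\<And>w. w \<in> W \<Longrightarrow> (t ^^ p) w = 0"
    and cyc: "tate_cyclic p W" and dvd: "p dvd dim W" and p: "p > 0"
  shows "tate_trivial p W"
proof -
  obtain H l where cb: "chain_basis W H l" using ex_chain_basis[OF inv fd nil] by blast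
  have fin: "finite H" and l1: "\<And>v. v \<in> H \<Longrightarrow> l v \<ge> 1" using cb unfolding chain_basis_def by blast+
  have lp: "l v \<le> p" if "v \<in> H" for v by (rule chain_length_le[OF cb nil that])
  have leq: "l v = p" if v: "v \<in> H" for v
  proof (rule ccontr)
    assume "l v \<noteq> p"
    then have lv: "l v < p" using lp[OF v] by simp
    have "dim W = l v + (\<Sum>u\<in>H - {v}. l u)" unfolding dim_chain_basis[OF inv cb] using fin v by (simp add: sum.remove)
    also have "(\<Sum>u\<in>H - {v}. l u) = (\<Sum>u\<in>H - {v}. p)"
    proof (rule sum.cong[OF refl])
      fix u assume "u \<in> H - {v}"
      then show "l u = p" using short_chain_unique[OF inv cb cyc v lv, of u] lp[of u] by force
    qed
    finally have "p dvd l v" using dvd by (simp add: dvd_add_left_iff)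
    then show False using l1[OF v] lv by (simp add: nat_dvd_not_less)
  qed
  show ?thesis unfolding tate_trivial_def
  proof (intro ballI impI)
    fix f assume f: "f \<in> W" and t0: "t f = 0"
    obtain c where c: "f = chain_sum H l c" using cb f unfolding chain_basis_def by blast
    have this0: "chain_sum H l (\<lambda>v k. if 1 \<le> k then c v (k - 1) else 0) = 0"
      using funpow_chain_sum[OF cb, of 1 c] t0 c by (simp add: chain_sum_def)
    have z: "c v (k - 1) = 0" if "v \<in> H" "1 \<le> k" "k < p" for v k
    proof -
      have "k < l v" using that leq by simp
      from chain_basis_coeff_0[OF cb this0 that(1) this] that(2) show ?thesis by simp
    qed
    \<comment> \<open>The preimage under t^(p-1): each coefficient at the last place moves to the
      head of its chain.\<close>
    define d where "d v k = (if k = 0 then c v (p - 1) else 0)" for v and k :: nat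
    have HW: "H \<subseteq> W" by (rule chain_basis_in[OF cb])
    have "(t ^^ (p - 1)) (chain_sum H l d) = chain_sum H l (\<lambda>v k. if p - 1 \<le> k then d v (k - (p - 1)) else 0)"
      unfolding funpow_chain_sum[OF cb] by (simp add: chain_sum_def)
    also have "\<dots> = f" unfolding c
    proof (rule chain_sum_cong)
      fix v k assume v: "v \<in> H" and "k < l v"
      then have k: "k < p" using leq by simp
      show "(if p - 1 \<le> k then d v (k - (p - 1)) else 0) = c v k"
      proof (cases "k = p - 1")
        case True then show ?thesis by (simp add: d_def)
      next
        case False then show ?thesis using z[OF v, of "Suc k"] k by simp
      qed
    qed
    finally show "f \<in> (t ^^ (p - 1)) ` W" using chain_sum_in[OF inv HW] by (metis imageI)
  qed
qed

end

section \<open>Modules with a basis of Jordan chains\<close>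

context linear_operator
begin

lemma count_chain_lengths:
  assumes inv: "invariant_subspace W" and cb: "chain_basis W H l"
  shows "count (image_mset l (mset_set H)) m =
    (if m = 0 then 0 else dim {x \<in> (t ^^ (m - 1)) ` W. t x = 0} - dim {x \<in> (t ^^ m) ` W. t x = 0})"
proof -
  have fin: "finite H" using cb by (simp add: chain_basis_def)
  have c: "count (image_mset l (mset_set H)) m = card {v\<in>H. l v = m}"
    using fin by (simp add: count_image_mset vimage_def Int_def conj_commute)
  show ?thesis
  proof (cases "m = 0")
    case True
    have "l v \<ge> 1" if "v \<in> H" for v using cb that unfolding chain_basis_def by blast
    then have "{v\<in>H. l v = 0} = {}" by fastforce
    then have "card {v\<in>H. l v = 0} = 0" by (metis card.empty)
    then show ?thesis using c True by simp
  next
    case False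
    have "card {v\<in>H. m - 1 < l v} = card ({v\<in>H. l v = m} \<union> {v\<in>H. m < l v})"
      using False by (intro arg_cong[where f=card]) auto
    also have "\<dots> = card {v\<in>H. l v = m} + card {v\<in>H. m < l v}"
      by (rule card_Un_disjoint) (use fin in auto)
    finally show ?thesis using c False card_chains_longer[OF inv cb] by simp
  qed
qed

text \<open>This is what replaces the Krull-Schmidt theorem for the multiplicities.\<close>

lemma chain_lengths_unique:
  assumes "invariant_subspace W" "chain_basis W H l" "chain_basis W H' l'"
  shows "image_mset l (mset_set H) = image_mset l' (mset_set H')"
  by (rule multiset_eqI) (simp add: count_chain_lengths[OF assms(1,2)] count_chain_lengths[OF assms(1,3)])

text \<open>Identifies a module record with a subspace of the ambient vector space, where the linear
  algebra takes place and the generator acts as 1 + t. The exponent of a group element is the one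
  chosen in \<open>jordan_rep\<close>.\<close>

definition realizes ::
  "('g, 'x) monoid_scheme \<Rightarrow> 'g \<Rightarrow> ('k, 'm, 'g) fg_module \<Rightarrow> 'v set \<Rightarrow> ('m \<Rightarrow> 'v) \<Rightarrow> bool" where
  "realizes G s M W \<phi> \<longleftrightarrow> bij_betw \<phi> (carrier M) W \<and>
     (\<forall>x\<in>carrier M. \<forall>y\<in>carrier M. x \<oplus>\<^bsub>M\<^esub> y \<in> carrier M \<and> \<phi> (x \<oplus>\<^bsub>M\<^esub> y) = \<phi> x + \<phi> y) \<and>
     (\<forall>c. \<forall>x\<in>carrier M. c \<odot>\<^bsub>M\<^esub> x \<in> carrier M \<and> \<phi> (c \<odot>\<^bsub>M\<^esub> x) = c *s \<phi> x) \<and>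
     (\<forall>g\<in>carrier G. \<forall>x\<in>carrier M. action M g x \<in> carrier M \<and>
        \<phi> (action M g x) = ((\<lambda>x. x + t x) ^^ (LEAST k::nat. g = s [^]\<^bsub>G\<^esub> k)) (\<phi> x))"

section \<open>Isomorphism of modules in terms of realizations\<close>

lemma realizes_imp_fg_iso:
  assumes M: "realizes G s M W \<phi>" and N: "realizes G s N W \<psi>"
  shows "fg_iso G M N"
proof -
  let ?f = "\<lambda>x. inv_into (carrier N) \<psi> (\<phi> x)"
  have bM: "bij_betw \<phi> (carrier M) W" and bN: "bij_betw \<psi> (carrier N) W"
    using M N by (auto simp: realizes_def)
  have \<psi>f: "\<psi> (?f x) = \<phi> x" and fN: "?f x \<in> carrier N" if "x \<in> carrier M" for x
    using bM bN that by (metis bij_betwE bij_betw_inv_into_right, metis bij_betwE bij_betw_inv_into)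
  have inj: "x = y" if "x \<in> carrier N" "y \<in> carrier N" "\<psi> x = \<psi> y" for x y
    using bN that by (metis bij_betw_inv_into_left)
  have clM: "\<And>x y. x \<in> carrier M \<Longrightarrow> y \<in> carrier M \<Longrightarrow> x \<oplus>\<^bsub>M\<^esub> y \<in> carrier M \<and> \<phi> (x \<oplus>\<^bsub>M\<^esub> y) = \<phi> x + \<phi> y"
    "\<And>c x. x \<in> carrier M \<Longrightarrow> c \<odot>\<^bsub>M\<^esub> x \<in> carrier M \<and> \<phi> (c \<odot>\<^bsub>M\<^esub> x) = c *s \<phi> x"
    "\<And>g x. g \<in> carrier G \<Longrightarrow> x \<in> carrier M \<Longrightarrow> action M g x \<in> carrier M \<and>
        \<phi> (action M g x) = ((\<lambda>x. x + t x) ^^ (LEAST k::nat. g = s [^]\<^bsub>G\<^esub> k)) (\<phi> x)"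
    using M unfolding realizes_def by blast+
  have clN: "\<And>x y. x \<in> carrier N \<Longrightarrow> y \<in> carrier N \<Longrightarrow> x \<oplus>\<^bsub>N\<^esub> y \<in> carrier N \<and> \<psi> (x \<oplus>\<^bsub>N\<^esub> y) = \<psi> x + \<psi> y"
    "\<And>c x. x \<in> carrier N \<Longrightarrow> c \<odot>\<^bsub>N\<^esub> x \<in> carrier N \<and> \<psi> (c \<odot>\<^bsub>N\<^esub> x) = c *s \<psi> x"
    "\<And>g x. g \<in> carrier G \<Longrightarrow> x \<in> carrier N \<Longrightarrow> action N g x \<in> carrier N \<and>
        \<psi> (action N g x) = ((\<lambda>x. x + t x) ^^ (LEAST k::nat. g = s [^]\<^bsub>G\<^esub> k)) (\<psi> x)"
    using N unfolding realizes_def by blast+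
  have hom: "?f \<in> module_hom class_ring M N"
    unfolding module_hom_def
  proof (intro CollectI conjI allI impI Pi_I; (elim conjE)?)
    fix x assume "x \<in> carrier M"
    then show "?f x \<in> carrier N" by (rule fN)
  next
    fix x y assume x: "x \<in> carrier M" and y: "y \<in> carrier M"
    show "?f (x \<oplus>\<^bsub>M\<^esub> y) = ?f x \<oplus>\<^bsub>N\<^esub> ?f y"
      using x y fN clM(1)[OF x y] \<psi>f clN(1)[OF fN[OF x] fN[OF y]] by (intro inj) metis+
  next
    fix c :: 'k and x assume "c \<in> carrier class_ring" and x: "x \<in> carrier M"
    show "?f (c \<odot>\<^bsub>M\<^esub> x) = c \<odot>\<^bsub>N\<^esub> ?f x"
      using x fN clM(2)[OF x] \<psi>f clN(2)[OF fN[OF x]] by (intro inj) metis+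
  qed
  moreover have "bij_betw ?f (carrier M) (carrier N)"
    using bij_betw_trans[OF bM bij_betw_inv_into[OF bN]] by (simp add: comp_def)
  moreover have "?f (action M g v) = action N g (?f v)" if "g \<in> carrier G" "v \<in> carrier M" for g v
    using that fN clM(3)[OF that] \<psi>f clN(3)[OF that(1) fN[OF that(2)]] by (intro inj) metis+
  ultimately show ?thesis unfolding fg_iso_def by blast
qed

lemma fg_iso_imp_realizes:
  assumes M: "realizes G s M W \<phi>" and iso: "fg_iso G M N"
  shows "\<exists>\<psi>. realizes G s N W \<psi>"
proof -
  obtain f where hom: "f \<in> module_hom class_ring M N" and bf: "bij_betw f (carrier M) (carrier N)"
    and act: "\<And>g v. g \<in> carrier G \<Longrightarrow> v \<in> carrier M \<Longrightarrow> f (action M g v) = action N g (f v)"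
    using iso unfolding fg_iso_def by blast
  let ?g = "inv_into (carrier M) f"
  have bM: "bij_betw \<phi> (carrier M) W" using M by (auto simp: realizes_def)
  have ex: "\<exists>x'\<in>carrier M. x = f x' \<and> ?g x = x'" if "x \<in> carrier N" for x
    using bf that by (metis bij_betwE bij_betw_inv_into bij_betw_inv_into_right)
  have gf: "?g (f x) = x" and fN: "f x \<in> carrier N" if "x \<in> carrier M" for x
    using bf that by (auto simp: bij_betw_inv_into_left bij_betwE)
  have add: "f x \<oplus>\<^bsub>N\<^esub> f y = f (x \<oplus>\<^bsub>M\<^esub> y)" if "x \<in> carrier M" "y \<in> carrier M" for x y
    using hom that by (simp add: module_hom_def)
  have smu: "c \<odot>\<^bsub>N\<^esub> f x = f (c \<odot>\<^bsub>M\<^esub> x)" if "x \<in> carrier M" for c x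
    using hom that by (simp add: module_hom_def class_ring_simps)
  have clM: "\<And>x y. x \<in> carrier M \<Longrightarrow> y \<in> carrier M \<Longrightarrow> x \<oplus>\<^bsub>M\<^esub> y \<in> carrier M \<and> \<phi> (x \<oplus>\<^bsub>M\<^esub> y) = \<phi> x + \<phi> y"
    "\<And>c x. x \<in> carrier M \<Longrightarrow> c \<odot>\<^bsub>M\<^esub> x \<in> carrier M \<and> \<phi> (c \<odot>\<^bsub>M\<^esub> x) = c *s \<phi> x"
    "\<And>g x. g \<in> carrier G \<Longrightarrow> x \<in> carrier M \<Longrightarrow> action M g x \<in> carrier M \<and>
        \<phi> (action M g x) = ((\<lambda>x. x + t x) ^^ (LEAST k::nat. g = s [^]\<^bsub>G\<^esub> k)) (\<phi> x)"
    using M unfolding realizes_def by blast+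
  have "realizes G s N W (\<phi> \<circ> ?g)"
    unfolding realizes_def
  proof (intro conjI ballI allI)
    show "bij_betw (\<phi> \<circ> ?g) (carrier N) W"
      using bij_betw_trans[OF bij_betw_inv_into[OF bf] bM] .
  next
    fix x y assume "x \<in> carrier N" "y \<in> carrier N"
    then obtain x' y' where "x' \<in> carrier M" "y' \<in> carrier M" "x = f x'" "y = f y'" using ex by blast
    then show "x \<oplus>\<^bsub>N\<^esub> y \<in> carrier N" "(\<phi> \<circ> ?g) (x \<oplus>\<^bsub>N\<^esub> y) = (\<phi> \<circ> ?g) x + (\<phi> \<circ> ?g) y"
      by (simp_all add: add clM gf fN)
  next
    fix c x assume "x \<in> carrier N"
    then obtain x' where "x' \<in> carrier M" "x = f x'" using ex by blast
    then show "c \<odot>\<^bsub>N\<^esub> x \<in> carrier N" "(\<phi> \<circ> ?g) (c \<odot>\<^bsub>N\<^esub> x) = c *s (\<phi> \<circ> ?g) x"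
      by (simp_all add: smu clM gf fN)
  next
    fix g x assume g: "g \<in> carrier G" and "x \<in> carrier N"
    then obtain x' where "x' \<in> carrier M" "x = f x'" using ex by blast
    then show "action N g x \<in> carrier N"
      "(\<phi> \<circ> ?g) (action N g x) = ((\<lambda>x. x + t x) ^^ (LEAST k::nat. g = s [^]\<^bsub>G\<^esub> k)) ((\<phi> \<circ> ?g) x)"
      using g by (simp_all add: act[symmetric] clM gf fN)
  qed
  then show ?thesis by blast
qed

text \<open>The ones stand above the diagonal, so the block minus 1 lowers the index of a unit
  vector. A chain thus starts at the last unit vector, which explains the reversed indices
  below.\<close>

lemma jordan_block_mult_vec:
  assumes "v \<in> carrier_vec n" "i < n"
  shows "(jordan_block n (1::'k) *\<^sub>v v) $ i = v $ i + (if Suc i < n then v $ Suc i else 0)"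
proof -
  have "(jordan_block n (1::'k) *\<^sub>v v) $ i = (\<Sum>j<n. jordan_block n (1::'k) $$ (i, j) * v $ j)"
    using assms by (simp add: scalar_prod_def lessThan_atLeast0)
  also have "\<dots> = (\<Sum>j<n. (if i = j then v $ j else 0) + (if Suc i = j then v $ j else 0))"
    using assms by (intro sum.cong) (auto simp: jordan_block_def)
  also have "\<dots> = v $ i + (if Suc i < n then v $ Suc i else 0)"
    using assms(2) by (simp add: sum.distrib)
  finally show ?thesis .
qed

lemma carrier_direct_sum_jordan:
  "u \<in> carrier (direct_sum (map (jordan_module G s) L) :: ('k, nat \<Rightarrow> 'k vec, 'g) fg_module) \<longleftrightarrow>
    u \<in> extensional {..<length L} \<and> (\<forall>j<length L. u j \<in> carrier_vec (L ! j))"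
  by (auto simp: direct_sum_def jordan_module_def PiE_def Pi_def)

lemma chain_basis_realizes:
  assumes cb: "chain_basis W H l" and inv: "invariant_subspace W"
    and L: "mset L = image_mset l (mset_set H)"
  shows "\<exists>\<psi>. realizes G s (direct_sum (map (jordan_module G s) L) :: ('k, nat \<Rightarrow> 'k vec, 'g) fg_module) W \<psi>"
proof -
  have fin: "finite H" using cb by (simp add: chain_basis_def)
  obtain hs0 where hs0: "set hs0 = H" "distinct hs0" using finite_distinct_list[OF fin] by blast
  have "mset L = mset (map l hs0)" using L hs0 by (simp add: mset_set_set[symmetric])
  \<comment> \<open>The heads are listed in such an order that their lengths form exactly the list
    \<open>L\<close>.\<close>
  then obtain \<pi> where \<pi>: "\<pi> permutes {..<length (map l hs0)}" "permute_list \<pi> (map l hs0) = L"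
    by (rule mset_eq_permutation)
  define hs where "hs = permute_list \<pi> hs0"
  have hs: "distinct hs" "set hs = H" "map l hs = L"
    using \<pi> hs0 by (simp_all add: hs_def permute_list_map)
  define n where "n = length L"
  have len: "length hs = n" using hs(3) n_def by auto
  have Lj: "L ! j = l (hs ! j)" if "j < n" for j using hs(3) len that by auto
  have bij: "bij_betw (\<lambda>j. hs ! j) {..<n} H" using bij_betw_nth[OF hs(1)] len hs(2) by blast
  let ?N = "direct_sum (map (jordan_module G s) L) :: ('k, nat \<Rightarrow> 'k vec, 'g) fg_module"
  define ix where "ix = the_inv_into {..<n} (\<lambda>j. hs ! j)"
  have ix: "ix (hs ! j) = j" if "j < n" for j
    using bij that by (auto simp: ix_def bij_betw_def the_inv_into_f_f)
  \<comment> \<open>Place k of a chain is coordinate \<open>l v - 1 - k\<close> of the vector in the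
    corresponding summand.\<close>
  define cf where "cf = (\<lambda>(u :: nat \<Rightarrow> 'k vec) v k. u (ix v) $ (l v - 1 - k))"
  define \<psi> where "\<psi> u = chain_sum H l (cf u)" for u
  have car: "u \<in> carrier ?N \<longleftrightarrow> u \<in> extensional {..<n} \<and> (\<forall>j<n. u j \<in> carrier_vec (L ! j))" for u
    unfolding n_def by (rule carrier_direct_sum_jordan)
  have HW: "H \<subseteq> W" using cb by (rule chain_basis_in)
  have ixH: "ix v < n" "hs ! ix v = v" if "v \<in> H" for v
    using bij that ix unfolding bij_betw_def by auto
  have lv: "L ! ix v = l v" if "v \<in> H" for v using Lj ixH[OF that] by simp
  have l1: "l v \<ge> 1" if "v \<in> H" for v using cb that unfolding chain_basis_def by blast
  have inj: "inj_on \<psi> (carrier ?N)"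
  proof (rule inj_onI)
    fix u u' assume u: "u \<in> carrier ?N" "u' \<in> carrier ?N" and e: "\<psi> u = \<psi> u'"
    show "u = u'"
    proof (rule extensionalityI[of _ "{..<n}"])
      fix j assume "j \<in> {..<n}"
      then have j: "j < n" by simp
      let ?v = "hs ! j"
      have v: "?v \<in> H" using bij j by (auto simp: bij_betw_def)
      show "u j = u' j"
      proof (rule eq_vecI)
        show "dim_vec (u j) = dim_vec (u' j)" using u car j by (metis carrier_vecD)
        fix i assume "i < dim_vec (u' j)"
        then have i: "i < l ?v" using u(2) j Lj by (auto simp: car)
        have "cf u ?v (l ?v - 1 - i) = cf u' ?v (l ?v - 1 - i)"
          using chain_basis_coeff_unique[OF cb e[unfolded \<psi>_def] v, of "l ?v - 1 - i"] i by simp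
        then show "u j $ i = u' j $ i" using i by (simp add: cf_def ix[OF j])
      qed
    qed (use u car in auto)
  qed
  have \<psi>W: "\<psi> u \<in> W" for u unfolding \<psi>_def by (rule chain_sum_in[OF inv HW])
  have surj: "w \<in> \<psi> ` carrier ?N" if "w \<in> W" for w
  proof -
    obtain c where c: "w = chain_sum H l c" using cb \<open>w \<in> W\<close> unfolding chain_basis_def by blast
    define u where "u = (\<lambda>j\<in>{..<n}. vec (L ! j) (\<lambda>i. c (hs ! j) (L ! j - 1 - i)))"
    have "u \<in> carrier ?N" by (auto simp: car u_def)
    moreover have "\<psi> u = w" unfolding \<psi>_def c
      by (rule chain_sum_cong) (auto simp: cf_def u_def ixH lv)
    ultimately show ?thesis by blast
  qed
  have ext: "u j = v j" if "u = v" for u v :: "nat \<Rightarrow> 'k vec" and j using that by simp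
  have add: "x \<oplus>\<^bsub>?N\<^esub> y \<in> carrier ?N \<and> \<psi> (x \<oplus>\<^bsub>?N\<^esub> y) = \<psi> x + \<psi> y"
    if x: "x \<in> carrier ?N" and y: "y \<in> carrier ?N" for x y
  proof
    have a: "(x \<oplus>\<^bsub>?N\<^esub> y) = (\<lambda>j\<in>{..<n}. x j + y j)"
      by (rule extensionalityI[of _ "{..<n}"]) (auto simp: direct_sum_def jordan_module_def n_def)
    show "x \<oplus>\<^bsub>?N\<^esub> y \<in> carrier ?N" using x y unfolding a car by auto
    have "cf (x \<oplus>\<^bsub>?N\<^esub> y) v k = cf x v k + cf y v k" if v: "v \<in> H" and k: "k < l v" for v k
    proof -
      have "y (ix v) \<in> carrier_vec (l v)" using y ixH[OF v] lv[OF v] car by auto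
      then show ?thesis unfolding cf_def a using ixH[OF v] k by simp
    qed
    then show "\<psi> (x \<oplus>\<^bsub>?N\<^esub> y) = \<psi> x + \<psi> y"
      unfolding \<psi>_def chain_sum_add by (rule chain_sum_cong)
  qed
  have smu: "c \<odot>\<^bsub>?N\<^esub> x \<in> carrier ?N \<and> \<psi> (c \<odot>\<^bsub>?N\<^esub> x) = c *s \<psi> x"
    if x: "x \<in> carrier ?N" for c x
  proof
    have a: "c \<odot>\<^bsub>?N\<^esub> x = (\<lambda>j\<in>{..<n}. c \<cdot>\<^sub>v x j)"
      by (rule extensionalityI[of _ "{..<n}"]) (auto simp: direct_sum_def jordan_module_def n_def)
    show "c \<odot>\<^bsub>?N\<^esub> x \<in> carrier ?N" using x unfolding a car by auto
    have "cf (c \<odot>\<^bsub>?N\<^esub> x) v k = c * cf x v k" if v: "v \<in> H" and k: "k < l v" for v k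
    proof -
      have "x (ix v) \<in> carrier_vec (l v)" using x ixH[OF v] lv[OF v] car by auto
      then show ?thesis unfolding cf_def a using ixH[OF v] k by simp
    qed
    then show "\<psi> (c \<odot>\<^bsub>?N\<^esub> x) = c *s \<psi> x"
      unfolding \<psi>_def chain_sum_scale by (rule chain_sum_cong)
  qed
  \<comment> \<open>The element s^k acts as \<open>J k\<close>. The powers are reduced to
    \<open>J1\<close> by induction on the exponent.\<close>
  define J where "J k u = (\<lambda>j\<in>{..<n}. jordan_block (L ! j) (1::'k) ^\<^sub>m k *\<^sub>v u j)" for k u
  have J1: "\<psi> (J 1 u) = \<psi> u + t (\<psi> u)" if u: "u \<in> carrier ?N" for u
  proof -
    have "cf (J 1 u) v k = cf u v k + (if 1 \<le> k then cf u v (k - 1) else 0)" if v: "v \<in> H" and k: "k < l v" for v k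
    proof -
      have "u (ix v) \<in> carrier_vec (l v)" using u ixH[OF v] lv[OF v] car by auto
      from jordan_block_mult_vec[OF this, of "l v - 1 - k"] 
      have "(jordan_block (l v) 1 *\<^sub>v u (ix v)) $ (l v - 1 - k) = 
         u (ix v) $ (l v - 1 - k) + (if 1 \<le> k then u (ix v) $ (l v - 1 - (k - 1)) else 0)"
        using k by (cases k) (auto simp: Suc_diff_Suc)
      then show ?thesis using ixH(1)[OF v] lv[OF v] by (simp add: cf_def J_def)
    qed
    then have "\<psi> (J 1 u) = chain_sum H l (\<lambda>v k. cf u v k + (if 1 \<le> k then cf u v (k - 1) else 0))"
      unfolding \<psi>_def by (rule chain_sum_cong)
    also have "\<dots> = \<psi> u + (t ^^ 1) (\<psi> u)"
      unfolding chain_sum_add[symmetric] \<psi>_def funpow_chain_sum[OF cb] by (simp add: chain_sum_def)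
    finally show ?thesis by simp
  qed
  have Jcar: "J k u \<in> carrier ?N" if u: "u \<in> carrier ?N" for k u
    using u unfolding car by (auto simp: J_def intro!: mult_mat_vec_carrier[of _ "L ! _" "L ! _"])
  have JSuc: "J (Suc k) u = J k (J 1 u)" if u: "u \<in> carrier ?N" for k u
    unfolding J_def
  proof (intro restrict_ext)
    fix j assume "j \<in> {..<n}"
    then have "u j \<in> carrier_vec (L ! j)" using u by (auto simp: car)
    then show "jordan_block (L ! j) 1 ^\<^sub>m Suc k *\<^sub>v u j =
      jordan_block (L ! j) 1 ^\<^sub>m k *\<^sub>v (\<lambda>j\<in>{..<n}. jordan_block (L ! j) 1 ^\<^sub>m 1 *\<^sub>v u j) j"
      using \<open>j \<in> {..<n}\<close>
      by (simp add: assoc_mult_mat_vec[OF pow_carrier_mat[OF jordan_block_carrier] jordan_block_carrier])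
  qed
  have Jk: "\<psi> (J k u) = ((\<lambda>x. x + t x) ^^ k) (\<psi> u)" if "u \<in> carrier ?N" for k u
    using that
  proof (induction k arbitrary: u)
    case 0
    have "J 0 u = u" using 0 by (intro extensionalityI[of _ "{..<n}"]) (auto simp: J_def car)
    then show ?case by simp
  next
    case (Suc k)
    show ?case unfolding JSuc[OF Suc.prems] Suc.IH[OF Jcar[OF Suc.prems]] J1[OF Suc.prems]
      by (simp add: funpow_Suc_right del: funpow.simps)
  qed
  have act: "action ?N g u = J (LEAST k::nat. g = s [^]\<^bsub>G\<^esub> k) u" for g u
    by (rule extensionalityI[of _ "{..<n}"])
      (auto simp: direct_sum_def jordan_module_def jordan_rep_def J_def n_def)
  have "realizes G s ?N W \<psi>"
    unfolding realizes_def
  proof (intro conjI ballI allI)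
    show "bij_betw \<psi> (carrier ?N) W" using inj surj \<psi>W by (auto simp: bij_betw_def)
  qed (use add smu in \<open>auto simp: act Jk Jcar\<close>)
  then show ?thesis by blast
qed

lemma sum_functional:
  assumes "subspace W" "\<And>x y. x \<in> W \<Longrightarrow> y \<in> W \<Longrightarrow> f (x + y) = f x + f y"
    "\<And>c x. x \<in> W \<Longrightarrow> f (c *s x) = c * f x" "\<And>i. i \<in> I \<Longrightarrow> e i \<in> W"
  shows "f (\<Sum>i\<in>I. c i *s e i) = (\<Sum>i\<in>I. c i * f (e i) :: 'k)"
proof -
  have f0: "f 0 = 0" using assms(3)[of 0 0] subspace_0[OF assms(1)] by simp
  show ?thesis using assms(4)
  proof (induction I rule: infinite_finite_induct)
    case (insert i I)
    then have "(\<Sum>i\<in>I. c i *s e i) \<in> W" "c i *s e i \<in> W"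
      using assms(1) by (auto intro!: subspace_sum subspace_scale)
    then show ?case using insert assms by simp
  qed (simp_all add: f0)
qed

text \<open>The converse of \<open>chain_basis_realizes\<close>: the unit vectors of the summands
  are carried to \<open>W\<close> and form chains there. A summand of size 0 would have no head,
  hence the condition on \<open>L\<close>.\<close>

lemma realizes_chain_basis:
  assumes R: "realizes G s (direct_sum (map (jordan_module G s) L) :: ('k, nat \<Rightarrow> 'k vec, 'g) fg_module) W \<psi>"
    and inv: "invariant_subspace W" and s: "s \<in> carrier G" "(LEAST k::nat. s = s [^]\<^bsub>G\<^esub> k) = 1"
    and L1: "\<And>m. m \<in> set L \<Longrightarrow> m \<ge> 1"
  shows "\<exists>H l. chain_basis W H l \<and> mset L = image_mset l (mset_set H)"
proof -
  let ?N = "direct_sum (map (jordan_module G s) L) :: ('k, nat \<Rightarrow> 'k vec, 'g) fg_module"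
  define n where "n = length L"
  have car: "u \<in> carrier ?N \<longleftrightarrow> u \<in> extensional {..<n} \<and> (\<forall>j<n. u j \<in> carrier_vec (L ! j))" for u
    unfolding n_def by (rule carrier_direct_sum_jordan)
  have L1': "L ! j \<ge> 1" if "j < n" for j using L1 that by (simp add: n_def)
  have subW: "subspace W" using inv by (simp add: invariant_subspace_def)
  have bij: "bij_betw \<psi> (carrier ?N) W" 
    and \<psi>add: "\<And>x y. x \<in> carrier ?N \<Longrightarrow> y \<in> carrier ?N \<Longrightarrow> \<psi> (x \<oplus>\<^bsub>?N\<^esub> y) = \<psi> x + \<psi> y"
    and addc: "\<And>x y. x \<in> carrier ?N \<Longrightarrow> y \<in> carrier ?N \<Longrightarrow> x \<oplus>\<^bsub>?N\<^esub> y \<in> carrier ?N"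
    and \<psi>smu: "\<And>c x. x \<in> carrier ?N \<Longrightarrow> \<psi> (c \<odot>\<^bsub>?N\<^esub> x) = c *s \<psi> x"
    and smuc: "\<And>c x. x \<in> carrier ?N \<Longrightarrow> c \<odot>\<^bsub>?N\<^esub> x \<in> carrier ?N"
    and \<psi>act: "\<And>x. x \<in> carrier ?N \<Longrightarrow> \<psi> (action ?N s x) = \<psi> x + t (\<psi> x)"
    using R s unfolding realizes_def by auto
  have adde: "(x \<oplus>\<^bsub>?N\<^esub> y) j = x j + y j" if "j < n" for x y j
    using that by (simp add: direct_sum_def jordan_module_def n_def)
  have smue: "(c \<odot>\<^bsub>?N\<^esub> x) j = c \<cdot>\<^sub>v x j" if "j < n" for c x j
    using that by (simp add: direct_sum_def jordan_module_def n_def)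
  have acte: "action ?N s x = (\<lambda>j\<in>{..<n}. jordan_block (L ! j) 1 *\<^sub>v x j)" for x
    by (rule extensionalityI[of _ "{..<n}"])
      (auto simp: direct_sum_def jordan_module_def n_def jordan_rep_def s)
  define \<theta> where "\<theta> = inv_into (carrier ?N) \<psi>"
  have \<theta>: "\<theta> w \<in> carrier ?N" "\<psi> (\<theta> w) = w" if "w \<in> W" for w
    using bij that unfolding \<theta>_def by (metis bij_betwE bij_betw_inv_into, metis bij_betw_inv_into_right)
  have \<theta>\<psi>: "\<theta> (\<psi> u) = u" if "u \<in> carrier ?N" for u using bij that by (simp add: \<theta>_def bij_betw_inv_into_left)
  have \<psi>W: "\<psi> u \<in> W" if "u \<in> carrier ?N" for u using bij that by (auto dest: bij_betwE)
  have \<theta>add: "\<theta> (x + y) = \<theta> x \<oplus>\<^bsub>?N\<^esub> \<theta> y" if "x \<in> W" "y \<in> W" for x y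
    using \<theta>\<psi>[OF addc[OF \<theta>(1)[OF that(1)] \<theta>(1)[OF that(2)]]] \<psi>add \<theta> that by simp
  have \<theta>smu: "\<theta> (c *s x) = c \<odot>\<^bsub>?N\<^esub> \<theta> x" if "x \<in> W" for x c
    using \<theta>\<psi>[OF smuc[OF \<theta>(1)[OF that]], of c] \<psi>smu \<theta> that by simp
  define E where "E = (\<lambda>j k. \<lambda>i\<in>{..<n}. if i = j then unit_vec (L ! j) k else 0\<^sub>v (L ! i) :: 'k vec)"
  have Ec: "E j k \<in> carrier ?N" for j k by (auto simp: E_def car)
  have Eval: "E j k i $ m = (if i = j \<and> m = k then 1 else 0)" if "i < n" "m < L ! i" "k < L ! j" for i j k m
    using that by (auto simp: E_def)
  define e where "e j k = \<psi> (E j k)" for j k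
  have eW: "e j k \<in> W" for j k unfolding e_def by (rule \<psi>W[OF Ec])
  have te0: "t (e j k) = (if k = 0 then 0 else e j (k - 1))" if j: "j < n" and k: "k < L ! j" for j k
  proof -
    have ac: "action ?N s (E j k) = (if k = 0 then E j k else E j k \<oplus>\<^bsub>?N\<^esub> E j (k - 1))" (is "?l = ?r")
    proof (rule extensionalityI[of _ "{..<n}"])
      show "?l \<in> extensional {..<n}" by (simp add: acte)
      show "?r \<in> extensional {..<n}" using Ec addc car by (auto split: if_splits)
      fix i assume i: "i \<in> {..<n}"
      have Eci: "E j k' i \<in> carrier_vec (L ! i)" for k' using Ec car i by blast
      have ri: "?r i = (if k = 0 then E j k i else E j k i + E j (k - 1) i)" using i adde by simp
      show "?l i = ?r i"
      proof (rule eq_vecI)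
        show "dim_vec (?l i) = dim_vec (?r i)" using i Eci[of k] Eci[of "k - 1"]
          by (auto simp: acte ri jordan_block_def)
        fix m assume "m < dim_vec (?r i)"
        then have m: "m < L ! i" using carrier_vecD[OF Eci] by (auto simp: ri split: if_splits)
        have "?l i $ m = E j k i $ m + (if Suc m < L ! i then E j k i $ Suc m else 0)"
          using i jordan_block_mult_vec[OF Eci m] by (simp add: acte)
        also have "\<dots> = ?r i $ m" using Eval i m k Eci[of "k - 1"]
          by (auto simp: ri)
        finally show "?l i $ m = ?r i $ m" .
      qed
    qed
    have "e j k + t (e j k) = \<psi> (action ?N s (E j k))" using \<psi>act[OF Ec] by (simp add: e_def)
    then show ?thesis using \<psi>add[OF Ec Ec] by (auto simp: ac e_def split: if_splits)
  qed
  \<comment> \<open>The head of a chain is the image of the last unit vector of its summand.\<close>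
  define h where "h j = e j (L ! j - 1)" for j
  have th: "(t ^^ k) (h j) = e j (L ! j - 1 - k)" if "j < n" "k < L ! j" for j k
    using that
  proof (induction k)
    case (Suc k) then show ?case using te0[of j "L ! j - 1 - k"] by simp
  qed (simp add: h_def)
  have tend: "(t ^^ (L ! j)) (h j) = 0" if j: "j < n" for j
  proof -
    obtain m where m: "L ! j = Suc m" using L1'[OF j] by (cases "L ! j") auto
    then show ?thesis using th[OF j, of m] te0[OF j, of 0] by simp
  qed
  have coord: "\<theta> (\<Sum>x\<in>I. c x *s e (fst x) (snd x)) i $ m = (\<Sum>x\<in>I. c x * \<theta> (e (fst x) (snd x)) i $ m)"
    if i: "i < n" and m: "m < L ! i" for I c i m
  proof (rule sum_functional[OF subW])
    fix x y assume "x \<in> W" "y \<in> W"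
    then have "\<theta> y i \<in> carrier_vec (L ! i)" using \<theta>(1) i car by blast
    then show "\<theta> (x + y) i $ m = \<theta> x i $ m + \<theta> y i $ m" using \<open>x \<in> W\<close> \<open>y \<in> W\<close> i m by (simp add: \<theta>add adde)
  next
    fix c x assume "x \<in> W"
    then have "\<theta> x i \<in> carrier_vec (L ! i)" using \<theta>(1) i car by blast
    then show "\<theta> (c *s x) i $ m = c * \<theta> x i $ m" using \<open>x \<in> W\<close> i m by (simp add: \<theta>smu smue)
  qed (rule eW)
  define I where "I = (SIGMA j:{..<n}. {..<L ! j})"
  have finI: "finite I" by (simp add: I_def)
  have coordI: "\<theta> (\<Sum>x\<in>I. c x *s e (fst x) (snd x)) i $ m = c (i, m)" if i: "i < n" and m: "m < L ! i" for c i m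
  proof -
    have "(\<Sum>x\<in>I. c x * \<theta> (e (fst x) (snd x)) i $ m) = (\<Sum>x\<in>I. if x = (i, m) then c x else 0)"
      using i m by (intro sum.cong refl) (auto simp: I_def e_def \<theta>\<psi>[OF Ec] Eval split: if_splits)
    then show ?thesis unfolding coord[OF i m] using i m finI by (simp add: I_def)
  qed
  have hinj: "inj_on h {..<n}"
  proof (rule inj_onI, rule ccontr)
    fix i j assume ij: "i \<in> {..<n}" "j \<in> {..<n}" "h i = h j" "i \<noteq> j"
    have "E i (L ! i - 1) = E j (L ! j - 1)" using ij(3) \<theta>\<psi>[OF Ec] unfolding h_def e_def by metis
    then have "E i (L ! i - 1) i $ (L ! i - 1) = E j (L ! j - 1) i $ (L ! i - 1)" by simp
    then show False using Eval[of i "L ! i - 1" "L ! i - 1" i] Eval[of i "L ! i - 1" "L ! j - 1" j] ij L1'[of i] L1'[of j]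
      by auto
  qed
  define H where "H = h ` {..<n}"
  define l where "l v = L ! the_inv_into {..<n} h v" for v
  have lh: "l (h j) = L ! j" if "j < n" for j using that by (simp add: l_def the_inv_into_f_f[OF hinj])
  have cs: "chain_sum H l c = (\<Sum>x\<in>I. c (h (fst x)) (L ! fst x - 1 - snd x) *s e (fst x) (snd x))" for c
  proof -
    have "chain_sum H l c = (\<Sum>j<n. \<Sum>k<L ! j. c (h j) k *s e j (L ! j - 1 - k))"
      unfolding chain_sum_def H_def sum.reindex[OF hinj] comp_def by (intro sum.cong) (auto simp: lh th)
    also have "\<dots> = (\<Sum>j<n. \<Sum>k<L ! j. c (h j) (L ! j - 1 - k) *s e j k)"
    proof (rule sum.cong[OF refl])
      fix j
      show "(\<Sum>k<L ! j. c (h j) k *s e j (L ! j - 1 - k)) = (\<Sum>k<L ! j. c (h j) (L ! j - 1 - k) *s e j k)"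
        by (rule sum.reindex_bij_witness[of _ "\<lambda>k. L ! j - 1 - k" "\<lambda>k. L ! j - 1 - k"]) auto
    qed
    also have "\<dots> = (\<Sum>x\<in>I. c (h (fst x)) (L ! fst x - 1 - snd x) *s e (fst x) (snd x))"
      unfolding I_def by (subst sum.Sigma) (auto simp: split_def)
    finally show ?thesis .
  qed
  have "chain_basis W H l"
    unfolding chain_basis_def
  proof (intro conjI ballI allI impI)
    show "finite H" by (simp add: H_def)
  next
    fix v assume "v \<in> H" 
    then obtain j where j: "j < n" "v = h j" by (auto simp: H_def)
    show "v \<in> W" using eW j by (simp add: h_def)
    show "1 \<le> l v" using j lh L1' by simp
    show "(t ^^ l v) v = 0" using j tend lh by simp
  next
    fix c v k assume z: "chain_sum H l c = 0" and "v \<in> H" and k: "k < l v"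
    then obtain j where j: "j < n" "v = h j" by (auto simp: H_def)
    have kj: "k < L ! j" using k j lh by simp
    have "c (h j) (L ! j - 1 - (L ! j - 1 - k)) = \<theta> 0 j $ (L ! j - 1 - k)"
      using coordI[OF j(1), of "L ! j - 1 - k" "\<lambda>x. c (h (fst x)) (L ! fst x - 1 - snd x)"] kj
      unfolding cs[symmetric] z by simp
    also have "\<dots> = 0" using coordI[OF j(1), of "L ! j - 1 - k" "\<lambda>x. 0"] kj by simp
    finally show "c v k = 0" using j kj by simp
  next
    fix w assume w: "w \<in> W"
    define c where "c v k = \<theta> w (the_inv_into {..<n} h v) $ (l v - 1 - k)" for v k
    let ?w = "chain_sum H l c"
    have HW: "H \<subseteq> W" using eW by (auto simp: H_def h_def)
    have w': "?w \<in> W" by (rule chain_sum_in[OF inv HW])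
    have "\<theta> ?w = \<theta> w"
    proof (rule extensionalityI[of _ "{..<n}"])
      show "\<theta> ?w \<in> extensional {..<n}" "\<theta> w \<in> extensional {..<n}" using \<theta>(1) w w' car by blast+
      fix i assume "i \<in> {..<n}"
      then have i: "i < n" by simp
      show "\<theta> ?w i = \<theta> w i"
      proof (rule eq_vecI)
        have c2: "\<theta> ?w i \<in> carrier_vec (L ! i)" "\<theta> w i \<in> carrier_vec (L ! i)" using \<theta>(1) w w' car i by blast+
        then show "dim_vec (\<theta> ?w i) = dim_vec (\<theta> w i)" by simp
        fix m assume "m < dim_vec (\<theta> w i)"
        then have m: "m < L ! i" using c2 by simp
        show "\<theta> ?w i $ m = \<theta> w i $ m"
          unfolding cs coordI[OF i m] using i m by (simp add: c_def lh the_inv_into_f_f[OF hinj])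
      qed
    qed
    then have "w = ?w" using \<theta>(2) w w' by metis
    then show "\<exists>c. w = chain_sum H l c" by blast
  qed
  moreover have "mset L = image_mset l (mset_set H)"
  proof -
    have "image_mset l (mset_set H) = image_mset (\<lambda>j. l (h j)) (mset_set {..<n})"
      unfolding H_def image_mset_mset_set[OF hinj, symmetric] by (simp add: multiset.map_comp comp_def)
    also have "\<dots> = image_mset (\<lambda>j. L ! j) (mset_set {..<n})"
      by (rule image_mset_cong) (simp add: lh)
    also have "\<dots> = mset (map (\<lambda>j. L ! j) [0..<n])" by (simp add: lessThan_atLeast0)
    finally show ?thesis by (simp add: n_def map_nth)
  qed
  ultimately show ?thesis by blast
qed

text \<open>Reduces both descriptions of multiplicities to a comparison of multisets of chain
  lengths.\<close>

theorem fg_iso_direct_sum_iff: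
  assumes M: "realizes G s M W \<phi>" and inv: "invariant_subspace W" and cb: "chain_basis W H l"
    and s: "s \<in> carrier G" "(LEAST k::nat. s = s [^]\<^bsub>G\<^esub> k) = 1" and L1: "\<And>m. m \<in> set L \<Longrightarrow> m \<ge> 1"
  shows "fg_iso G M (direct_sum (map (jordan_module G s) L)) \<longleftrightarrow> mset L = image_mset l (mset_set H)"
proof
  assume "fg_iso G M (direct_sum (map (jordan_module G s) L))"
  then obtain \<psi> where "realizes G s (direct_sum (map (jordan_module G s) L) :: ('k, nat \<Rightarrow> 'k vec, _) fg_module) W \<psi>"
    using fg_iso_imp_realizes[OF M] by blast
  from realizes_chain_basis[OF this inv s L1]
  obtain H' l' where "chain_basis W H' l'" "mset L = image_mset l' (mset_set H')" by auto
  with chain_lengths_unique[OF inv cb] show "mset L = image_mset l (mset_set H)" by simp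
next
  assume "mset L = image_mset l (mset_set H)"
  then show "fg_iso G M (direct_sum (map (jordan_module G s) L))"
    using chain_basis_realizes[OF cb inv] realizes_imp_fg_iso[OF M] by meson
qed

end

section \<open>The permutation module \<open>F[w\<^sub>0, \<dots>, w\<^sub>p\<^sub>-\<^sub>1]\<close>\<close>

lemma poly_mapping_vector_space:
  "vector_space (\<lambda>c (f :: 'k::field mpoly). mconst c * f)"
  by unfold_locales (simp_all add: algebra_simps)

lemma funpow_pred: "n > 0 \<Longrightarrow> f ((f ^^ (n - 1)) x) = (f ^^ n) x"
  by (cases n) simp_all

locale cyclic_prime =
  fixes p :: nat and K :: "'k::field itself"
  assumes p: "prime p" and char: "CHAR('k) = p"
begin

lemma p_gt: "p > 0" "p \<ge> 2" "p > 1"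
  using p prime_gt_0_nat prime_ge_2_nat prime_gt_1_nat by auto

section \<open>Rotation of the exponent vectors\<close>

definition next_var :: "nat \<Rightarrow> nat" where
  "next_var i = (if i < p then Suc i mod p else i)"

text \<open>The inverse of \<open>next_var\<close>; adding p - 1 avoids a truncated subtraction.
  Both fix the indices from \<open>p\<close> on, so that they are permutations of all natural
  numbers.\<close>

definition prev_var :: "nat \<Rightarrow> nat" where
  "prev_var i = (if i < p then (i + (p - 1)) mod p else i)"

lemma next_prev [simp]: "next_var (prev_var i) = i"
proof (cases "i < p")
  case True
  have "Suc ((i + (p - 1)) mod p) mod p = Suc (i + (p - 1)) mod p" by (simp add: mod_Suc_eq)
  also have "\<dots> = i" using True p_gt by simp
  finally show ?thesis using True p_gt by (simp add: next_var_def prev_var_def)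
qed (simp add: next_var_def prev_var_def)

lemma prev_next [simp]: "prev_var (next_var i) = i"
proof (cases "i < p")
  case True
  have "(Suc i mod p + (p - 1)) mod p = (Suc i + (p - 1)) mod p" by (simp add: mod_add_left_eq)
  also have "\<dots> = i" using True p_gt by simp
  finally show ?thesis using True p_gt by (simp add: next_var_def prev_var_def)
qed (simp add: next_var_def prev_var_def)

lemma next_var_lt: "next_var i < p \<longleftrightarrow> i < p"
  using p_gt by (simp add: next_var_def)

definition rot :: "(nat \<Rightarrow>\<^sub>0 nat) \<Rightarrow> (nat \<Rightarrow>\<^sub>0 nat)" where
  "rot e = (\<Sum>i\<in>keys e. single (next_var i) (lookup e i))"

lemma lookup_rot: "lookup (rot e) i = lookup e (prev_var i)"
proof -
  have "lookup (rot e) i = (\<Sum>j\<in>keys e. if j = prev_var i then lookup e j else 0)"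
    unfolding rot_def lookup_sum by (intro sum.cong) (auto simp: lookup_single when_def)
  then show ?thesis by (simp add: in_keys_iff)
qed

lemma rot_inj: "rot e = rot e' \<Longrightarrow> e = e'"
  by (rule poly_mapping_eqI) (metis lookup_rot prev_next)

lemma lookup_rot_funpow: "lookup ((rot ^^ n) e) i = lookup e ((prev_var ^^ n) i)"
  by (induction n arbitrary: i) (simp_all add: lookup_rot funpow_swap1[of prev_var])

lemma prev_var_funpow: "i < p \<Longrightarrow> (prev_var ^^ n) i = (i + n * (p - 1)) mod p"
proof (induction n)
  case (Suc n)
  have "(prev_var ^^ Suc n) i = prev_var ((i + n * (p - 1)) mod p)" using Suc by simp
  also have "\<dots> = ((i + n * (p - 1)) mod p + (p - 1)) mod p" using p_gt by (simp add: prev_var_def)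
  also have "\<dots> = (i + n * (p - 1) + (p - 1)) mod p" by (rule mod_add_left_eq)
  also have "i + n * (p - 1) + (p - 1) = i + Suc n * (p - 1)" by simp
  finally show ?case .
qed simp

lemma rot_funpow_p: "(rot ^^ p) e = e"
proof (rule poly_mapping_eqI)
  fix i
  have "(prev_var ^^ p) i = i"
  proof (cases "i < p")
    case False
    then have "(prev_var ^^ n) i = i" for n by (induction n) (simp_all add: prev_var_def)
    then show ?thesis .
  qed (simp add: prev_var_funpow)
  then show "lookup ((rot ^^ p) e) i = lookup e i" by (simp add: lookup_rot_funpow)
qed

lemma rot_monomials: "e \<in> monomials p d \<Longrightarrow> rot e \<in> monomials p d"
proof -
  assume e: "e \<in> monomials p d"
  have "keys (rot e) \<subseteq> {..<p}"
  proof
    fix i assume "i \<in> keys (rot e)"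
    then have "prev_var i \<in> keys e" by (simp add: in_keys_iff lookup_rot)
    then have "prev_var i < p" using e by (auto simp: monomials_iff)
    then show "i \<in> {..<p}" using next_var_lt[of "prev_var i"] by simp
  qed
  moreover have "(\<Sum>i<p. lookup (rot e) i) = (\<Sum>i<p. lookup e i)"
    unfolding lookup_rot
    by (rule sum.reindex_bij_witness[of _ next_var prev_var]) (use next_var_lt next_var_lt[of "prev_var _"] in auto)
  ultimately show ?thesis using e by (simp add: monomials_iff)
qed

lemma rot_orbit_inj:
  assumes "rot e \<noteq> e" shows "inj_on (\<lambda>i. (rot ^^ i) e) {..<p}"
proof (rule inj_onI, rule ccontr)
  have main: False if ij: "i < j" "j < p" "(rot ^^ i) e = (rot ^^ j) e" for i j
  proof -
    define k where "k = j - i"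
    have k: "0 < k" "k < p" using ij by (auto simp: k_def)
    have inj: "(rot ^^ n) a = (rot ^^ n) b \<Longrightarrow> a = b" for n a b
      by (induction n) (auto dest: rot_inj)
    have "(rot ^^ i) ((rot ^^ k) e) = (rot ^^ i) e"
      using ij by (simp add: k_def flip: funpow_add comp_apply[of "rot ^^ i"])
    then have ke: "(rot ^^ k) e = e" by (rule inj)
    have mult: "(rot ^^ (n * m)) e = e" if "(rot ^^ m) e = e" for n m
      using that by (induction n) (simp_all add: funpow_add)
    have "coprime k p" using k p by (metis coprime_commute nat_dvd_not_less prime_imp_coprime_nat)
    \<comment> \<open>k x is congruent to 1 modulo p, so a return after k steps would be a return
      after one step.\<close>
    then obtain x y where xy: "k * x = p * y + 1" using bezout_nat[of k p] k by auto
    have "e = (rot ^^ (x * k)) e" using mult[OF ke] by simp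
    also have "\<dots> = (rot ^^ (1 + y * p)) e" using xy by (simp add: mult.commute)
    also have "\<dots> = rot e" using mult[OF rot_funpow_p] by (simp add: funpow_swap1)
    finally show False using assms by simp
  qed
  fix i j assume "i \<in> {..<p}" "j \<in> {..<p}" "(rot ^^ i) e = (rot ^^ j) e" "i \<noteq> j"
  then show False using main[of i j] main[of j i] by (cases "i < j") auto
qed

text \<open>The exponent vector of the j-th power of nu = w_0 ... w_(p-1). By
  \<open>rot_fixed\<close> these are the only monomials fixed by the rotation.\<close>

definition constant_monomial :: "nat \<Rightarrow> nat \<Rightarrow>\<^sub>0 nat" where
  "constant_monomial j = (\<Sum>i<p. single i j)"

lemma lookup_constant_monomial: "lookup (constant_monomial j) i = (if i < p then j else 0)"
proof -
  have "lookup (constant_monomial j) i = (\<Sum>k<p. if k = i then j else 0)"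
    unfolding constant_monomial_def lookup_sum by (intro sum.cong) (auto simp: lookup_single when_def)
  then show ?thesis by simp
qed

lemma constant_monomial_add: "constant_monomial i + constant_monomial j = constant_monomial (i + j)"
  by (rule poly_mapping_eqI) (simp add: lookup_add lookup_constant_monomial)

lemma constant_monomial_in: "constant_monomial j \<in> monomials p (p * j)"
  by (auto simp: monomials_iff in_keys_iff lookup_constant_monomial split: if_splits)

lemma rot_constant_monomial: "rot (constant_monomial j) = constant_monomial j"
  by (rule poly_mapping_eqI) (use next_var_lt[of "prev_var _"] in \<open>simp add: lookup_rot lookup_constant_monomial\<close>)

lemma rot_fixed:
  assumes "rot e = e" "e \<in> monomials p d"
  shows "p dvd d \<and> e = constant_monomial (d div p)"
proof -
  have l0: "lookup e i = lookup e 0" if "i < p" for i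
    using that
  proof (induction i)
    case (Suc i)
    have "lookup e (Suc i) = lookup (rot e) (Suc i)" using assms by simp
    also have "\<dots> = lookup e i" using Suc.prems prev_next[of i] by (simp add: lookup_rot next_var_def)
    finally show ?case using Suc by simp
  qed simp
  have c: "e = constant_monomial (lookup e 0)"
  proof (rule poly_mapping_eqI)
    fix i
    show "lookup e i = lookup (constant_monomial (lookup e 0)) i"
    proof (cases "i < p")
      case True then show ?thesis using l0[OF True] by (simp only: lookup_constant_monomial if_True)
    next
      case False
      then have "i \<notin> keys e" using assms(2) by (auto simp: monomials_iff)
      then show ?thesis using False by (simp add: lookup_constant_monomial in_keys_iff)
    qed
  qed
  have "d = (\<Sum>i<p. lookup e i)" using assms(2) by (simp add: monomials_iff)
  also have "\<dots> = (\<Sum>i<p. lookup e 0)" by (intro sum.cong refl l0) simp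
  finally have "d = p * lookup e 0" by simp
  then have "d div p = lookup e 0" "p dvd d" using p_gt by simp_all
  then show ?thesis using c by (metis (no_types))
qed

section \<open>The rotation of A and its invariants\<close>

definition rotA :: "'k mpoly \<Rightarrow> 'k mpoly" where
  "rotA = meval mconst (mvar \<circ> next_var)"

lemma rotA_simps [simp]:
  "rotA 0 = 0" "rotA 1 = 1" "rotA (f + g) = rotA f + rotA g" "rotA (f * g) = rotA f * rotA g"
  "rotA (mconst c) = mconst c" "rotA (mvar i) = mvar (next_var i)" "rotA (sum a I) = (\<Sum>i\<in>I. rotA (a i))"
  by (simp_all add: rotA_def mconst.meval_add mconst.meval_mult mconst.meval_sum)

lemma rotA_power [simp]: "rotA (f ^ n) = rotA f ^ n"
  by (simp add: rotA_def mconst.meval_power)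

lemma rotA_single: "rotA (single e c) = single (rot e) c"
proof -
  have "monom_value (mvar \<circ> next_var) e = (single (rot e) 1 :: 'k mpoly)"
  proof -
    have p: "(single (single i 1) 1 :: 'k mpoly) ^ n = single (single i n) 1" for i n
      by (induction n) (simp_all add: mult_single single_add[symmetric])
    have "(\<Prod>i\<in>A. single (single (next_var i) (g i)) 1) = (single (\<Sum>i\<in>A. single (next_var i) (g i)) 1 :: 'k mpoly)"
      if "finite A" for A g
      using that by (induction A rule: finite_induct) (simp_all add: mult_single)
    then show ?thesis by (simp add: monom_value_def mvar_def p[unfolded One_nat_def] rot_def)
  qed
  then show ?thesis by (simp add: rotA_def mconst.meval_single mconst_def mult_single)
qed

lemma lookup_rotA: "lookup (rotA f) (rot e) = lookup f e"
proof -
  have "rotA f = (\<Sum>e\<in>keys f. single (rot e) (lookup f e))"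
    by (subst poly_mapping_as_sum[of f]) (simp add: rotA_single del: single_of_nat)
  then have "lookup (rotA f) (rot e) = lookup (\<Sum>e\<in>keys f. single (rot e) (lookup f e)) (rot e)" by simp
  also have "\<dots> = (\<Sum>e'\<in>keys f. if e' = e then lookup f e' else 0)"
    unfolding lookup_sum by (intro sum.cong) (auto simp: lookup_single when_def dest: rot_inj)
  finally show ?thesis by (simp add: in_keys_iff)
qed

lemma lookup_rotA_funpow: "lookup ((rotA ^^ n) f) ((rot ^^ n) e) = lookup f e"
  by (induction n) (simp_all add: lookup_rotA)

lemma rotA_funpow_p: "(rotA ^^ p) f = f"
  by (rule poly_mapping_eqI) (metis lookup_rotA_funpow rot_funpow_p)

lemma rotA_homogeneous: "f \<in> homogeneous p d \<Longrightarrow> rotA f \<in> homogeneous p d"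
proof (rule homogeneousI)
  fix e assume f: "f \<in> homogeneous p d" and l: "lookup (rotA f) e \<noteq> 0"
  have e: "e = rot ((rot ^^ (p - 1)) e)" using rot_funpow_p[of e] funpow_pred[OF p_gt(1), of rot e] by simp
  then have "lookup f ((rot ^^ (p - 1)) e) \<noteq> 0" using l lookup_rotA by metis
  then have "(rot ^^ (p - 1)) e \<in> monomials p d" by (rule homogeneousD[OF f])
  then show "e \<in> monomials p d" using rot_monomials e by metis
qed

lemma linear_operator_A: "linear_operator (\<lambda>c (f :: 'k mpoly). mconst c * f) (\<lambda>f. rotA f - f)"
  using poly_mapping_vector_space
  by (auto simp: linear_operator_def linear_operator_axioms_def algebra_simps)

sublocale A: linear_operator "\<lambda>c (f :: 'k mpoly). mconst c * f" "\<lambda>f. rotA f - f"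
  by (rule linear_operator_A)

abbreviation tA :: "'k mpoly \<Rightarrow> 'k mpoly" where
  "tA f \<equiv> rotA f - f"

lemma tA_homogeneous: "f \<in> homogeneous p d \<Longrightarrow> tA f \<in> homogeneous p d"
  by (intro homogeneous_diff rotA_homogeneous)

lemma tA_funpow_homogeneous: "f \<in> homogeneous p d \<Longrightarrow> (tA ^^ n) f \<in> homogeneous p d"
  by (induction n) (simp_all add: tA_homogeneous)

text \<open>The coefficient of a power of nu is a functional that kills im t; it detects the trivial
  summand of a layer.\<close>

lemma lookup_tA_constant: "lookup (tA f) (constant_monomial j) = 0"
  using lookup_rotA[of f "constant_monomial j"] by (simp add: lookup_minus rot_constant_monomial)

lemma transfer_A: "(\<Sum>i<p. (rotA ^^ i) f) = (tA ^^ (p - 1)) f"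
  using A.char_sum_funpow_one_plus[OF p char, of f] by simp

text \<open>Induction on the number of monomials. An invariant without a fixed monomial is a
  combination of sums over orbits of p elements, and by \<open>transfer_A\<close> such a sum is
  t^(p-1) applied to one of its terms.\<close>

lemma invariant_A:
  assumes "f \<in> homogeneous p d" "rotA f = f" "p dvd d \<Longrightarrow> lookup f (constant_monomial (d div p)) = 0"
  shows "\<exists>g\<in>homogeneous p d. f = (tA ^^ (p - 1)) g"
  using assms
proof (induction "card (keys f)" arbitrary: f rule: less_induct)
  case less
  show ?case
  proof (cases "f = 0")
    case True
    then show ?thesis using A.funpow_zero by (intro bexI[of _ 0]) simp_all
  next
    case False
    then obtain e where e: "e \<in> keys f" using poly_mapping_eqI[of f 0] by (auto simp: in_keys_iff)
    then have eM: "e \<in> monomials p d" using less.prems(1) by (auto simp: homogeneous_def)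
    have ne: "rot e \<noteq> e"
      using rot_fixed[OF _ eM] less.prems(3) e by (auto simp: in_keys_iff)
    define c where "c = lookup f e"
    \<comment> \<open>The orbit sum of the chosen monomial. By invariance \<open>f\<close> has the
      same coefficient on the whole orbit, so subtracting the sum removes the orbit from the
      keys.\<close>
    define s where "s = (\<Sum>i<p. (rotA ^^ i) (single e c))"
    have ri: "(rotA ^^ i) (single e c) = single ((rot ^^ i) e) c" for i
      by (induction i) (simp_all add: rotA_single)
    have frot: "lookup f ((rot ^^ i) e') = lookup f e'" for i e'
    proof -
      have "(rotA ^^ i) f = f" by (induction i) (simp_all add: less.prems(2))
      then show ?thesis using lookup_rotA_funpow[of i f e'] by simp
    qed
    have ls: "lookup s e' = (if e' \<in> (\<lambda>i. (rot ^^ i) e) ` {..<p} then c else 0)" for e'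
    proof -
      have "lookup s e' = (\<Sum>i<p. if (rot ^^ i) e = e' then c else 0)"
        unfolding s_def ri lookup_sum by (intro sum.cong) (auto simp: lookup_single when_def)
      also have "\<dots> = (\<Sum>x\<in>(\<lambda>i. (rot ^^ i) e) ` {..<p}. if x = e' then c else 0)"
        by (simp add: sum.reindex[OF rot_orbit_inj[OF ne]])
      finally show ?thesis by simp
    qed
    have l2: "lookup (f - s) e' = (if e' \<in> (\<lambda>i. (rot ^^ i) e) ` {..<p} then 0 else lookup f e')" for e'
      by (auto simp: lookup_minus ls frot c_def)
    have "e \<in> (\<lambda>i. (rot ^^ i) e) ` {..<p}" using p_gt by (auto intro!: image_eqI[of _ _ 0])
    then have "e \<notin> keys (f - s)" by (simp add: in_keys_iff l2)
    moreover have "keys (f - s) \<subseteq> keys f" by (auto simp: in_keys_iff l2 split: if_splits)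
    ultimately have sub: "keys (f - s) \<subset> keys f" using e by blast
    have eq: "s = (tA ^^ (p - 1)) (single e c)" unfolding s_def by (rule transfer_A)
    have sh: "single e c \<in> homogeneous p d" by (rule homogeneous_single[OF eM])
    have "tA ((tA ^^ (p - 1)) (single e c)) = (tA ^^ p) (single e c)"
      by (rule funpow_pred[OF p_gt(1)])
    also have "\<dots> = 0" using A.char_funpow_one_plus[OF p char, of "single e c"] rotA_funpow_p by simp
    finally have ts: "tA s = 0" by (simp add: eq)
    have "\<exists>g\<in>homogeneous p d. f - s = (tA ^^ (p - 1)) g"
    proof (rule less.hyps)
      show "card (keys (f - s)) < card (keys f)" using sub by (simp add: psubset_card_mono)
      show "f - s \<in> homogeneous p d"
        using less.prems(1) sh eq tA_funpow_homogeneous by (simp add: homogeneous_diff)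
      show "rotA (f - s) = f - s" using less.prems(2) ts A.t_diff[of f s] by simp
      show "p dvd d \<Longrightarrow> lookup (f - s) (constant_monomial (d div p)) = 0" using less.prems(3) by (simp add: l2)
    qed
    then obtain g where g: "g \<in> homogeneous p d" "f - s = (tA ^^ (p - 1)) g" by blast
    have "f = (tA ^^ (p - 1)) (g + single e c)" using g(2) eq by (simp add: A.funpow_add algebra_simps)
    then show ?thesis using g(1) sh homogeneous_add by blast
  qed
qed

section \<open>The elements z and tN of A\<close>

definition z :: "'k mpoly" where "z = (\<Sum>i<p. mvar i)"

text \<open>This is tN by \<open>rho_N\<close>, and also the value of the polynomial N at Y =
  w_0.\<close>

definition c :: "'k mpoly" where "c = mvar 0 ^ p - z ^ (p - 1) * mvar 0"

lemma rotA_z: "rotA z = z"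
proof -
  have "rotA z = (\<Sum>i<p. mvar (next_var i))" by (simp add: z_def)
  also have "\<dots> = z" unfolding z_def
    by (rule sum.reindex_bij_witness[of _ prev_var next_var]) (use next_var_lt next_var_lt[of "prev_var _"] in auto)
  finally show ?thesis .
qed

lemma z_homogeneous: "z \<in> homogeneous p 1"
  unfolding z_def by (intro homogeneous_sum homogeneous_mvar) simp

lemma z_nonzero: "z \<noteq> 0"
proof
  assume "z = 0"
  then have "lookup z (single 0 1) = 0" by simp
  moreover have "lookup z (single 0 1) = (\<Sum>i<p. if i = 0 then 1 else 0)"
    unfolding z_def lookup_sum mvar_def
    by (intro sum.cong) (auto simp: lookup_single when_def dest: arg_cong[where f = keys])
  ultimately show False using p_gt by simp
qed

lemma lookup_mvar_mult: "lookup (mvar i * f) (single i 1 + e) = lookup f e"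
  unfolding mvar_def by (simp add: lookup_single_mult)

lemma lookup_mvar_mult_0:
  assumes "lookup e i = 0" shows "lookup (mvar i * f) e = 0"
proof (rule ccontr)
  assume "lookup (mvar i * f) e \<noteq> 0"
  then obtain a where "e = single i 1 + a"
    using keys_mult[of "mvar i" f] by (auto simp: mvar_def in_keys_iff)
  then show False using assms by (simp add: lookup_add)
qed

text \<open>A multinomial coefficient: the variables of a squarefree monomial are distributed over
  the factors of the power. The induction splits off the variable taken from the first
  factor.\<close>

lemma lookup_z_power:
  assumes "I \<subseteq> {..<p}"
  shows "lookup (z ^ card I) (\<Sum>i\<in>I. single i 1) = of_nat (fact (card I))"
  using assms
proof (induction "card I" arbitrary: I)
  case 0
  then have "I = {}" using finite_subset by fastforce
  then show ?case by simp
next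
  case (Suc n)
  have fin: "finite I" using Suc.prems finite_subset by blast
  have l: "lookup (\<Sum>i\<in>I. single i (1::nat)) j = (if j \<in> I then 1 else 0)" for j
  proof -
    have "lookup (\<Sum>i\<in>I. single i (1::nat)) j = (\<Sum>i\<in>I. if i = j then 1 else 0)"
      unfolding lookup_sum by (intro sum.cong) (auto simp: lookup_single when_def)
    then show ?thesis using fin by simp
  qed
  have "lookup (z ^ card I) (\<Sum>i\<in>I. single i 1) = (\<Sum>j<p. lookup (mvar j * z ^ n) (\<Sum>i\<in>I. single i 1))"
    unfolding Suc(2)[symmetric] power_Suc by (subst (1) z_def) (simp add: sum_distrib_right lookup_sum)
  also have "\<dots> = (\<Sum>j<p. if j \<in> I then of_nat (fact n) else 0)"
  proof (rule sum.cong[OF refl])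
    fix j
    show "lookup (mvar j * z ^ n) (\<Sum>i\<in>I. single i 1) = (if j \<in> I then of_nat (fact n) else 0)"
    proof (cases "j \<in> I")
      case True
      then have c: "card (I - {j}) = n" using Suc(2) fin by simp
      have "(\<Sum>i\<in>I. single i (1::nat)) = single j 1 + (\<Sum>i\<in>I - {j}. single i 1)"
        using True fin by (simp add: sum.remove)
      then have "lookup (mvar j * z ^ n) (\<Sum>i\<in>I. single i 1) = lookup (z ^ n) (\<Sum>i\<in>I - {j}. single i 1)"
        by (simp add: lookup_mvar_mult[unfolded One_nat_def])
      also have "\<dots> = of_nat (fact n)" using Suc(1)[of "I - {j}"] Suc.prems c by auto
      finally show ?thesis using True by simp
    next
      case False
      then show ?thesis by (simp add: lookup_mvar_mult_0 l[unfolded One_nat_def])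
    qed
  qed
  also have "\<dots> = (\<Sum>j\<in>I. of_nat (fact n))"
    by (rule sum.mono_neutral_cong_right) (use Suc.prems in auto)
  also have "\<dots> = of_nat (fact (card I))" unfolding Suc(2)[symmetric] fact_Suc using Suc(2) by simp
  finally show ?case .
qed

lemma lookup_c: "lookup c (constant_monomial 1) \<noteq> 0"
proof -
  \<comment> \<open>Only z^(p-1) w_0 contains this monomial. Splitting off w_0 leaves w_1 ...
    w_(p-1), which has coefficient (p-1)! in z^(p-1).\<close>
  have E: "constant_monomial 1 = single 0 1 + (\<Sum>i\<in>{1..<p}. single i 1)"
  proof -
    have "{..<p} = insert 0 {1..<p}" using p_gt by auto
    then show ?thesis unfolding constant_monomial_def by simp
  qed
  have "lookup (mvar 0 ^ p) (constant_monomial 1) = (0::'k)"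
  proof -
    have pw: "(mvar 0 :: 'k mpoly) ^ n = single (single 0 n) 1" for n
      by (induction n) (simp_all add: mvar_def mult_single single_add[symmetric])
    have "lookup (single 0 p) 0 \<noteq> lookup (constant_monomial 1) 0"
      using p_gt by (simp add: lookup_constant_monomial)
    then have "single 0 p \<noteq> constant_monomial 1" by metis
    then show ?thesis unfolding pw by (simp add: lookup_single when_def)
  qed
  moreover have "lookup (z ^ (p - 1) * mvar 0) (constant_monomial 1) = of_nat (fact (p - 1))"
  proof -
    have "{1..<p} \<subseteq> {..<p}" by auto
    from lookup_z_power[OF this] show ?thesis
      unfolding E mult.commute[of _ "mvar 0"] lookup_mvar_mult by simp
  qed
  moreover have "(of_nat (fact (p - 1)) :: 'k) \<noteq> 0"
    unfolding of_nat_eq_0_iff_char_dvd char using prime_dvd_fact_iff[OF p, of "p - 1"] p_gt by simp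
  ultimately show ?thesis by (simp add: c_def lookup_minus)
qed

end

section \<open>The model \<open>F[w\<^sub>0, \<dots>, w\<^sub>p\<^sub>-\<^sub>1][Y]\<close>\<close>

hide_const (open) Module.smult up_ring.coeff up_ring.monom

text \<open>Degree below \<open>n\<close>, where \<open>low 0\<close> means the zero polynomial, a
  case that \<open>degree\<close> does not separate from the constants.\<close>

definition low :: "nat \<Rightarrow> 'a::zero poly \<Rightarrow> bool" where
  "low n f \<longleftrightarrow> (\<forall>i\<ge>n. coeff f i = 0)"

lemma low_0 [simp]: "low n 0"
  by (simp add: low_def)

lemma low_add: "low n f \<Longrightarrow> low n g \<Longrightarrow> low n (f + g)"
  by (simp add: low_def)

lemma low_diff: "low n f \<Longrightarrow> low n g \<Longrightarrow> low n (f - (g :: 'a::ab_group_add poly))"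
  by (simp add: low_def)

lemma low_smult: "low n f \<Longrightarrow> low n (smult a f)"
  by (simp add: low_def)

lemma low_mono: "low n f \<Longrightarrow> n \<le> m \<Longrightarrow> low m f"
  by (simp add: low_def)

lemma low_degree: "low (Suc n) f \<longleftrightarrow> degree f \<le> n"
  unfolding low_def using le_degree[of f] coeff_eq_0[of f] by (metis Suc_le_eq leading_coeff_0_iff le_less_linear not_less_eq_eq degree_0 order.trans bot_nat_0.extremum)

lemma low_iff_0: "low 0 f \<longleftrightarrow> f = 0"
  by (auto simp: low_def poly_eq_iff)

lemma low_Suc: "low (Suc n) f \<Longrightarrow> coeff f n = 0 \<Longrightarrow> low n f"
  unfolding low_def by (metis le_antisym not_less_eq_eq)

lemma low_mult: "low n f \<Longrightarrow> low (Suc m) g \<Longrightarrow> low (n + m) (f * (g :: 'a::comm_ring_1 poly))"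
  unfolding low_def coeff_mult
proof (intro allI impI sum.neutral ballI)
  fix i k assume *: "\<forall>i\<ge>n. coeff f i = 0" "\<forall>i\<ge>Suc m. coeff g i = 0" "n + m \<le> i" "k \<in> {..i}"
  then show "coeff f k * coeff g (i - k) = 0" by (cases "n \<le> k") auto
qed

section \<open>The substitution of Y + b for Y and its leading coefficients\<close>

lemma coeff_shift:
  fixes f :: "'a::comm_ring_1 poly"
  assumes "degree f \<le> D"
  shows "coeff (pcompose f [:b, 1:]) n = (\<Sum>i\<le>D. coeff f i * (of_nat (i choose n) * b ^ (i - n)))"
proof -
  have m: "pcompose (monom a i) [:b, 1:] = smult a ([:b, 1:] ^ i)" for a i
    by (induction i) (simp_all add: monom_Suc monom_0 pcompose_pCons)
  have "pcompose f [:b, 1:] = pcompose (\<Sum>i\<le>D. monom (coeff f i) i) [:b, 1:]"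
    using poly_as_sum_of_monoms'[OF assms] by simp
  also have "\<dots> = (\<Sum>i\<le>D. smult (coeff f i) ([:b, 1:] ^ i))" by (simp add: pcompose_sum m)
  finally have e: "pcompose f [:b, 1:] = (\<Sum>i\<le>D. smult (coeff f i) ([:b, 1:] ^ i))" .
  have "coeff ([:b, 1:] ^ i) n = of_nat (i choose n) * b ^ (i - n)" for i
  proof (cases "n \<le> i")
    case True then show ?thesis by (simp add: coeff_linear_poly_power)
  next
    case False
    then have "degree ([:b, 1:] ^ i) < n" using degree_power_le[of "[:b, 1:]" i] by simp
    then show ?thesis using False by (simp add: coeff_eq_0 binomial_eq_0)
  qed
  then show ?thesis by (simp add: e coeff_sum)
qed

lemma coeff_shift_top:
  fixes f :: "'a::comm_ring_1 poly"
  assumes "low (Suc n) f"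
  shows "coeff (pcompose f [:b, 1:]) n = coeff f n" "low (Suc n) (pcompose f [:b, 1:])"
proof -
  have d: "degree f \<le> n" using assms low_degree by blast
  have "(\<Sum>i\<le>n. coeff f i * (of_nat (i choose n) * b ^ (i - n))) = (\<Sum>i\<in>{n}. coeff f i * (of_nat (i choose n) * b ^ (i - n)))"
    by (rule sum.mono_neutral_right) (auto simp: binomial_eq_0)
  then show "coeff (pcompose f [:b, 1:]) n = coeff f n" by (simp add: coeff_shift[OF d])
  show "low (Suc n) (pcompose f [:b, 1:])" unfolding low_def
  proof (intro allI impI)
    fix i assume "Suc n \<le> i"
    then show "coeff (pcompose f [:b, 1:]) i = 0"
      unfolding coeff_shift[OF d] by (intro sum.neutral) (auto simp: binomial_eq_0)
  qed
qed

text \<open>Just below the top only the first derivative adds a term to the Taylor expansion. This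
  coefficient will force the Y-degree of an element of ker u to be divisible by p.\<close>

lemma coeff_shift_pred:
  fixes f :: "'a::comm_ring_1 poly"
  assumes "low (Suc (Suc n)) f"
  shows "coeff (pcompose f [:b, 1:]) n = coeff f n + of_nat (Suc n) * b * coeff f (Suc n)"
proof -
  have d: "degree f \<le> Suc n" using assms low_degree by blast
  have "(\<Sum>i\<le>Suc n. coeff f i * (of_nat (i choose n) * b ^ (i - n))) = (\<Sum>i\<in>{n, Suc n}. coeff f i * (of_nat (i choose n) * b ^ (i - n)))"
    by (rule sum.mono_neutral_right) (auto simp: binomial_eq_0)
  then show ?thesis by (simp add: coeff_shift[OF d] mult_ac)
qed

lemma low_shift_diff:
  fixes f :: "'a::comm_ring_1 poly"
  assumes "low n f"
  shows "low (n - 1) (pcompose f [:b, 1:] - f)"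
proof (cases n)
  case 0 then show ?thesis using assms by (simp add: low_iff_0)
next
  case (Suc m)
  then have f: "low (Suc m) f" using assms by simp
  have "low (Suc m) (pcompose f [:b, 1:] - f)" by (rule low_diff[OF coeff_shift_top(2)[OF f] f])
  then have "low m (pcompose f [:b, 1:] - f)" by (rule low_Suc) (simp add: coeff_shift_top(1)[OF f])
  then show ?thesis by (simp add: Suc)
qed

lemma poly_mpoly_vector_space:
  "vector_space (\<lambda>c (f :: 'k::field mpoly poly). smult (mconst c) f)"
  by unfold_locales (simp_all add: smult_add_right smult_add_left)

context cyclic_prime
begin

definition shift :: "'k mpoly \<Rightarrow> 'k mpoly poly \<Rightarrow> 'k mpoly poly" where
  "shift b f = pcompose f [:b, 1:]"

text \<open>The action of the generator. The order matters: rotating after the shift would send Y to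
  Y + w_1.\<close>

definition rho :: "'k mpoly poly \<Rightarrow> 'k mpoly poly" where
  "rho f = shift (mvar 0) (map_poly rotA f)"

lemma shift_simps [simp]:
  "shift b 0 = 0" "shift b 1 = 1" "shift b (f + g) = shift b f + shift b g" "shift b (f - g) = shift b f - shift b g"
  "shift b (f * g) = shift b f * shift b g" "shift b (smult a f) = smult a (shift b f)" "shift b [:a:] = [:a:]"
  "shift b [:0, 1:] = [:b, 1:]"
  by (simp_all add: shift_def pcompose_1 pcompose_add pcompose_diff pcompose_mult pcompose_smult pcompose_pCons)

lemma shift_power [simp]: "shift b (f ^ n) = shift b f ^ n"
  by (induction n) simp_all

lemma shift_shift: "shift a (shift b f) = shift (a + b) f"
  by (simp add: shift_def pcompose_assoc[symmetric] pcompose_pCons add.commute)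

lemma coeff_map_rotA [simp]: "coeff (map_poly rotA f) i = rotA (coeff f i)"
  by (simp add: coeff_map_poly)

lemma map_rotA_simps [simp]:
  "map_poly rotA (f + g) = map_poly rotA f + map_poly rotA g"
  "map_poly rotA (f * g) = map_poly rotA f * map_poly rotA g"
  "map_poly rotA (smult a f) = smult (rotA a) (map_poly rotA f)"
  "map_poly rotA 1 = 1"
  by (auto intro!: poly_eqI simp: coeff_mult coeff_1)

lemma map_rotA_pCons [simp]: "map_poly rotA (pCons a f) = pCons (rotA a) (map_poly rotA f)"
  by (rule poly_eqI) (simp add: coeff_pCons split: nat.splits)

lemma map_rotA_shift: "map_poly rotA (shift b f) = shift (rotA b) (map_poly rotA f)"
  unfolding shift_def by (induction f) (simp_all add: pcompose_pCons)

lemma rho_simps [simp]: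
  "rho 0 = 0" "rho 1 = 1" "rho (f + g) = rho f + rho g" "rho (f * g) = rho f * rho g"
  "rho (smult a f) = smult (rotA a) (rho f)" "rho [:a:] = [:rotA a:]" "rho [:0, 1:] = [:mvar 0, 1:]"
  by (simp_all add: rho_def)

lemma rho_power [simp]: "rho (f ^ n) = rho f ^ n"
  by (induction n) simp_all

lemma rho_funpow: "(rho ^^ n) f = shift (\<Sum>i<n. (rotA ^^ i) (mvar 0)) (((map_poly rotA) ^^ n) f)"
proof (induction n)
  case 0 show ?case by (simp add: shift_def)
next
  case (Suc n)
  have "(rho ^^ Suc n) f = shift (mvar 0 + (\<Sum>i<n. (rotA ^^ Suc i) (mvar 0))) (((map_poly rotA) ^^ Suc n) f)"
    by (simp add: Suc rho_def map_rotA_shift shift_shift)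
  also have "mvar 0 + (\<Sum>i<n. (rotA ^^ Suc i) (mvar 0)) = (\<Sum>i<Suc n. (rotA ^^ i) (mvar 0))"
    by (subst sum.lessThan_Suc_shift) simp
  finally show ?case .
qed

lemma rotA_funpow_mvar: "i < p \<Longrightarrow> (rotA ^^ i) (mvar 0) = mvar i"
  by (induction i) (simp_all add: next_var_def)

text \<open>After p steps the coefficients are back in place, while the increments of Y have run
  through all the w_i, whose sum is z.\<close>

lemma rho_funpow_p: "(rho ^^ p) f = shift z f"
proof -
  have "((map_poly rotA) ^^ n) f = map_poly (rotA ^^ n) f" for n
  proof (rule poly_eqI)
    fix i
    have r0: "(rotA ^^ n) 0 = 0" by (induction n) simp_all
    have "coeff ((map_poly rotA ^^ n) f) i = (rotA ^^ n) (coeff f i)" by (induction n) simp_all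
    then show "coeff ((map_poly rotA ^^ n) f) i = coeff (map_poly (rotA ^^ n) f) i"
      by (simp add: coeff_map_poly r0)
  qed
  moreover have "map_poly (rotA ^^ p) f = f" by (rule poly_eqI) (simp add: coeff_map_poly rotA_funpow_p)
  ultimately show ?thesis by (simp add: rho_funpow z_def rotA_funpow_mvar)
qed

lemma shift_funpow: "(shift b ^^ n) f = shift (of_nat n * b) f"
proof (induction n)
  case 0 show ?case by (simp add: shift_def)
next
  case (Suc n) then show ?case by (simp add: shift_shift algebra_simps)
qed

lemma char_mpoly: "(of_nat n :: 'k mpoly) = 0 \<longleftrightarrow> p dvd n"
  using CHAR_poly_mapping by (metis char of_nat_eq_0_iff_char_dvd)

lemma rho_funpow_p2: "(rho ^^ (p * p)) f = f"
proof -
  have "(rho ^^ (p * p)) f = ((rho ^^ p) ^^ p) f" by (simp add: funpow_mult)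
  also have "(rho ^^ p) = shift z" using rho_funpow_p by blast
  finally show ?thesis using char_mpoly[of p] by (simp add: shift_funpow) (simp add: shift_def)
qed

lemma linear_operator_S: "linear_operator (\<lambda>c (f :: 'k mpoly poly). smult (mconst c) f) (\<lambda>f. rho f - f)"
  using poly_mpoly_vector_space
  by (auto simp: linear_operator_def linear_operator_axioms_def smult_diff_right)

sublocale S: linear_operator "\<lambda>c (f :: 'k mpoly poly). smult (mconst c) f" "\<lambda>f. rho f - f"
  by (rule linear_operator_S)

abbreviation t :: "'k mpoly poly \<Rightarrow> 'k mpoly poly" where "t f \<equiv> rho f - f"

definition u :: "'k mpoly poly \<Rightarrow> 'k mpoly poly" where "u f = shift z f - f"

lemma t_funpow_p: "(t ^^ p) f = u f"
  using S.char_funpow_one_plus[OF p char, of f] rho_funpow_p[of f] by (simp add: u_def algebra_simps)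

text \<open>Because of t^p = u, exponents of t are split by division with remainder by p. The block
  sizes a p + j of the overview come from here.\<close>

lemma t_funpow_mult_p: "(t ^^ (p * a + j)) f = (t ^^ j) ((u ^^ a) f)"
proof -
  have tu: "(t ^^ p) = u" using t_funpow_p by blast
  have "(t ^^ (p * a + j)) f = (t ^^ (j + p * a)) f" by (simp add: add.commute)
  also have "\<dots> = (t ^^ j) ((t ^^ (p * a)) f)" by (simp add: funpow_add)
  also have "(t ^^ (p * a)) = (u ^^ a)" unfolding tu[symmetric] by (simp add: funpow_mult mult.commute)
  finally show ?thesis .
qed

lemma linear_operator_u: "linear_operator (\<lambda>c (f :: 'k mpoly poly). smult (mconst c) f) u"
  using poly_mpoly_vector_space
  by (auto simp: linear_operator_def linear_operator_axioms_def u_def smult_diff_right)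

sublocale U: linear_operator "\<lambda>c (f :: 'k mpoly poly). smult (mconst c) f" u
  by (rule linear_operator_u)

lemma u_funpow_p: "(u ^^ p) f = 0"
  using U.char_funpow_one_plus[OF p char, of f] shift_funpow[of p z f] char_mpoly[of p]
  by (simp add: u_def) (simp add: shift_def)

lemma t_funpow_p2: "(t ^^ (p * p)) f = 0"
  using t_funpow_mult_p[of p 0 f] u_funpow_p by simp

lemma u_mult: "u h = 0 \<Longrightarrow> u (h * f) = h * u f"
  by (simp add: u_def algebra_simps)

lemma u_smult: "u (smult a f) = smult a (u f)"
  by (simp add: u_def smult_diff_right)

lemma u_funpow_smult: "(u ^^ n) (smult a f) = smult a ((u ^^ n) f)"
  by (induction n) (simp_all add: u_smult)

lemma t_smult: "rotA a = a \<Longrightarrow> t (smult a f) = smult a (t f)"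
  by (simp add: smult_diff_right)

lemma t_funpow_smult: "rotA a = a \<Longrightarrow> (t ^^ n) (smult a f) = smult a ((t ^^ n) f)"
  by (induction n) (simp_all add: smult_diff_right)

lemma low_u: "low n f \<Longrightarrow> low (n - 1) (u f)"
  unfolding u_def shift_def by (rule low_shift_diff)

lemma low_u_funpow: "low n f \<Longrightarrow> low (n - k) ((u ^^ k) f)"
  by (induction k) (simp_all, metis diff_Suc_eq_diff_pred diff_commute low_u)

text \<open>Adding w_0 to Y does not change the top coefficient. So on top coefficients, that is, on
  the layers of the filtration, the generator acts by the rotation alone.\<close>

lemma rho_top:
  assumes "low (Suc n) f"
  shows "coeff (rho f) n = rotA (coeff f n)" "low (Suc n) (rho f)"
proof -
  have l: "low (Suc n) (map_poly rotA f)" using assms by (simp add: low_def)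
  show "coeff (rho f) n = rotA (coeff f n)" "low (Suc n) (rho f)"
    using coeff_shift_top[OF l, of "mvar 0"] by (simp_all add: rho_def shift_def)
qed

lemma t_top: "low (Suc n) f \<Longrightarrow> coeff (t f) n = tA (coeff f n)" "low (Suc n) f \<Longrightarrow> low (Suc n) (t f)"
  using rho_top[of n f] by (simp_all add: low_diff)

lemma t_funpow_top:
  assumes "low (Suc n) f"
  shows "coeff ((t ^^ k) f) n = (tA ^^ k) (coeff f n) \<and> low (Suc n) ((t ^^ k) f)"
  by (induction k) (use assms t_top in auto)

subsection \<open>The graded pieces\<close>

definition S_deg :: "nat \<Rightarrow> 'k mpoly poly set" where
  "S_deg n = {f. \<forall>i. if i \<le> n then coeff f i \<in> homogeneous p (n - i) else coeff f i = 0}"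

lemma S_degD: "f \<in> S_deg n \<Longrightarrow> i \<le> n \<Longrightarrow> coeff f i \<in> homogeneous p (n - i)" "f \<in> S_deg n \<Longrightarrow> low (Suc n) f"
  by (auto simp: S_deg_def low_def split: if_splits)

lemma S_deg_0 [simp]: "0 \<in> S_deg n"
  by (simp add: S_deg_def)

lemma S_deg_add: "f \<in> S_deg n \<Longrightarrow> g \<in> S_deg n \<Longrightarrow> f + g \<in> S_deg n"
  by (auto simp: S_deg_def intro: homogeneous_add)

lemma S_deg_diff: "f \<in> S_deg n \<Longrightarrow> g \<in> S_deg n \<Longrightarrow> f - g \<in> S_deg n"
  by (auto simp: S_deg_def intro: homogeneous_diff)

lemma S_deg_sum: "(\<And>i. i \<in> I \<Longrightarrow> f i \<in> S_deg n) \<Longrightarrow> sum f I \<in> S_deg n"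
  by (induction I rule: infinite_finite_induct) (simp_all add: S_deg_add)

lemma S_deg_mult: "f \<in> S_deg n \<Longrightarrow> g \<in> S_deg m \<Longrightarrow> f * g \<in> S_deg (n + m)"
proof -
  assume f: "f \<in> S_deg n" and g: "g \<in> S_deg m"
  have "coeff f j * coeff g (i - j) \<in> homogeneous p (n + m - i)" if "i \<le> n + m" "j \<le> i" for i j
  proof (cases "j \<le> n \<and> i - j \<le> m")
    case True
    then have "coeff f j * coeff g (i - j) \<in> homogeneous p ((n - j) + (m - (i - j)))"
      using S_degD(1)[OF f] S_degD(1)[OF g] by (intro homogeneous_mult) auto
    moreover have "(n - j) + (m - (i - j)) = n + m - i" using True that by linarith
    ultimately show ?thesis by (simp only:)
  next
    case False
    then have "coeff f j = 0 \<or> coeff g (i - j) = 0"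
      using S_degD(2)[OF f] S_degD(2)[OF g] by (auto simp: low_def)
    then show ?thesis by auto
  qed
  moreover have "low (Suc n + m) (f * g)" using low_mult S_degD(2) f g by blast
  ultimately show ?thesis by (auto simp: S_deg_def coeff_mult low_def intro!: homogeneous_sum)
qed

lemma S_deg_const: "a \<in> homogeneous p n \<Longrightarrow> [:a:] \<in> S_deg n"
  by (auto simp: S_deg_def coeff_pCons split: nat.splits)

lemma S_deg_smult: "a \<in> homogeneous p n \<Longrightarrow> f \<in> S_deg m \<Longrightarrow> smult a f \<in> S_deg (n + m)"
  using S_deg_mult[OF S_deg_const] by fastforce

lemma S_deg_scale: "f \<in> S_deg m \<Longrightarrow> smult (mconst a) f \<in> S_deg m"
  using S_deg_smult[OF homogeneous_mconst] by fastforce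

lemma S_deg_linear: "a \<in> homogeneous p 1 \<Longrightarrow> [:a, 1:] \<in> S_deg 1"
  by (auto simp: S_deg_def coeff_pCons homogeneous_1 split: nat.splits)

lemma S_deg_Y: "[:0, 1:] \<in> S_deg 1"
  by (rule S_deg_linear) simp

lemma S_deg_power: "f \<in> S_deg m \<Longrightarrow> f ^ k \<in> S_deg (k * m)"
proof (induction k)
  case 0 then show ?case using S_deg_const[OF homogeneous_1] by (simp add: one_pCons)
next
  case (Suc k) then show ?case using S_deg_mult[of f m "f ^ k"] by simp
qed

lemma S_deg_as_sum: "f = (\<Sum>i\<le>degree f. [:coeff f i:] * [:0, 1:] ^ i)"
proof -
  have "monom (coeff f i) i = [:coeff f i:] * [:0, 1:] ^ i" for i by (simp add: monom_altdef)
  then show ?thesis using poly_as_sum_of_monoms[of f] by simp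
qed

lemma rho_S_deg: "f \<in> S_deg n \<Longrightarrow> rho f \<in> S_deg n"
proof -
  assume f: "f \<in> S_deg n"
  have rsum: "rho (sum g I) = (\<Sum>i\<in>I. rho (g i))" for g and I :: "nat set"
    by (induction I rule: infinite_finite_induct) simp_all
  have "rho f = rho (\<Sum>i\<le>degree f. [:coeff f i:] * [:0, 1:] ^ i)" by (rule arg_cong[OF S_deg_as_sum])
  also have "\<dots> = (\<Sum>i\<le>degree f. [:rotA (coeff f i):] * [:mvar 0, 1:] ^ i)" by (simp add: rsum)
  also have "\<dots> \<in> S_deg n"
  proof (rule S_deg_sum)
    fix i assume "i \<in> {..degree f}"
    moreover have "degree f \<le> n" using S_degD(2)[OF f] by (simp add: low_degree)
    ultimately have i: "i \<le> n" by simp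
    have "[:rotA (coeff f i):] * [:mvar 0, 1:] ^ i \<in> S_deg ((n - i) + i * 1)"
      using S_degD(1)[OF f i] p_gt
      by (intro S_deg_mult S_deg_const S_deg_power S_deg_linear rotA_homogeneous homogeneous_mvar)
    then show "[:rotA (coeff f i):] * [:mvar 0, 1:] ^ i \<in> S_deg n" using i by simp
  qed
  finally show ?thesis .
qed

lemma t_S_deg: "f \<in> S_deg n \<Longrightarrow> t f \<in> S_deg n"
  by (intro S_deg_diff rho_S_deg)

lemma S_deg_invariant: "S.invariant_subspace (S_deg n)"
  unfolding S.invariant_subspace_def S.subspace_def using S_deg_add S_deg_scale t_S_deg by auto

lemma t_funpow_S_deg: "f \<in> S_deg n \<Longrightarrow> (t ^^ k) f \<in> S_deg n"
  by (rule S.invariant_funpow[OF S_deg_invariant])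

section \<open>The kernel T of u and the element N\<close>

definition T_deg :: "nat \<Rightarrow> 'k mpoly poly set" where
  "T_deg n = {f\<in>S_deg n. u f = 0}"

lemma t_u: "u (t f) = t (u f)"
  using funpow_swap1[of t p f] by (simp only: t_funpow_p)

lemma T_deg_invariant: "S.invariant_subspace (T_deg n)"
  unfolding S.invariant_subspace_def
proof
  show "S.subspace (T_deg n)"
    using U.t_add U.t_scale S_deg_add S_deg_scale unfolding S.subspace_def T_deg_def by (simp add: U.t_zero)
  show "t ` T_deg n \<subseteq> T_deg n" using t_S_deg by (auto simp: T_deg_def t_u)
qed

lemma T_deg_add: "f \<in> T_deg n \<Longrightarrow> g \<in> T_deg n \<Longrightarrow> f + g \<in> T_deg n"
  using S_deg_add U.t_add by (auto simp: T_deg_def)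

lemma t_funpow_T_deg: "f \<in> T_deg n \<Longrightarrow> (t ^^ k) f \<in> T_deg n"
  by (rule S.invariant_funpow[OF T_deg_invariant])

lemma t_funpow_p_T: "f \<in> T_deg n \<Longrightarrow> (t ^^ p) f = 0"
  by (simp add: T_deg_def t_funpow_p)

text \<open>The product of Y + jz over j in the prime field, that is, the norm of Y under the
  subgroup generated by Y -> Y + z.\<close>

definition N :: "'k mpoly poly" where
  "N = [:0, 1:] ^ p - smult (z ^ (p - 1)) [:0, 1:]"

lemma freshman: "(f + g) ^ p = f ^ p + (g ^ p :: 'k mpoly poly)"
  by (rule freshmans_dream) (simp_all add: CHAR_poly_mapping char p)

lemma rho_diff: "rho (f - g) = rho f - rho g"
  using rho_simps(3)[of "f - g" g] by simp

text \<open>By Frobenius the polynomial N is additive in Y, so adding w_0 to Y adds the value of N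
  at w_0.\<close>

lemma rho_N: "rho N = N + [:c:]"
proof -
  have Y: "[:mvar 0, 1:] = [:0, 1:] + [:mvar 0 :: 'k mpoly:]" by simp
  have "rho N = [:mvar 0, 1:] ^ p - smult (z ^ (p - 1)) [:mvar 0, 1:]"
    unfolding N_def rho_diff rho_simps rho_power rotA_power rotA_z by simp
  also have "[:mvar 0, 1:] ^ p = [:0, 1:] ^ p + [:(mvar 0 :: 'k mpoly) ^ p:]"
    unfolding Y freshman by (simp add: poly_const_pow)
  finally show ?thesis unfolding N_def c_def by (simp add: poly_eq_iff coeff_pCons split: nat.split)
qed

lemma u_N: "u N = 0"
proof -
  have Y: "[:z, 1:] = [:0, 1:] + [:z:]" by simp
  have "shift z N = [:z, 1:] ^ p - smult (z ^ (p - 1)) [:z, 1:]"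
    unfolding N_def shift_simps shift_power by simp
  also have "[:z, 1:] ^ p = [:0, 1:] ^ p + [:z ^ p:]" unfolding Y freshman by (simp add: poly_const_pow)
  finally have "shift z N = [:0, 1:] ^ p + [:z ^ p:] - smult (z ^ (p - 1)) [:z, 1:]" .
  moreover have "z ^ p = z ^ (p - 1) * z" using p_gt by (simp add: power_eq_if mult.commute)
  ultimately show ?thesis by (simp add: u_def N_def poly_eq_iff coeff_pCons split: nat.split)
qed

lemma shift_N: "shift z N = N"
  using u_N by (simp add: u_def)

lemma N_S_deg: "N \<in> S_deg p"
proof -
  have "[:0, 1:] ^ p \<in> S_deg p" using S_deg_power[OF S_deg_Y, of p] by simp
  moreover have "smult (z ^ (p - 1)) [:0, 1:] \<in> S_deg (p - 1 + 1)"
    using homogeneous_power[OF z_homogeneous, of "p - 1"] by (intro S_deg_smult S_deg_Y) simp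
  then have "smult (z ^ (p - 1)) [:0, 1:] \<in> S_deg p" using p_gt by (simp only: le_add_diff_inverse2)
  ultimately show ?thesis unfolding N_def by (rule S_deg_diff)
qed

lemma N_degree: "degree N = p" "lead_coeff N = 1"
proof -
  have "coeff N p = 1"
    using p_gt by (simp add: N_def coeff_linear_poly_power coeff_pCons split: nat.splits)
  then have "p \<le> degree N" by (intro le_degree) simp
  moreover have "degree N \<le> p" using S_degD(2)[OF N_S_deg] by (simp add: low_degree)
  ultimately show "degree N = p" "lead_coeff N = 1" using \<open>coeff N p = 1\<close> by auto
qed

lemma N_power_degree: "degree (N ^ k) = k * p" "coeff (N ^ k) (k * p) = 1"
proof -
  show "degree (N ^ k) = k * p" using N_degree by (subst degree_power_eq) auto
  then show "coeff (N ^ k) (k * p) = 1" using lead_coeff_power[of N k] N_degree by simp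
qed

lemma low_N_power: "low (Suc (k * p)) (N ^ k)"
  by (simp add: low_degree N_power_degree)

lemma smult_N_power_T: "a \<in> homogeneous p d \<Longrightarrow> smult a (N ^ k) \<in> T_deg (d + k * p)"
  unfolding T_deg_def using S_deg_smult[OF _ S_deg_power[OF N_S_deg]] by (simp add: u_def shift_N)

text \<open>The binomial terms from c^2 on have N-degree at most k - 1, hence Y-degree below k
  p.\<close>

lemma N_plus_c_power:
  "\<exists>r. (N + [:c:]) ^ Suc k = N ^ Suc k + of_nat (Suc k) * [:c:] * N ^ k + r \<and> low (k * p) r"
proof (induction k)
  case 0 show ?case by (intro exI[of _ 0]) simp
next
  case (Suc k)
  then obtain r where r: "(N + [:c:]) ^ Suc k = N ^ Suc k + of_nat (Suc k) * [:c:] * N ^ k + r" "low (k * p) r"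
    by blast
  let ?r = "of_nat (Suc k) * [:c:] * [:c:] * N ^ k + r * (N + [:c:])"
  have "(N + [:c:]) ^ Suc (Suc k) = (N + [:c:]) ^ Suc k * (N + [:c:])" by (simp add: mult.commute)
  also have "\<dots> = N ^ Suc (Suc k) + of_nat (Suc (Suc k)) * [:c:] * N ^ Suc k + ?r"
    unfolding r(1) by (simp add: algebra_simps del: mult_pCons_left mult_pCons_right)
  finally have "(N + [:c:]) ^ Suc (Suc k) = N ^ Suc (Suc k) + of_nat (Suc (Suc k)) * [:c:] * N ^ Suc k + ?r" .
  moreover have "low (Suc k * p) ?r"
  proof (rule low_add)
    have "low (Suc k * p) (N ^ k)" by (rule low_mono[OF low_N_power]) (use p_gt in simp)
    then have "low (Suc k * p) (smult (of_nat (Suc k) * c * c) (N ^ k))" by (rule low_smult)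
    then show "low (Suc k * p) (of_nat (Suc k) * [:c:] * [:c:] * N ^ k)"
      by (simp add: of_nat_poly mult_ac del: of_nat_Suc)
    have "low (Suc p) (N + [:c:])" using low_N_power[of 1] by (intro low_add) (auto simp: low_def coeff_pCons split: nat.splits)
    from low_mult[OF r(2) this] show "low (Suc k * p) (r * (N + [:c:]))" by (simp add: add.commute)
  qed
  ultimately show ?case by blast
qed

end

section \<open>Invariants of the subgroup of order \<open>p\<close>\<close>

lemma (in vector_space) dim_injective_image:
  assumes add: "\<And>x y. f (x + y) = f x + f y" and sc: "\<And>a x. f (scale a x) = scale a (f x)"
    and inj: "inj f"
  shows "dim (f ` V) = dim V"
proof -
  have hom: "Modules.module_hom scale scale f"
    by unfold_locales (simp_all add: add sc algebra_simps)
  obtain B where B: "B \<subseteq> V" "independent B" "V \<subseteq> span B" "card B = dim V" by (rule basis_exists)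
  have "independent (f ` B)"
    using Modules.module_hom.independent_injective_image[OF hom B(2)] inj_on_subset[OF inj subset_UNIV] by blast
  moreover have "f ` V \<subseteq> span (f ` B)" by (rule Modules.module_hom.spans_image[OF hom B(3)])
  ultimately have "card (f ` B) = dim (f ` V)" using B(1) by (intro basis_card_eq_dim) auto
  moreover have "card (f ` B) = card B" using inj_on_subset[OF inj subset_UNIV] by (intro card_image)
  ultimately show ?thesis using B(4) by simp
qed

text \<open>The binomial coefficient is the dimension of A_d. By Vandermonde and the divisibility of
  the middle coefficients \<open>p choose k\<close>, the residue of \<open>n choose (p - 1)\<close>
  modulo p has period p in n, so d may be replaced by its remainder.\<close>

lemma choose_pred_prime_mod:
  assumes "prime p"
  shows "((d + p - 1) choose d) mod p = (if p dvd d then 1 else 0)"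
proof -
  have p: "p > 1" using assms prime_gt_1_nat by blast
  have step: "((n + p) choose (p - 1)) mod p = (n choose (p - 1)) mod p" for n
  proof -
    have "p dvd (p choose k) * (n choose (p - 1 - k))" if "k \<in> {..p - 1} - {0}" for k
      using that dvd_choose_prime[of k p] assms p by auto
    then have "p dvd (\<Sum>k\<in>{..p - 1} - {0}. (p choose k) * (n choose (p - 1 - k)))" by (rule dvd_sum)
    moreover have "((n + p) choose (p - 1)) = (n choose (p - 1)) + (\<Sum>k\<in>{..p - 1} - {0}. (p choose k) * (n choose (p - 1 - k)))"
    proof -
      have "((n + p) choose (p - 1)) = (\<Sum>k\<le>p - 1. (p choose k) * (n choose (p - 1 - k)))"
        unfolding vandermonde by (simp add: add.commute)
      also have "\<dots> = (p choose 0) * (n choose (p - 1 - 0)) + (\<Sum>k\<in>{..p - 1} - {0}. (p choose k) * (n choose (p - 1 - k)))"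
        by (rule sum.remove) auto
      finally show ?thesis by simp
    qed
    ultimately show ?thesis by (auto elim!: dvdE)
  qed
  have steps: "((n + p * q) choose (p - 1)) mod p = (n choose (p - 1)) mod p" for n q
  proof (induction q)
    case (Suc q)
    have "((n + p * Suc q) choose (p - 1)) mod p = ((n + p * q + p) choose (p - 1)) mod p" by (simp add: add_ac)
    then show ?case using step[of "n + p * q"] Suc by simp
  qed simp
  have "(d + p - 1) choose d = ((d mod p + (p - 1)) + p * (d div p)) choose (p - 1)"
  proof -
    have "(d + p - 1) choose d = (d + p - 1) choose (p - 1)"
      using binomial_symmetric[of d "d + p - 1"] p by simp
    moreover have "d + p - 1 = (d mod p + (p - 1)) + p * (d div p)" using p mod_mult_div_eq[of d p] by linarith
    ultimately show ?thesis by metis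
  qed
  then have *: "((d + p - 1) choose d) mod p = ((d mod p + (p - 1)) choose (p - 1)) mod p" using steps by metis
  show ?thesis
  proof (cases "p dvd d")
    case True then show ?thesis using * p by simp
  next
    case False
    then have "d mod p > 0" by (simp add: dvd_eq_mod_eq_0)
    then obtain r where r: "d mod p = Suc r" by (cases "d mod p") auto
    have "r < p - 1" using r p mod_less_divisor[of p d] by linarith
    then have "((r + p) choose (p - 1)) mod p = 0" using step[of r] by (simp add: binomial_eq_0)
    moreover have "d mod p + (p - 1) = r + p" using r p by simp
    ultimately show ?thesis using * False by simp
  qed
qed

section \<open>The filtration of T by N-degree\<close>

context cyclic_prime
begin

text \<open>The elements of T_m of N-degree below \<open>k\<close>, expressed by the Y-degree since
  N is monic of degree p in Y.\<close>

definition F :: "nat \<Rightarrow> nat \<Rightarrow> 'k mpoly poly set" where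
  "F m k = {f\<in>T_deg m. low (k * p) f}"

text \<open>The coefficient of u f just below the top is (n + 1) z times the top coefficient of f,
  and (n + 1) z is nonzero if p does not divide n + 1.\<close>

lemma T_deg_top:
  assumes "u f = 0" "low (Suc (Suc n)) f" "\<not> p dvd Suc n"
  shows "coeff f (Suc n) = 0"
proof -
  have "coeff (u f) n = of_nat (Suc n) * z * coeff f (Suc n)"
    using coeff_shift_pred[OF assms(2), of z] by (simp add: u_def shift_def)
  then have "of_nat (Suc n) * z * coeff f (Suc n) = 0" using assms(1) by simp
  then show ?thesis using assms(3) z_nonzero char_mpoly[of "Suc n"] by (simp del: of_nat_Suc)
qed

text \<open>Descent with \<open>T_deg_top\<close> from (k + 1) p to the next multiple of p. The top
  term can then be cancelled by a multiple of N^k, and this is how T = A[N] arises.\<close>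

lemma T_deg_low:
  assumes "u f = 0" "low (Suc k * p) f"
  shows "low (Suc (k * p)) f"
proof -
  have "low (k * p + Suc j) f \<Longrightarrow> j < p \<Longrightarrow> low (Suc (k * p)) f" for j
  proof (induction j)
    case (Suc j)
    have "\<not> p dvd Suc j" using Suc.prems by (simp add: nat_dvd_not_less del: add_Suc_right)
    then have "\<not> p dvd k * p + Suc j" by (simp add: dvd_add_right_iff del: add_Suc_right)
    then have "coeff f (k * p + Suc j) = 0" using T_deg_top[OF assms(1), of "k * p + j"] Suc.prems by simp
    then have "low (k * p + Suc j) f" using Suc.prems(1) low_Suc[of "k * p + Suc j" f] by simp
    then show ?case using Suc by simp
  qed simp
  from this[of "p - 1"] show ?thesis using assms(2) p_gt by (simp add: add.commute)
qed

lemma F_0: "F m 0 = {0}"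
  by (auto simp: F_def T_deg_def low_iff_0 U.t_zero)

lemma F_Suc_low: "f \<in> F m (Suc k) \<Longrightarrow> low (Suc (k * p)) f"
  using T_deg_low by (auto simp: F_def T_deg_def)

lemma F_coeff: "f \<in> F m (Suc k) \<Longrightarrow> k * p \<le> m \<Longrightarrow> coeff f (k * p) \<in> homogeneous p (m - k * p)"
  using S_degD(1) by (auto simp: F_def T_deg_def)

lemma F_decrease: "f \<in> F m (Suc k) \<Longrightarrow> coeff f (k * p) = 0 \<Longrightarrow> f \<in> F m k"
  using low_Suc[OF F_Suc_low] by (simp add: F_def)

lemma F_mono: "f \<in> F m k \<Longrightarrow> f \<in> F m (Suc k)"
  unfolding F_def by (auto elim: low_mono)

lemma t_F: "f \<in> F m k \<Longrightarrow> t f \<in> F m k"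
proof (cases k)
  case 0 then show "f \<in> F m k \<Longrightarrow> t f \<in> F m k" by (simp add: F_0)
next
  case (Suc k')
  assume f: "f \<in> F m k"
  then have "low (k * p) (t f)" using t_top(2)[of "k * p - 1" f] Suc p_gt by (simp add: F_def)
  then show "t f \<in> F m k" using f t_funpow_T_deg[of f m 1] by (simp add: F_def)
qed

lemma F_invariant: "S.invariant_subspace (F m k)"
  unfolding S.invariant_subspace_def
proof
  have "S.subspace (T_deg m)" using T_deg_invariant by (simp add: S.invariant_subspace_def)
  then show "S.subspace (F m k)" unfolding S.subspace_def F_def by (auto intro: low_add low_smult)
  show "t ` F m k \<subseteq> F m k" using t_F by auto
qed

lemmas F_subspace = S.invariantD(1)[OF F_invariant]
lemmas F_add = S.subspace_add[OF F_subspace]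
lemmas F_diff = S.subspace_diff[OF F_subspace]
lemmas F_scale = S.subspace_scale[OF F_subspace]

lemma t_funpow_F: "f \<in> F m k \<Longrightarrow> (t ^^ n) f \<in> F m k"
  by (rule S.invariant_funpow[OF F_invariant])

lemma smult_N_power_F:
  assumes "a \<in> homogeneous p (m - k * p)" "k * p \<le> m"
  shows "smult a (N ^ k) \<in> F m (Suc k)"
proof -
  have "smult a (N ^ k) \<in> T_deg m" using smult_N_power_T[OF assms(1), of k] assms(2) by simp
  moreover have "low (Suc k * p) (smult a (N ^ k))"
    by (rule low_smult, rule low_mono[OF low_N_power]) (use p_gt in simp)
  ultimately show ?thesis by (simp add: F_def)
qed

lemma t_t_funpow_pred: "f \<in> T_deg m \<Longrightarrow> t ((t ^^ (p - 1)) f) = 0"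
proof -
  assume f: "f \<in> T_deg m"
  have "t ((t ^^ (p - 1)) f) = (t ^^ p) f" by (rule funpow_pred[OF p_gt(1)])
  then show ?thesis using t_funpow_p_T[OF f] by simp
qed

text \<open>The top coefficient of g N^k is g, and t acts on top coefficients as \<open>tA\<close>.
  So a summand of the form t^(p-1) g in the top coefficient can be removed without leaving the
  invariants.\<close>

lemma F_transfer_step:
  assumes f: "f \<in> F m (Suc k)" "t f = 0" and km: "k * p \<le> m"
    and g: "g \<in> homogeneous p (m - k * p)" "coeff f (k * p) = (tA ^^ (p - 1)) g + h"
  shows "f - (t ^^ (p - 1)) (smult g (N ^ k)) \<in> F m (Suc k)"
    "t (f - (t ^^ (p - 1)) (smult g (N ^ k))) = 0"
    "coeff (f - (t ^^ (p - 1)) (smult g (N ^ k))) (k * p) = h"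
proof -
  let ?x = "smult g (N ^ k)"
  have x: "?x \<in> F m (Suc k)" by (rule smult_N_power_F[OF g(1) km])
  show "f - (t ^^ (p - 1)) ?x \<in> F m (Suc k)" by (rule F_diff[OF f(1) t_funpow_F[OF x]])
  show "t (f - (t ^^ (p - 1)) ?x) = 0"
    using f(2) t_t_funpow_pred[of ?x m] x by (simp add: F_def rho_diff)
  have "coeff ((t ^^ (p - 1)) ?x) (k * p) = (tA ^^ (p - 1)) (coeff ?x (k * p))"
    using t_funpow_top[of "k * p" ?x "p - 1"] low_smult[OF low_N_power] by blast
  then show "coeff (f - (t ^^ (p - 1)) ?x) (k * p) = h" using g(2) by (simp add: N_power_degree)
qed

lemma top_invariant: "f \<in> F m (Suc k) \<Longrightarrow> t f = 0 \<Longrightarrow> rotA (coeff f (k * p)) = coeff f (k * p)"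
  using t_top(1)[OF F_Suc_low, of f m k] by simp

text \<open>No degree m - k p is divisible by p, so no layer has a fixed monomial. Every top
  coefficient is then of the form t^(p-1) g and can be removed, layer after layer.\<close>

lemma tate_trivial_F_not_dvd:
  assumes "\<not> p dvd m"
  shows "S.tate_trivial p (F m k)"
proof (induction k)
  case 0
  then show ?case using S.funpow_zero by (auto simp: S.tate_trivial_def F_0)
next
  case (Suc k)
  show ?case unfolding S.tate_trivial_def
  proof (intro ballI impI)
    fix f assume f: "f \<in> F m (Suc k)" "t f = 0"
    have IH: "f' \<in> (t ^^ (p - 1)) ` F m k" if "f' \<in> F m k" "t f' = 0" for f'
      using Suc that by (simp add: S.tate_trivial_def)
    show "f \<in> (t ^^ (p - 1)) ` F m (Suc k)"
    proof (cases "k * p \<le> m")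
      case True
      then have "\<not> p dvd m - k * p" using assms by (metis dvd_diffD dvd_triv_right)
      then obtain g where g: "g \<in> homogeneous p (m - k * p)" "coeff f (k * p) = (tA ^^ (p - 1)) g"
        using invariant_A[OF F_coeff[OF f(1) True] top_invariant[OF f]] by blast
      let ?x = "smult g (N ^ k)"
      have "coeff f (k * p) = (tA ^^ (p - 1)) g + 0" using g(2) by simp
      note st = F_transfer_step[OF f True g(1) this]
      from IH[OF F_decrease[OF st(1,3)] st(2)]
      obtain y where y: "y \<in> F m k" "f - (t ^^ (p - 1)) ?x = (t ^^ (p - 1)) y" by blast
      have "f = (t ^^ (p - 1)) (?x + y)" using y(2) S.funpow_add[of "p - 1" ?x y] by (simp add: algebra_simps)
      moreover have "?x + y \<in> F m (Suc k)" by (rule F_add[OF smult_N_power_F[OF g(1) True] F_mono[OF y(1)]])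
      ultimately show ?thesis by blast
    next
      case False
      \<comment> \<open>For k p > m the layer is empty.\<close>
      have "coeff f (k * p) = 0" using f(1) False S_degD(2) by (auto simp: F_def T_deg_def low_def)
      then have "f \<in> F m k" by (rule F_decrease[OF f(1)])
      then obtain y where "y \<in> F m k" "f = (t ^^ (p - 1)) y" using IH f(2) by blast
      then show ?thesis using F_mono by blast
    qed
  qed
qed

text \<open>Write f as s N^k plus an element of lower N-degree, with s the given multiple of a power
  of nu. In t f = 0 the coefficient of Y^((k-1)p) is k s c + tA b for some b. At the next power of
  nu, tA b has coefficient 0, so k a times the coefficient of nu in c vanishes.\<close>

lemma top_multiplicity_zero:
  assumes f: "f \<in> F (p * \<mu>) (Suc k)" "t f = 0" and k: "k \<le> \<mu>" "\<not> p dvd k"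
    and top: "coeff f (k * p) = single (constant_monomial (\<mu> - k)) a"
  shows "a = 0"
proof -
  obtain k' where k': "k = Suc k'" using k(2) by (cases k) auto
  define s where "s = (single (constant_monomial (\<mu> - k)) a :: 'k mpoly)"
  have d: "p * \<mu> - k * p = p * (\<mu> - k)" by (simp add: diff_mult_distrib2 mult.commute)
  have km: "k * p \<le> p * \<mu>" using k(1) by (simp add: mult.commute)
  have sh: "s \<in> homogeneous p (p * \<mu> - k * p)"
    unfolding s_def d by (rule homogeneous_single[OF constant_monomial_in])
  have rs: "rotA s = s" by (simp add: s_def rotA_single rot_constant_monomial)
  define f'' where "f'' = f - smult s (N ^ k)"
  have f'': "f'' \<in> F (p * \<mu>) k"
  proof (rule F_decrease)
    show "f'' \<in> F (p * \<mu>) (Suc k)" unfolding f''_def by (rule F_diff[OF f(1) smult_N_power_F[OF sh km]])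
    show "coeff f'' (k * p) = 0" using top by (simp add: f''_def s_def N_power_degree)
  qed
  obtain r where r: "(N + [:c:]) ^ Suc k' = N ^ Suc k' + of_nat (Suc k') * [:c:] * N ^ k' + r" "low (k' * p) r"
    using N_plus_c_power by blast
  have e: "of_nat (Suc k') * [:c:] * N ^ k' = smult (of_nat (Suc k') * c) (N ^ k')"
    by (simp add: of_nat_poly mult_ac del: of_nat_Suc)
  have "t (smult s (N ^ k)) = smult s ((N + [:c:]) ^ k - N ^ k)" by (simp add: rs rho_N smult_diff_right)
  also have "(N + [:c:]) ^ k - N ^ k = smult (of_nat k * c) (N ^ k') + r"
    using r(1) unfolding k' e by (simp del: power_Suc of_nat_Suc)
  finally have t1: "t (smult s (N ^ k)) = smult s (smult (of_nat k * c) (N ^ k') + r)" .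
  have "f = smult s (N ^ k) + f''" by (simp add: f''_def)
  then have "0 = t (smult s (N ^ k)) + t f''" using f(2) S.t_add[of "smult s (N ^ k)" f''] by simp
  then have "0 = coeff (t (smult s (N ^ k))) (k' * p) + coeff (t f'') (k' * p)" by (metis coeff_0 coeff_add)
  moreover have "coeff (t f'') (k' * p) = tA (coeff f'' (k' * p))"
    using t_top(1)[OF F_Suc_low, of f'' "p * \<mu>" k'] f'' k' by simp
  moreover have "coeff (t (smult s (N ^ k))) (k' * p) = s * (of_nat k * c)"
    unfolding t1 using r(2) by (simp add: N_power_degree low_def)
  ultimately have "0 = lookup (s * (of_nat k * c) + tA (coeff f'' (k' * p))) (constant_monomial (\<mu> - k + 1))"
    by simp
  also have "\<dots> = lookup (s * (of_nat k * c)) (constant_monomial (\<mu> - k) + constant_monomial 1)"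
    using lookup_tA_constant[of "coeff f'' (k' * p)" "\<mu> - k + 1"] by (simp add: lookup_add constant_monomial_add)
  also have "\<dots> = a * (of_nat k * lookup c (constant_monomial 1))"
    unfolding s_def lookup_single_mult mconst_of_nat[symmetric] lookup_mconst_mult ..
  finally have "a * (of_nat k * lookup c (constant_monomial 1)) = 0" by simp
  moreover have "(of_nat k :: 'k) \<noteq> 0" using k(2) char by (simp add: of_nat_eq_0_iff_char_dvd)
  ultimately show "a = 0" using lookup_c by simp
qed

text \<open>Normalizes the top coefficient of an invariant modulo im t^(p-1): once its nu-part is
  subtracted, the rest is covered by \<open>invariant_A\<close>.\<close>

lemma F_step_dvd:
  assumes f: "f \<in> F (p * \<mu>) (Suc k)" "t f = 0" and k: "k \<le> \<mu>"
  shows "\<exists>x\<in>F (p * \<mu>) (Suc k). f - (t ^^ (p - 1)) x \<in> F (p * \<mu>) (Suc k) \<and> t (f - (t ^^ (p - 1)) x) = 0 \<and>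
    coeff (f - (t ^^ (p - 1)) x) (k * p) = single (constant_monomial (\<mu> - k)) (lookup (coeff f (k * p)) (constant_monomial (\<mu> - k)))"
proof -
  have d: "p * \<mu> - k * p = p * (\<mu> - k)" by (simp add: diff_mult_distrib2 mult.commute)
  have km: "k * p \<le> p * \<mu>" using k by (simp add: mult.commute)
  let ?a = "coeff f (k * p)" 
  let ?s = "single (constant_monomial (\<mu> - k)) (lookup ?a (constant_monomial (\<mu> - k)))"
  have sh: "?s \<in> homogeneous p (p * \<mu> - k * p)"
    unfolding d by (rule homogeneous_single[OF constant_monomial_in])
  have "\<exists>g\<in>homogeneous p (p * \<mu> - k * p). ?a - ?s = (tA ^^ (p - 1)) g"
  proof (rule invariant_A)
    show "?a - ?s \<in> homogeneous p (p * \<mu> - k * p)" by (rule homogeneous_diff[OF F_coeff[OF f(1) km] sh])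
    have "tA (?a - ?s) = tA ?a - tA ?s" by (rule A.t_diff)
    then show "rotA (?a - ?s) = ?a - ?s"
      using top_invariant[OF f] by (simp add: rotA_single rot_constant_monomial)
    show "lookup (?a - ?s) (constant_monomial ((p * \<mu> - k * p) div p)) = 0"
      using p_gt by (simp add: d lookup_minus)
  qed
  then obtain g where g: "g \<in> homogeneous p (p * \<mu> - k * p)" "?a - ?s = (tA ^^ (p - 1)) g" by blast
  then have "?a = (tA ^^ (p - 1)) g + ?s" by (simp add: algebra_simps)
  from F_transfer_step[OF f km g(1) this] smult_N_power_F[OF g(1) km] show ?thesis by blast
qed

subsection \<open>Dimensions\<close>

lemma F_expansion:
  "f \<in> F m k \<Longrightarrow> (\<And>i. i < k \<Longrightarrow> i * p \<le> m) \<Longrightarrow>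
    \<exists>a. (\<forall>i<k. a i \<in> homogeneous p (m - i * p)) \<and> f = (\<Sum>i<k. smult (a i) (N ^ i))"
proof (induction k arbitrary: f)
  case 0
  then show ?case by (simp add: F_0)
next
  case (Suc k)
  let ?a = "coeff f (k * p)"
  have km: "k * p \<le> m" using Suc.prems(2) by simp
  have ah: "?a \<in> homogeneous p (m - k * p)" by (rule F_coeff[OF Suc.prems(1) km])
  have "f - smult ?a (N ^ k) \<in> F m k"
    by (rule F_decrease[OF F_diff[OF Suc.prems(1) smult_N_power_F[OF ah km]]]) (simp add: N_power_degree)
  from Suc.IH[OF this] obtain b where b: "\<forall>i<k. b i \<in> homogeneous p (m - i * p)"
    "f - smult ?a (N ^ k) = (\<Sum>i<k. smult (b i) (N ^ i))" using Suc.prems(2) by auto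
  have "f = (\<Sum>i<Suc k. smult ((b(k := ?a)) i) (N ^ i))"
  proof -
    have "(\<Sum>i<k. smult ((b(k := ?a)) i) (N ^ i)) = (\<Sum>i<k. smult (b i) (N ^ i))" by (intro sum.cong) auto
    then show ?thesis using b(2) by (simp add: algebra_simps)
  qed
  moreover have "\<forall>i<Suc k. (b(k := ?a)) i \<in> homogeneous p (m - i * p)" using b(1) ah by (auto simp: less_Suc_eq)
  ultimately show ?case by blast
qed

lemma N_expansion_unique:
  "(\<Sum>i<k. smult (a i) (N ^ i)) = 0 \<Longrightarrow> i < k \<Longrightarrow> a i = 0"
proof (induction k)
  case (Suc k)
  have "coeff (\<Sum>i<k. smult (a i) (N ^ i)) (k * p) = 0"
    unfolding coeff_sum
  proof (intro sum.neutral ballI)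
    fix i assume "i \<in> {..<k}"
    then have "Suc (i * p) \<le> k * p" using p_gt by (metis Suc_le_eq lessThan_iff mult_less_mono1)
    then show "coeff (smult (a i) (N ^ i)) (k * p) = 0" using low_N_power[of i] by (simp add: low_def)
  qed
  then have "a k = 0" using Suc.prems(1) N_power_degree(2)[of k]
    by (metis (no_types, lifting) add_0 coeff_0 coeff_add coeff_smult mult.right_neutral sum.lessThan_Suc)
  then show ?case using Suc by (auto simp: less_Suc_eq)
qed simp

lemma F_dim:
  assumes km: "\<And>i. i < k \<Longrightarrow> i * p \<le> m"
  shows "S.dim (F m k) = (\<Sum>i<k. card (monomials p (m - i * p)))" "\<exists>B. finite B \<and> F m k \<subseteq> S.span B"
proof -
  define I where "I = (SIGMA i:{..<k}. monomials p (m - i * p))"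
  define b where "b x = smult (single (snd x) 1) (N ^ fst x)" for x :: "nat \<times> (nat \<Rightarrow>\<^sub>0 nat)"
  have finI: "finite I" by (simp add: I_def finite_monomials)
  have sumI: "(\<Sum>x\<in>I. smult (mconst (a x)) (b x)) = (\<Sum>i<k. smult (\<Sum>e\<in>monomials p (m - i * p). single e (a (i, e))) (N ^ i))" for a
  proof -
    have "(\<Sum>x\<in>I. smult (mconst (a x)) (b x)) = (\<Sum>i<k. \<Sum>e\<in>monomials p (m - i * p). smult (mconst (a (i, e))) (b (i, e)))"
      unfolding I_def by (subst sum.Sigma) (auto simp: finite_monomials split_def)
    also have "\<dots> = (\<Sum>i<k. smult (\<Sum>e\<in>monomials p (m - i * p). single e (a (i, e))) (N ^ i))"
      by (intro sum.cong refl) (simp add: b_def smult_sum mconst_def mult_single)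
    finally show ?thesis .
  qed
  have ind: "a x = 0" if "(\<Sum>x\<in>I. smult (mconst (a x)) (b x)) = 0" and x: "x \<in> I" for a x
  proof -
    from that(1)[unfolded sumI] have "(\<Sum>e\<in>monomials p (m - fst x * p). single e (a (fst x, e))) = 0"
      by (rule N_expansion_unique) (use x in \<open>auto simp: I_def\<close>)
    then have "lookup (\<Sum>e\<in>monomials p (m - fst x * p). single e (a (fst x, e))) (snd x) = 0" by simp
    moreover have "lookup (\<Sum>e\<in>monomials p (m - fst x * p). single e (a (fst x, e))) (snd x)
      = (\<Sum>e\<in>monomials p (m - fst x * p). if e = snd x then a (fst x, e) else 0)"
      unfolding lookup_sum by (intro sum.cong) (auto simp: lookup_single when_def)
    moreover have "\<dots> = a x" using x finite_monomials by (auto simp: I_def)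
    ultimately show "a x = 0" by simp
  qed
  have sub: "b ` I \<subseteq> F m k"
  proof -
    have sub: "F m i \<subseteq> F m k" if "i \<le> k" for i
      using that by (induction k) (auto simp: le_Suc_eq dest: F_mono)
    show "b ` I \<subseteq> F m k"
    proof
      fix y assume "y \<in> b ` I"
      then obtain i e where ie: "y = smult (single e 1) (N ^ i)" "i < k" "e \<in> monomials p (m - i * p)"
        by (auto simp: I_def b_def)
      then have "y \<in> F m (Suc i)" using smult_N_power_F[OF homogeneous_single km] by blast
      then show "y \<in> F m k" using sub ie(2) by (meson Suc_leI subsetD)
    qed
  qed
  have span: "\<exists>a. w = (\<Sum>x\<in>I. smult (mconst (a x)) (b x))" if "w \<in> F m k" for w
  proof -
    from F_expansion[OF that km] obtain a where a: "\<forall>i<k. a i \<in> homogeneous p (m - i * p)"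
      "w = (\<Sum>i<k. smult (a i) (N ^ i))" by blast
    have "(\<Sum>e\<in>monomials p (m - i * p). single e (lookup (a i) e)) = a i" if "i < k" for i
    proof -
      have "(\<Sum>e\<in>monomials p (m - i * p). single e (lookup (a i) e)) = (\<Sum>e\<in>keys (a i). single e (lookup (a i) e))"
        using a(1) that by (intro sum.mono_neutral_right finite_monomials) (auto simp: homogeneous_def in_keys_iff)
      then show ?thesis by (simp flip: poly_mapping_as_sum)
    qed
    then have "w = (\<Sum>x\<in>I. smult (mconst (lookup (a (fst x)) (snd x))) (b x))" by (simp add: sumI a(2))
    then show "\<exists>a. w = (\<Sum>x\<in>I. smult (mconst (a x)) (b x))" by (rule exI[of _ "\<lambda>x. lookup (a (fst x)) (snd x)"])
  qed
  have "S.dim (F m k) = card I"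
    by (rule S.dim_family(1)[where b = b]; (rule finI sub | (erule ind, assumption) | erule span))
  moreover have "F m k \<subseteq> S.span (b ` I)"
    by (rule S.dim_family(3)[where b = b]; (rule finI sub | (erule ind, assumption) | erule span))
  moreover note finI
  ultimately  show "S.dim (F m k) = (\<Sum>i<k. card (monomials p (m - i * p)))" "\<exists>B. finite B \<and> F m k \<subseteq> S.span B"
    by (simp add: I_def finite_monomials, blast)
qed

lemma card_monomials_mod: "card (monomials p d) mod p = (if p dvd d then 1 else 0)"
  using choose_pred_prime_mod[OF p, of d] card_monomials[of p d] p_gt by simp

text \<open>The degrees of the layers agree modulo p, so all layers have the same dimension modulo
  p, namely 1 or 0.\<close>

lemma sum_card_monomials_mod:
  assumes "\<And>i. i < k \<Longrightarrow> i * p \<le> m"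
  shows "(\<Sum>i<k. card (monomials p (m - i * p))) mod p = (if p dvd m then k mod p else 0)"
proof -
  have "(\<Sum>i<k. card (monomials p (m - i * p))) mod p = (\<Sum>i<k. card (monomials p (m - i * p)) mod p) mod p"
    by (simp add: mod_sum_eq)
  also have "(\<Sum>i<k. card (monomials p (m - i * p)) mod p) = (\<Sum>i<k. if p dvd m then 1 else 0)"
  proof (rule sum.cong[OF refl])
    fix i assume "i \<in> {..<k}"
    then have "p dvd m - i * p \<longleftrightarrow> p dvd m" using assms[of i] by (metis dvd_diff_nat dvd_diffD dvd_triv_right lessThan_iff)
    then show "card (monomials p (m - i * p)) mod p = (if p dvd m then 1 else 0)" by (simp add: card_monomials_mod)
  qed
  finally show ?thesis by simp
qed

text \<open>The two claims need each other. At a multiple k of p the quotient ker t / im t^(p-1) is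
  zero; the next layer may add one class, and by \<open>top_multiplicity_zero\<close> the layers up
  to the next multiple of p add none. There the dimension is divisible by p, so the class has
  disappeared and the argument starts again. The bound on \<open>k\<close> keeps all layers
  nonempty.\<close>

lemma tate_F_dvd:
  "k \<le> Suc \<mu> \<Longrightarrow> S.tate_cyclic p (F (p * \<mu>) k) \<and> (p dvd k \<longrightarrow> S.tate_trivial p (F (p * \<mu>) k))"
proof (induction k)
  case 0
  have "S.tate_trivial p (F (p * \<mu>) 0)" using S.funpow_zero by (auto simp: S.tate_trivial_def F_0)
  then show ?case using S.tate_trivial_imp_cyclic[OF S.invariantD(1)[OF F_invariant]] by blast
next
  case (Suc k)
  let ?m = "p * \<mu>"
  have k: "k \<le> \<mu>" using Suc.prems by simp
  have IH: "S.tate_cyclic p (F ?m k)" "p dvd k \<Longrightarrow> S.tate_trivial p (F ?m k)" using Suc by auto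
  let ?lam = "\<lambda>f. lookup (coeff f (k * p)) (constant_monomial (\<mu> - k))"
  have red: "\<exists>x\<in>F ?m (Suc k). f - (t ^^ (p - 1)) x \<in> F ?m k \<and> t (f - (t ^^ (p - 1)) x) = 0"
    if f: "f \<in> F ?m (Suc k)" "t f = 0" and l: "?lam f = 0" for f
  proof -
    obtain x where x: "x \<in> F ?m (Suc k)" "f - (t ^^ (p - 1)) x \<in> F ?m (Suc k)" "t (f - (t ^^ (p - 1)) x) = 0"
      "coeff (f - (t ^^ (p - 1)) x) (k * p) = single (constant_monomial (\<mu> - k)) (?lam f)"
      using F_step_dvd[OF f k] by blast
    have "f - (t ^^ (p - 1)) x \<in> F ?m k" by (rule F_decrease[OF x(2)]) (simp only: x(4) l single_zero)
    then show ?thesis using x(1,3) by blast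
  qed
  have comb: "f - a \<in> (t ^^ (p - 1)) ` F ?m (Suc k)"
    if x: "x \<in> F ?m (Suc k)" and im: "f - (t ^^ (p - 1)) x - a \<in> (t ^^ (p - 1)) ` F ?m k" for f x a
  proof -
    obtain y where y: "y \<in> F ?m k" "f - (t ^^ (p - 1)) x - a = (t ^^ (p - 1)) y" using im by blast
    then have "f - a = (t ^^ (p - 1)) (x + y)" using S.funpow_add[of "p - 1" x y] by (simp add: algebra_simps)
    moreover have "x + y \<in> F ?m (Suc k)" by (rule F_add[OF x F_mono[OF y(1)]])
    ultimately show ?thesis by blast
  qed
  have cyc: "S.tate_cyclic p (F ?m (Suc k))"
  proof (cases "p dvd k")
    case True
    \<comment> \<open>Below layer \<open>k\<close> the quotient is zero, so the coefficient of
      nu^(mu - k) alone decides whether an invariant lies in im t^(p-1).\<close>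
    have triv: "f \<in> (t ^^ (p - 1)) ` F ?m (Suc k)" if f: "f \<in> F ?m (Suc k)" "t f = 0" "?lam f = 0" for f
    proof -
      obtain x where x: "x \<in> F ?m (Suc k)" "f - (t ^^ (p - 1)) x \<in> F ?m k" "t (f - (t ^^ (p - 1)) x) = 0"
        using red[OF f] by blast
      then have "f - (t ^^ (p - 1)) x - 0 \<in> (t ^^ (p - 1)) ` F ?m k" using IH(2)[OF True] by (simp add: S.tate_trivial_def)
      from comb[OF x(1) this] show ?thesis by simp
    qed
    show ?thesis
    proof (cases "\<exists>f\<in>F ?m (Suc k). t f = 0 \<and> ?lam f \<noteq> 0")
      case False
      then have "S.tate_trivial p (F ?m (Suc k))" using triv unfolding S.tate_trivial_def by blast
      then show ?thesis by (rule S.tate_trivial_imp_cyclic[OF S.invariantD(1)[OF F_invariant]])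
    next
      case True
      then obtain x0 where x0: "x0 \<in> F ?m (Suc k)" "t x0 = 0" "?lam x0 \<noteq> 0" by blast
      show ?thesis unfolding S.tate_cyclic_def
      proof (intro bexI[OF _ x0(1)] conjI x0(2) ballI impI)
        fix f assume f: "f \<in> F ?m (Suc k)" "t f = 0"
        let ?a = "?lam f / ?lam x0"
        let ?f = "f - smult (mconst ?a) x0"
        have "?f \<in> F ?m (Suc k)" by (rule F_diff[OF f(1) F_scale[OF x0(1)]])
        moreover have "t ?f = 0" using f(2) x0(2) by (simp add: rho_diff)
        moreover have "?lam ?f = 0" using x0(3) by (simp add: lookup_minus lookup_mconst_mult)
        ultimately have "?f \<in> (t ^^ (p - 1)) ` F ?m (Suc k)" by (rule triv)
        then show "\<exists>a. f - smult (mconst a) x0 \<in> (t ^^ (p - 1)) ` F ?m (Suc k)" by blast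
      qed
    qed
  next
    case False
    obtain x0 where x0: "x0 \<in> F ?m k" "t x0 = 0"
      "\<And>f. f \<in> F ?m k \<Longrightarrow> t f = 0 \<Longrightarrow> \<exists>a. f - smult (mconst a) x0 \<in> (t ^^ (p - 1)) ` F ?m k"
      using IH(1) unfolding S.tate_cyclic_def by blast
    show ?thesis unfolding S.tate_cyclic_def
    proof (intro bexI[OF _ F_mono[OF x0(1)]] conjI x0(2) ballI impI)
      fix f assume f: "f \<in> F ?m (Suc k)" "t f = 0"
      obtain x where x: "x \<in> F ?m (Suc k)" "f - (t ^^ (p - 1)) x \<in> F ?m (Suc k)" "t (f - (t ^^ (p - 1)) x) = 0"
        "coeff (f - (t ^^ (p - 1)) x) (k * p) = single (constant_monomial (\<mu> - k)) (?lam f)"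
        using F_step_dvd[OF f k] by blast
      \<comment> \<open>For k not divisible by p the layer adds no class, and the old generator
        \<open>x0\<close> still suffices.\<close>
      have "?lam f = 0" by (rule top_multiplicity_zero[OF x(2,3) k False x(4)])
      then have "f - (t ^^ (p - 1)) x \<in> F ?m k" by (intro F_decrease[OF x(2)]) (simp only: x(4) single_zero)
      then obtain a where "f - (t ^^ (p - 1)) x - smult (mconst a) x0 \<in> (t ^^ (p - 1)) ` F ?m k" using x0(3) x(3) by blast
      from comb[OF x(1) this] show "\<exists>a. f - smult (mconst a) x0 \<in> (t ^^ (p - 1)) ` F ?m (Suc k)" by blast
    qed
  qed
  moreover have "S.tate_trivial p (F ?m (Suc k))" if "p dvd Suc k"
  proof -
    have le: "i * p \<le> ?m" if "i < Suc k" for i using that k by (simp add: mult.commute)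
    obtain B where B: "finite B" "F ?m (Suc k) \<subseteq> S.span B" using F_dim(2)[OF le] by blast
    \<comment> \<open>Now the number of layers is a multiple of p, and with it the
      dimension.\<close>
    have "S.dim (F ?m (Suc k)) mod p = 0"
      using sum_card_monomials_mod[of "Suc k" ?m, OF le] that
      by (simp add: F_dim(1)[OF le] dvd_eq_mod_eq_0 del: sum.lessThan_Suc)
    then have "p dvd S.dim (F ?m (Suc k))" by blast
    then show ?thesis
      by (intro S.tate_cyclic_dim_dvd_imp_trivial[OF F_invariant B _ cyc _ p_gt(1)])
        (auto simp: F_def t_funpow_p_T)
  qed
  ultimately show ?case by blast
qed

lemma T_deg_eq_F: "T_deg m = F m (Suc (m div p))"
proof -
  have "m < Suc (m div p) * p" using p_gt dividend_less_div_times[of p m] by simp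
  then have "low (Suc (m div p) * p) f" if "f \<in> S_deg m" for f
    using S_degD(2)[OF that] low_mono by (metis Suc_leI)
  then show ?thesis by (auto simp: F_def T_deg_def)
qed

text \<open>The dimension of T_m, written as the sum of the dimensions of the layers.\<close>

definition theta :: "nat \<Rightarrow> nat" where
  "theta m = (\<Sum>i\<le>m div p. card (monomials p (m - i * p)))"

lemma div_mult_le: "i < Suc (m div p) \<Longrightarrow> i * p \<le> m"
  by (metis div_times_less_eq_dividend le_trans less_Suc_eq_le mult_le_mono1)

lemma theta_mod: "theta m mod p = (if p dvd m then Suc (m div p) mod p else 0)"
  using sum_card_monomials_mod[OF div_mult_le, of "Suc (m div p)" m] by (simp add: theta_def lessThan_Suc_atMost)

lemma T_deg_blocks:
  assumes j: "j < p"
  shows "S.dim {x \<in> (t ^^ j) ` T_deg m. t x = 0} = theta m div p + (if j < theta m mod p then 1 else 0)"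
proof -
  obtain B where B: "finite B" "T_deg m \<subseteq> S.span B" unfolding T_deg_eq_F using F_dim(2)[of "Suc (m div p)" m, OF div_mult_le] by blast
  have d: "S.dim (T_deg m) = theta m"
    by (simp add: T_deg_eq_F F_dim(1)[OF div_mult_le] theta_def lessThan_Suc_atMost del: sum.lessThan_Suc)
  have "S.tate_cyclic p (T_deg m)"
  proof (cases "p dvd m")
    case True
    then obtain \<mu> where "m = p * \<mu>" by blast
    then show ?thesis unfolding T_deg_eq_F using tate_F_dvd[of "Suc \<mu>" \<mu>] p_gt by simp
  next
    case False
    show ?thesis unfolding T_deg_eq_F
      by (intro S.tate_trivial_imp_cyclic S.invariantD(1)[OF F_invariant] tate_trivial_F_not_dvd[OF False])
  qed
  from S.tate_cyclic_dim_image[OF T_deg_invariant B t_funpow_p_T this j] show ?thesis by (simp add: d)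
qed

end

section \<open>Block sizes of the graded pieces\<close>

context cyclic_prime
begin

definition falling :: "nat \<Rightarrow> 'k mpoly poly" where
  "falling r = (\<Prod>i<r. [:- (of_nat i * z), 1:])"

lemma falling_simps: "falling 0 = 1" "falling (Suc r) = falling r * [:- (of_nat r * z), 1:]"
  by (simp_all add: falling_def)

lemma shift_falling: "shift z (falling (Suc r)) = [:z, 1:] * falling r"
proof (induction r)
  case 0 show ?case by (simp add: falling_simps shift_def pcompose_pCons)
next
  case (Suc r)
  have "shift z (falling (Suc (Suc r))) = shift z (falling (Suc r)) * shift z [:- (of_nat (Suc r) * z), 1:]"
    by (simp only: falling_simps(2)[of "Suc r"] shift_simps)
  also have "shift z [:- (of_nat (Suc r) * z), 1:] = [:- (of_nat r * z), 1:]"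
    by (simp add: shift_def pcompose_pCons algebra_simps)
  finally show ?case unfolding Suc by (simp only: falling_simps(2) mult.assoc)
qed

text \<open>u is the difference operator of step z, so on falling factorials of the same step it
  acts like z times the derivative on powers.\<close>

lemma u_falling: "u (falling (Suc r)) = smult (of_nat (Suc r) * z) (falling r)"
proof -
  have "u (falling (Suc r)) = [:z, 1:] * falling r - falling r * [:- (of_nat r * z), 1:]"
    unfolding u_def shift_falling unfolding falling_simps(2) ..
  also have "\<dots> = ([:z, 1:] - [:- (of_nat r * z), 1:]) * falling r" by (simp only: left_diff_distrib mult.commute[of "falling r"])
  also have "[:z, 1:] - [:- (of_nat r * z), 1:] = [:of_nat (Suc r) * z:]" by (simp add: algebra_simps)
  finally show ?thesis by simp
qed

lemma u_funpow_falling: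
  "(u ^^ a) (falling (r + a)) = smult (of_nat (\<Prod>i<a. r + i + 1) * z ^ a) (falling r)"
proof (induction a)
  case (Suc a)
  have "(u ^^ Suc a) (falling (r + Suc a)) = (u ^^ a) (u (falling (Suc (r + a))))" by (simp add: funpow_swap1)
  also have "\<dots> = smult (of_nat (Suc (r + a)) * z) ((u ^^ a) (falling (r + a)))" unfolding u_falling u_funpow_smult ..
  also have "\<dots> = smult (of_nat (\<Prod>i<Suc a. r + i + 1) * z ^ Suc a) (falling r)"
    unfolding Suc by (simp add: algebra_simps)
  finally show ?case .
qed simp

text \<open>All factors lie between 1 and r + a, hence below p.\<close>

lemma falling_coeff_nonzero: "r + a < p \<Longrightarrow> \<not> p dvd (\<Prod>i<a. r + i + 1)"
  using p by (auto simp: prime_dvd_prod_iff dest!: dvd_imp_le)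

lemma falling_degree: "degree (falling r) = r" "lead_coeff (falling r) = 1"
proof -
  have "degree (falling r) = r \<and> lead_coeff (falling r) = 1"
  proof (induction r)
    case (Suc r)
    then have nz: "falling r \<noteq> 0" by auto
    have "coeff (falling r) r = 1" using Suc by (elim conjE) (erule subst)
    then show ?case unfolding falling_simps(2) lead_coeff_mult using Suc nz
      by (simp add: degree_mult_eq del: mult_pCons_right)
  qed (simp add: falling_simps)
  then show "degree (falling r) = r" "lead_coeff (falling r) = 1" by auto
qed

lemma falling_nonzero: "falling r \<noteq> 0"
  using falling_degree(2)[of r] by auto

lemma N_nonzero: "N \<noteq> 0"
  using N_degree(1) p_gt by auto

lemma falling_S_deg: "falling r \<in> S_deg r"
proof (induction r)
  case 0 then show ?case using S_deg_const[OF homogeneous_1] by (simp add: falling_simps one_pCons)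
next
  case (Suc r)
  have "[:- (of_nat r * z), 1:] \<in> S_deg 1"
    using homogeneous_scale[OF z_homogeneous, of "of_nat r"] by (intro S_deg_linear homogeneous_uminus) (simp add: mconst_of_nat)
  from S_deg_mult[OF Suc this] show ?case by (simp add: falling_simps)
qed

lemma u_funpow_mult: "u h = 0 \<Longrightarrow> (u ^^ n) (h * f) = h * (u ^^ n) f"
  by (induction n) (simp_all add: u_mult)

lemma T_degD: "h \<in> T_deg n \<Longrightarrow> u h = 0" "h \<in> T_deg n \<Longrightarrow> h \<in> S_deg n"
  by (auto simp: T_deg_def)

lemma T_deg_scale: "h \<in> T_deg n \<Longrightarrow> smult (mconst a) h \<in> T_deg n"
  using S.subspace_scale[OF S.invariantD(1)[OF T_deg_invariant]] .

lemma u_image_ex: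
  assumes h: "h \<in> T_deg (n - a)" and a: "a < p" "a \<le> n"
  shows "\<exists>f\<in>S_deg n. (u ^^ a) f = smult (z ^ a) h"
proof -
  define k where "k = (of_nat (\<Prod>i<a. i + 1) :: 'k)"
  have k: "k \<noteq> 0" unfolding k_def of_nat_eq_0_iff_char_dvd char using falling_coeff_nonzero[of 0 a] a by simp
  \<comment> \<open>u^a sends \<open>falling a\<close> to a! z^a, and a! is invertible because a <
    p.\<close>
  let ?f = "smult (mconst (1 / k)) h * falling a"
  have "?f \<in> S_deg n"
    using S_deg_mult[OF S_deg_scale[OF T_degD(2)[OF h]] falling_S_deg[of a]] a by simp
  moreover have "(u ^^ a) ?f = smult (mconst (1 / k)) h * (u ^^ a) (falling (0 + a))"
    by (simp add: u_funpow_mult[OF T_degD(1)[OF T_deg_scale[OF h]]] del: mult_smult_left)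
  then have "(u ^^ a) ?f = smult (mconst (1 / k)) h * smult (of_nat (\<Prod>i<a. 0 + i + 1) * z ^ a) 1"
    unfolding u_funpow_falling falling_simps(1) .
  then have "(u ^^ a) ?f = smult (mconst (1 / k) * mconst k * z ^ a) h"
    unfolding k_def mconst_of_nat by (simp add: mult_ac)
  then have "(u ^^ a) ?f = smult (z ^ a) h" using k by (simp flip: mconst_simps(4))
  ultimately show ?thesis by blast
qed

text \<open>Induction on a bound for the Y-degree. The leading term is cancelled by a multiple of
  \<open>N ^ q * falling r\<close> with r < p, on which u acts through the second factor only. If r
  < a, then u^a kills this product. If r = a, then u^a turns it into z^a times an element of T. If r
  > a, then u^(a+1) f could not vanish.\<close>

lemma u_image:
  assumes "f \<in> S_deg n" "(u ^^ Suc a) f = 0" and a: "a < p" "a \<le> n"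
  shows "\<exists>h\<in>T_deg (n - a). (u ^^ a) f = smult (z ^ a) h"
proof -
  have "low D f \<Longrightarrow> f \<in> S_deg n \<Longrightarrow> (u ^^ Suc a) f = 0 \<Longrightarrow> \<exists>h\<in>T_deg (n - a). (u ^^ a) f = smult (z ^ a) h" for D
  proof (induction D arbitrary: f)
    case 0
    then have "f = 0" by (simp add: low_iff_0)
    moreover have "0 \<in> T_deg (n - a)" by (simp add: T_deg_def U.t_zero)
    ultimately show ?case using U.funpow_zero by (intro bexI[of _ 0]) simp_all
  next
    case (Suc D)
    define \<alpha> where "\<alpha> = coeff f D"
    define q where "q = D div p"
    define r where "r = D mod p"
    have D: "D = q * p + r" and r: "r < p" using p_gt by (simp_all add: q_def r_def)
    define E where "E = N ^ q * falling r"
    have uN: "u (smult b (N ^ q)) = 0" for b by (simp add: u_def shift_N)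
    have Ed: "degree E = D" "coeff E D = 1"
    proof -
      have nz: "N ^ q \<noteq> 0" "falling r \<noteq> 0" using N_nonzero falling_nonzero by auto
      show "degree E = D" unfolding E_def D using nz by (simp add: degree_mult_eq N_power_degree falling_degree)
      have "lead_coeff E = 1" unfolding E_def lead_coeff_mult lead_coeff_power N_degree(2) falling_degree(2) by simp
      then show "coeff E D = 1" using \<open>degree E = D\<close> by simp
    qed
    have lE: "low (Suc D) E" by (simp add: low_degree Ed)
    define f' where "f' = f - smult \<alpha> E"
    have f'low: "low D f'" unfolding f'_def
      by (rule low_Suc[OF low_diff[OF Suc.prems(1) low_smult[OF lE]]]) (simp add: \<alpha>_def Ed)
    show ?case
    proof (cases "\<alpha> = 0")
      case True
      then have "low D f" using f'low by (simp add: f'_def)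
      then show ?thesis using Suc by blast
    next
      case False
      have Dn: "D \<le> n" using False S_degD(2)[OF Suc.prems(2)] by (auto simp: \<alpha>_def low_def not_le intro: ccontr)
      have \<alpha>h: "\<alpha> \<in> homogeneous p (n - D)" unfolding \<alpha>_def by (rule S_degD(1)[OF Suc.prems(2) Dn])
      have "E \<in> S_deg D" unfolding E_def D by (rule S_deg_mult[OF S_deg_power[OF N_S_deg] falling_S_deg])
      then have "smult \<alpha> E \<in> S_deg n" using S_deg_smult[OF \<alpha>h] Dn by fastforce
      then have f'S: "f' \<in> S_deg n" unfolding f'_def by (rule S_deg_diff[OF Suc.prems(2)])
      have uE: "(u ^^ k) (smult \<alpha> E) = smult \<alpha> (N ^ q) * (u ^^ k) (falling r)" for k
        using u_funpow_mult[OF uN[of \<alpha>], of k "falling r"] by (simp add: E_def)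
      have f: "f = f' + smult \<alpha> E" by (simp add: f'_def)
      consider "r < a" | "r = a" | "a < r" by linarith
      then show ?thesis
      proof cases
        case 1
        have "(u ^^ Suc r) (falling r) = 0"
          using u_funpow_falling[of r 0] by (simp add: falling_simps U.t_scale u_smult) (simp add: u_def)
        then have z0: "(u ^^ k) (falling r) = 0" if "k \<ge> Suc r" for k using U.funpow_eq_0_mono that by blast
        have "(u ^^ k) f = (u ^^ k) f'" if "k \<ge> Suc r" for k
          unfolding f U.funpow_add uE z0[OF that] by simp
        then have "(u ^^ a) f = (u ^^ a) f'" "(u ^^ Suc a) f' = 0" using 1 Suc.prems(3) by auto
        then show ?thesis using Suc.IH[OF f'low f'S] by simp
      next
        case 2
        have ua: "(u ^^ a) (falling r) = smult (of_nat (\<Prod>i<a. 0 + i + 1) * z ^ a) 1"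
          using u_funpow_falling[of a 0] by (simp only: 2 falling_simps(1) add_0_left)
        then have "u ((u ^^ a) (falling r)) = 0" by (simp add: u_def)
        then have "(u ^^ Suc a) f = (u ^^ Suc a) f'" unfolding f U.funpow_add uE by simp
        then obtain h' where h': "h' \<in> T_deg (n - a)" "(u ^^ a) f' = smult (z ^ a) h'"
          using Suc.IH[OF f'low f'S] Suc.prems(3) by auto
        let ?c = "of_nat (\<Prod>i<a. 0 + i + 1) :: 'k mpoly"
        let ?h = "smult (?c * \<alpha>) (N ^ q)"
        have "?c * \<alpha> \<in> homogeneous p (n - D)" using homogeneous_scale[OF \<alpha>h] mconst_of_nat by metis
        from smult_N_power_T[OF this, of q] have "?h \<in> T_deg (n - D + q * p)" .
        moreover have "n - D + q * p = n - a" using D Dn 2 by simp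
        ultimately have "?h \<in> T_deg (n - a)" by (simp only:)
        then have "h' + ?h \<in> T_deg (n - a)" by (rule T_deg_add[OF h'(1)])
        moreover have "(u ^^ a) f = smult (z ^ a) (h' + ?h)"
          unfolding f U.funpow_add uE ua h'(2) by (simp add: smult_add_right mult_ac)
        ultimately show ?thesis by blast
      next
        case 3
        obtain s where s: "r = s + Suc a" using 3 by (metis add.commute add_Suc_right less_imp_Suc_add)
        let ?b = "of_nat (\<Prod>i<Suc a. s + i + 1) * z ^ Suc a"
        have "0 = (u ^^ Suc a) f' + smult \<alpha> (N ^ q) * smult ?b (falling s)"
          using Suc.prems(3) unfolding f U.funpow_add uE unfolding s u_funpow_falling by simp
        then have "0 = coeff ((u ^^ Suc a) f' + smult \<alpha> (N ^ q) * smult ?b (falling s)) (q * p + s)" by (metis coeff_0)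
        \<comment> \<open>u^(a+1) lowers the degree by a + 1, and \<open>f'\<close> has degree below
          D, so \<open>f'\<close> cannot cancel the leading term in degree q p + s = D - (a +
          1).\<close>
        moreover have "coeff ((u ^^ Suc a) f') (q * p + s) = 0"
          using low_u_funpow[OF f'low, of "Suc a"] D s by (simp add: low_def)
        moreover have "coeff (N ^ q * falling s) (q * p + s) = 1"
        proof -
          have "N ^ q \<noteq> 0" "falling s \<noteq> 0" using N_nonzero falling_nonzero by auto
          then have "degree (N ^ q * falling s) = q * p + s" by (simp add: degree_mult_eq N_power_degree falling_degree)
          moreover have "lead_coeff (N ^ q * falling s) = 1"
            unfolding lead_coeff_mult lead_coeff_power N_degree(2) falling_degree(2) by simp
          ultimately show ?thesis by simp
        qed
        ultimately have "\<alpha> * ?b = 0" by (simp add: mult.commute)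
        moreover have "(of_nat (\<Prod>i<Suc a. s + i + 1) :: 'k mpoly) \<noteq> 0"
          unfolding char_mpoly using falling_coeff_nonzero[of s "Suc a"] r s by blast
        ultimately have False using False z_nonzero by (simp del: of_nat_prod prod.lessThan_Suc)
        then show ?thesis ..
      qed
    qed
  qed
  moreover have "low (Suc n) f" by (rule S_degD(2)[OF assms(1)])
  ultimately show ?thesis using assms by blast
qed

text \<open>Multiplication by z^a is injective and commutes with t, as z is invariant. By
  \<open>u_image\<close> and \<open>u_image_ex\<close> it maps the corresponding space for T in
  degree n - a onto the space considered here.\<close>

lemma S_deg_blocks:
  assumes a: "a < p" and j: "j < p"
  shows "S.dim {x \<in> (t ^^ (p * a + j)) ` S_deg n. t x = 0} =
    (if a \<le> n then theta (n - a) div p + (if j < theta (n - a) mod p then 1 else 0) else 0)"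
proof (cases "a \<le> n")
  case False
  have "(t ^^ (p * a + j)) f = 0" if "f \<in> S_deg n" for f
  proof -
    have "low (Suc n - a) ((u ^^ a) f)" by (rule low_u_funpow[OF S_degD(2)[OF that]])
    then have "(u ^^ a) f = 0" using False by (simp add: low_iff_0)
    then show ?thesis unfolding t_funpow_mult_p using S.funpow_zero by simp
  qed
  then have "{x \<in> (t ^^ (p * a + j)) ` S_deg n. t x = 0} \<subseteq> S.span {}" by auto
  from S.dim_le_card[OF this] False show ?thesis by simp
next
  case True
  have rz: "rotA (z ^ a) = z ^ a" by (simp add: rotA_z)
  let ?X = "{x \<in> (t ^^ (p * a + j)) ` S_deg n. t x = 0}" and ?Y = "{x \<in> (t ^^ j) ` T_deg (n - a). t x = 0}"
  have za: "z ^ a \<noteq> 0" using z_nonzero by simp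
  have "?X = smult (z ^ a) ` ?Y"
  proof (intro equalityI subsetI)
    fix x assume "x \<in> ?X"
    then obtain f where f: "f \<in> S_deg n" "x = (t ^^ j) ((u ^^ a) f)" "t x = 0" by (auto simp: t_funpow_mult_p)
    have "(t ^^ Suc j) ((u ^^ a) f) = 0" using f by simp
    \<comment> \<open>Since j < p, being killed by t after t^j implies being killed by t^p =
      u.\<close>
    then have "(t ^^ p) ((u ^^ a) f) = 0" by (rule S.funpow_eq_0_mono) (use j in simp)
    then have "(u ^^ Suc a) f = 0" by (simp add: t_funpow_p)
    from u_image[OF f(1) this a True] obtain h where h: "h \<in> T_deg (n - a)" "(u ^^ a) f = smult (z ^ a) h" by blast
    have x: "x = smult (z ^ a) ((t ^^ j) h)" unfolding f(2) h(2) by (rule t_funpow_smult[OF rz])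
    have "smult (z ^ a) (t ((t ^^ j) h)) = 0" using f(3) t_smult[OF rz, of "(t ^^ j) h"] unfolding x by simp
    then have "t ((t ^^ j) h) = 0" using z_nonzero by simp
    then show "x \<in> smult (z ^ a) ` ?Y" using x h(1) by blast
  next
    fix x assume "x \<in> smult (z ^ a) ` ?Y"
    then obtain h where h: "h \<in> T_deg (n - a)" "x = smult (z ^ a) ((t ^^ j) h)" "t ((t ^^ j) h) = 0" by auto
    obtain f where f: "f \<in> S_deg n" "(u ^^ a) f = smult (z ^ a) h" using u_image_ex[OF h(1) a True] by blast
    have "x = (t ^^ (p * a + j)) f" unfolding t_funpow_mult_p f(2) t_funpow_smult[OF rz] h(2) ..
    moreover have "t x = 0" unfolding h(2) t_smult[OF rz] h(3) by simp
    ultimately show "x \<in> ?X" using f(1) by blast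
  qed
  moreover have "S.dim (smult (z ^ a) ` ?Y) = S.dim ?Y"
  proof (rule S.dim_injective_image)
    show "inj (smult (z ^ a))"
    proof (rule injI)
      fix x y assume "smult (z ^ a) x = smult (z ^ a) y"
      then have "smult (z ^ a) (x - y) = 0" by (simp add: smult_diff_right)
      then show "x = y" using z_nonzero by simp
    qed
  qed (simp_all add: smult_add_right mult.commute)
  ultimately show ?thesis using T_deg_blocks[OF j] True by simp
qed

lemma S_deg_finite_span: "\<exists>B. finite B \<and> S_deg n \<subseteq> S.span B"
proof (intro exI conjI)
  let ?I = "SIGMA i:{..n}. monomials p (n - i)"
  let ?b = "\<lambda>x. [:single (snd x) 1:] * [:0, 1:] ^ fst x"
  show "finite (?b ` ?I)" using finite_monomials by auto
  show "S_deg n \<subseteq> S.span (?b ` ?I)"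
  proof
    fix f assume f: "f \<in> S_deg n"
    have "f = (\<Sum>i\<le>n. [:coeff f i:] * [:0, 1:] ^ i)"
    proof -
      have "degree f \<le> n" using S_degD(2)[OF f] by (simp add: low_degree)
      from poly_as_sum_of_monoms'[OF this] show ?thesis by (simp add: monom_altdef)
    qed
    also have "\<dots> = (\<Sum>i\<le>n. \<Sum>e\<in>keys (coeff f i). smult (mconst (lookup (coeff f i) e)) (?b (i, e)))"
    proof (rule sum.cong[OF refl])
      fix i
      have "[:coeff f i:] * [:0, 1:] ^ i = smult (\<Sum>e\<in>keys (coeff f i). single e (lookup (coeff f i) e)) ([:0, 1:] ^ i)"
        by (simp flip: poly_mapping_as_sum)
      then show "[:coeff f i:] * [:0, 1:] ^ i = (\<Sum>e\<in>keys (coeff f i). smult (mconst (lookup (coeff f i) e)) (?b (i, e)))"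
        by (simp add: smult_sum mconst_def mult_single)
    qed
    also have "\<dots> \<in> S.span (?b ` ?I)"
    proof (intro S.span_sum S.span_scale S.span_base)
      fix i e assume "i \<in> {..n}" "e \<in> keys (coeff f i)"
      then have "(i, e) \<in> ?I" using S_degD(1)[OF f, of i] by (auto simp: homogeneous_def)
      then show "?b (i, e) \<in> ?b ` ?I" by (rule imageI)
    qed
    finally show "f \<in> S.span (?b ` ?I)" .
  qed
qed

lemma ex_chain_basis_S_deg: "\<exists>H l. S.chain_basis (S_deg n) H l"
  using S_deg_finite_span[of n] S.ex_chain_basis[OF S_deg_invariant] t_funpow_p2 by blast

text \<open>The number of Jordan blocks of size greater than \<open>k\<close> in degree
  \<open>n\<close>, by \<open>dim_S_deg_blocks\<close>; \<open>k div p\<close> and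
  \<open>k mod p\<close> are the a and j of \<open>S_deg_blocks\<close>.\<close>

definition blocks :: "nat \<Rightarrow> nat \<Rightarrow> nat" where
  "blocks n k = (if k < p * p \<and> k div p \<le> n
     then theta (n - k div p) div p + (if k mod p < theta (n - k div p) mod p then 1 else 0) else 0)"

lemma dim_S_deg_blocks: "S.dim {x \<in> (t ^^ k) ` S_deg n. t x = 0} = blocks n k"
proof (cases "k < p * p")
  case True
  then have "k div p < p" by (simp add: less_mult_imp_div_less)
  then show ?thesis using S_deg_blocks[of "k div p" "k mod p" n] True p_gt by (simp add: blocks_def)
next
  case False
  then have "(t ^^ k) f = 0" for f by (intro S.funpow_eq_0_mono[OF t_funpow_p2]) simp
  then have "{x \<in> (t ^^ k) ` S_deg n. t x = 0} \<subseteq> S.span {}" by auto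
  from S.dim_le_card[OF this] False show ?thesis by (simp add: blocks_def)
qed

end

section \<open>Isomorphism with the model\<close>

text \<open>Stated for an arbitrary grading \<open>Gr\<close>, because values are graded both by
  \<open>homogeneous\<close> and by \<open>S_deg\<close>.\<close>

lemma (in coeff_hom) meval_graded:
  assumes Gr: "\<And>n. 0 \<in> Gr n" "\<And>n x y. x \<in> Gr n \<Longrightarrow> y \<in> Gr n \<Longrightarrow> x + y \<in> Gr n"
    "\<And>m n x y. x \<in> Gr m \<Longrightarrow> y \<in> Gr n \<Longrightarrow> x * y \<in> Gr (m + n)" "\<And>a. h a \<in> Gr 0"
    and \<theta>: "\<And>i. i < v \<Longrightarrow> \<theta> i \<in> Gr 1" and f: "f \<in> homogeneous v n"
  shows "meval h \<theta> f \<in> Gr n"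
proof -
  have one: "1 \<in> Gr 0" using Gr(4)[of 1] by (simp add: h_1)
  have pw: "\<theta> i ^ k \<in> Gr k" if "i < v" for i k
  proof (induction k)
    case (Suc k) then show ?case using Gr(3)[OF \<theta>[OF that]] by fastforce
  qed (simp add: one)
  have pr: "(\<Prod>i\<in>A. \<theta> i ^ g i) \<in> Gr (\<Sum>i\<in>A. g i)" if "finite A" "A \<subseteq> {..<v}" for A and g :: "nat \<Rightarrow> nat"
    using that by (induction A rule: finite_induct) (auto intro: one Gr(3) pw)
  have sm: "sum q A \<in> Gr n" if "\<And>e. e \<in> A \<Longrightarrow> q e \<in> Gr n" for q and A :: "(nat \<Rightarrow>\<^sub>0 nat) set"
    using that by (induction A rule: infinite_finite_induct) (auto intro: Gr)
  show ?thesis unfolding meval_def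
  proof (rule sm)
    fix e assume "e \<in> keys f"
    then have "e \<in> monomials v n" using f by (auto simp: homogeneous_def)
    then have "monom_value \<theta> e \<in> Gr n" unfolding monom_value_def using pr[of "keys e" "lookup e"] by (auto simp: monomials_def)
    from Gr(3)[OF Gr(4) this] show "h (lookup f e) * monom_value \<theta> e \<in> Gr n" by simp
  qed
qed

lemma meval_graded_homogeneous:
  assumes "\<And>i. i < v \<Longrightarrow> \<theta> i \<in> homogeneous v' 1" "f \<in> homogeneous v n"
  shows "meval mconst \<theta> f \<in> homogeneous v' n"
  by (rule mconst.meval_graded[where Gr = "homogeneous v'" and v = v])
    (auto intro: homogeneous_add homogeneous_mult homogeneous_mconst assms[unfolded One_nat_def])

lemma homogeneous_1_expansion:
  assumes "f \<in> homogeneous v 1"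
  shows "f = (\<Sum>i<v. mconst (lookup f (single i 1)) * mvar i)"
proof (rule poly_mapping_eqI)
  fix e
  have "lookup (\<Sum>i<v. mconst (lookup f (single i 1)) * mvar i) e = (\<Sum>i<v. if single i 1 = e then lookup f e else 0)"
    unfolding lookup_sum lookup_mconst_mult mvar_def by (intro sum.cong) (auto simp: lookup_single when_def)
  also have "\<dots> = lookup f e"
  proof (cases "\<exists>i<v. single i 1 = e")
    case True
    then obtain i where i: "i < v" "single i 1 = e" by blast
    have "single j 1 = e \<longleftrightarrow> j = i" for j unfolding i(2)[symmetric] by (auto dest: arg_cong[where f = keys])
    then show ?thesis using i(1) by simp
  next
    case False
    have "lookup f e = 0"
    proof (rule ccontr)
      assume "lookup f e \<noteq> 0"
      then have e: "keys e \<subseteq> {..<v}" "(\<Sum>i<v. lookup e i) = 1"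
        using homogeneousD[OF assms] by (auto simp: monomials_iff)
      then obtain i where i: "i < v" "lookup e i > 0" by (metis One_nat_def gr0I lessThan_iff sum.neutral zero_neq_one)
      have "(\<Sum>i<v. lookup e i) = lookup e i + (\<Sum>j\<in>{..<v} - {i}. lookup e j)"
        by (rule sum.remove) (use i in auto)
      then have "lookup e i = 1" "(\<Sum>j\<in>{..<v} - {i}. lookup e j) = 0" using e(2) i(2) by linarith+
      then have l: "lookup e i = 1" "\<And>j. j \<in> {..<v} - {i} \<Longrightarrow> lookup e j = 0" by simp_all
      have "single i 1 = e"
      proof (rule poly_mapping_eqI)
        fix j show "lookup (single i 1) j = lookup e j"
          using l e(1) by (cases "j < v") (auto simp: lookup_single when_def in_keys_iff)
      qed
      then show False using False i by blast
    qed
    then show ?thesis by (intro sum.neutral[THEN trans]) auto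
  qed
  finally show "lookup f e = lookup (\<Sum>i<v. mconst (lookup f (single i 1)) * mvar i) e" by simp
qed

context cyclic_prime
begin

section \<open>The inverse of the generator and the images of the coordinate functions\<close>

lemma rho_funpow_simps [simp]:
  "(rho ^^ n) 0 = 0" "(rho ^^ n) 1 = 1" "(rho ^^ n) (f + g) = (rho ^^ n) f + (rho ^^ n) g"
  "(rho ^^ n) (f - g) = (rho ^^ n) f - (rho ^^ n) g"
  "(rho ^^ n) (f * g) = (rho ^^ n) f * (rho ^^ n) g" "(rho ^^ n) [:mconst a:] = [:mconst a:]"
  by (induction n) (simp_all add: rho_diff)

lemma rho_funpow_scale: "(rho ^^ n) (smult (mconst a) f) = smult (mconst a) ((rho ^^ n) f)"
  by (induction n) simp_all

text \<open>The inverse of \<open>rho\<close>, written as a power so that it inherits the rules for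
  \<open>rho\<close>. It appears because a group element acts on coordinate functions through the
  matrix of its inverse.\<close>

definition tau :: "'k mpoly poly \<Rightarrow> 'k mpoly poly" where "tau = rho ^^ (p * p - 1)"

lemma tau_rho: "tau (rho f) = f" and rho_tau: "rho (tau f) = f"
proof -
  have "p * p > 0" using p_gt by simp
  from funpow_pred[OF this, of rho f] show "rho (tau f) = f" by (simp add: tau_def rho_funpow_p2)
  then show "tau (rho f) = f" unfolding tau_def by (metis funpow_swap1)
qed

text \<open>Shows that a set closed under \<open>tau\<close> is also closed under
  \<open>rho\<close>, as needed for the span of the \<open>X i\<close>.\<close>

lemma rho_eq_tau_funpow: "rho = tau ^^ (p * p - 1)"
proof
  fix f
  have "rho f = (tau ^^ n) ((rho ^^ n) (rho f))" for n
    by (induction n) (simp_all add: funpow_swap1[of tau] tau_rho)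
  from this[of "p * p - 1"] show "rho f = (tau ^^ (p * p - 1)) f"
    using funpow_pred[of "p * p" rho f] p_gt by (simp add: rho_funpow_p2 flip: funpow_swap1)
qed

lemma tau_simps: "tau (f + g) = tau f + tau g" "tau (f - g) = tau f - tau g" "tau 0 = 0"
  "tau (smult (mconst a) f) = smult (mconst a) (tau f)"
  by (simp_all add: tau_def rho_funpow_scale)

lemma tau_S_deg: "f \<in> S_deg n \<Longrightarrow> tau f \<in> S_deg n"
proof -
  assume f: "f \<in> S_deg n"
  have "(rho ^^ k) f \<in> S_deg n" for k by (induction k) (simp_all add: f rho_S_deg)
  then show ?thesis by (simp add: tau_def)
qed

lemma linear_operator_tau: "linear_operator (\<lambda>c (f :: 'k mpoly poly). smult (mconst c) f) (\<lambda>f. tau f - f)"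
  using poly_mpoly_vector_space
  by (auto simp: linear_operator_def linear_operator_axioms_def tau_simps smult_diff_right)

sublocale D: linear_operator "\<lambda>c (f :: 'k mpoly poly). smult (mconst c) f" "\<lambda>f. tau f - f"
  by (rule linear_operator_tau)

abbreviation d :: "'k mpoly poly \<Rightarrow> 'k mpoly poly" where "d f \<equiv> tau f - f"

text \<open>With tau the inverse of rho, tau - 1 = - tau (rho - 1), and the two factors
  commute.\<close>

lemma d_funpow: "(d ^^ n) f = ((\<lambda>f. - tau f) ^^ n) ((t ^^ n) f)"
proof (induction n arbitrary: f)
  case (Suc n)
  have comm: "((\<lambda>f. - tau f) ^^ n) (- tau f) = - tau (((\<lambda>f. - tau f) ^^ n) f)" for f
    using funpow_swap1[of "\<lambda>f. - tau f" n f] by simp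
  have tt: "(t ^^ n) (- tau g) = - tau ((t ^^ n) g)" for g
  proof (induction n)
    case (Suc n)
    then show ?case using rho_diff[of 0 "tau ((t ^^ n) g)"] by (simp add: tau_simps rho_tau tau_rho)
  qed simp
  have df: "d f = - tau (t f)" by (simp add: tau_simps tau_rho)
  have "(d ^^ Suc n) f = (d ^^ n) (d f)" by (simp only: funpow_Suc_right comp_apply)
  also have "\<dots> = ((\<lambda>f. - tau f) ^^ n) ((t ^^ n) (- tau (t f)))" unfolding Suc df ..
  also have "\<dots> = - tau (((\<lambda>f. - tau f) ^^ n) ((t ^^ n) (t f)))" unfolding tt comm ..
  also have "(t ^^ n) (t f) = (t ^^ Suc n) f" using funpow_swap1[of t n f] by simp
  finally show ?case by simp
qed simp

text \<open>The images of the coordinate functions. The Jordan block sends x_i to x_i + x_(i+1), and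
  in the model it becomes \<open>tau\<close>, so x_i must go to (tau - 1)^i Y.\<close>

definition X :: "nat \<Rightarrow> 'k mpoly poly" where "X i = (d ^^ i) [:0, 1:]"

lemma X_0: "X 0 = [:0, 1:]"
  by (simp add: X_def)

lemma tau_X: "tau (X i) = X i + X (Suc i)"
  by (simp add: X_def)

lemma t_funpow_p_Y: "(t ^^ p) [:0, 1:] = [:z:]"
  by (simp add: t_funpow_p u_def)

text \<open>t^p Y = z and t z = 0. With \<open>X_p\<close> the chain of Y has exactly p + 1 members,
  one for each coordinate function.\<close>

lemma X_end: "X (Suc p) = 0"
proof -
  have "(t ^^ Suc p) [:0, 1:] = t ((t ^^ p) [:0, 1:])" by simp
  also have "\<dots> = 0" unfolding t_funpow_p_Y by (simp add: rotA_z)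
  finally have "(t ^^ Suc p) [:0, 1:] = 0" .
  moreover have "((\<lambda>f. - tau f) ^^ n) 0 = 0" for n by (induction n) (simp_all add: tau_simps)
  ultimately show ?thesis unfolding X_def d_funpow by (simp only:)
qed

lemma X_p: "X p \<noteq> 0"
proof -
  have inj: "((\<lambda>f. - tau f) ^^ n) f \<noteq> 0" if "f \<noteq> 0" for n f
  proof (induction n)
    case (Suc n)
    have "tau g \<noteq> 0" if "g \<noteq> 0" for g using rho_tau[of g] that by auto
    then show ?case using Suc by simp
  qed (simp add: that)
  show ?thesis unfolding X_def d_funpow t_funpow_p_Y using z_nonzero by (intro inj) simp
qed

lemma X_S_deg: "X i \<in> S_deg 1"
  unfolding X_def by (induction i) (auto intro: S_deg_Y[unfolded One_nat_def] S_deg_diff tau_S_deg)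

lemma X_independent:
  assumes "(\<Sum>l<Suc p. smult (mconst (a l)) (X l)) = 0" "l < Suc p"
  shows "a l = 0"
  using assms(2)
proof (induction l rule: less_induct)
  case (less l)
  have dX: "(d ^^ k) (X i) = X (k + i)" for k i by (simp add: X_def funpow_add)
  have X0: "X i = 0" if "i > p" for i
  proof -
    have "X (i - Suc p + Suc p) = 0" unfolding dX[symmetric] X_end by (rule D.funpow_zero)
    then show ?thesis using that by simp
  qed
  \<comment> \<open>This power of d sends \<open>X l\<close> to \<open>X p\<close> and kills the
    later members; the earlier ones have coefficient 0 by induction.\<close>
  have "0 = (d ^^ (p - l)) (\<Sum>l<Suc p. smult (mconst (a l)) (X l))" unfolding assms(1) by (rule D.funpow_zero[symmetric])
  also have "\<dots> = (\<Sum>i<Suc p. smult (mconst (a i)) (X (p - l + i)))"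
    unfolding D.funpow_sum D.funpow_scale dX ..
  also have "\<dots> = (\<Sum>i\<in>{l}. smult (mconst (a i)) (X (p - l + i)))"
  proof (rule sum.mono_neutral_right)
    show "\<forall>i\<in>{..<Suc p} - {l}. smult (mconst (a i)) (X (p - l + i)) = 0"
    proof
      fix i assume i: "i \<in> {..<Suc p} - {l}"
      show "smult (mconst (a i)) (X (p - l + i)) = 0"
      proof (cases "i < l")
        case True then show ?thesis using less by simp
      next
        case False
        then have "p - l + i > p" using i less.prems by auto
        then show ?thesis using X0 by simp
      qed
    qed
  qed (use less.prems in auto)
  finally have "smult (mconst (a l)) (X p) = 0" using less.prems by simp
  then show ?case using X_p by simp
qed

text \<open>The span of the \<open>X i\<close> is closed under \<open>tau\<close>, hence under
  \<open>rho\<close>. It contains Y, therefore w_0 = rho Y - Y, and therefore the whole orbit of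
  w_0.\<close>

lemma mvar_in_X_span:
  assumes "j < p" shows "\<exists>a. [:mvar j:] = (\<Sum>l<Suc p. smult (mconst (a l)) (X l))"
proof -
  define XS where "XS a = (\<Sum>l<Suc p. smult (mconst (a l)) (X l))" for a
  let ?P = "range XS"
  have tauP: "tau f \<in> ?P" if f: "f \<in> ?P" for f
  proof -
    obtain a where a: "f = (\<Sum>l<Suc p. smult (mconst (a l)) (X l))" using f unfolding XS_def by blast
    have ts: "tau (sum g A) = (\<Sum>x\<in>A. tau (g x))" for g and A :: "nat set"
      by (induction A rule: infinite_finite_induct) (simp_all add: tau_simps)
    have "tau f = (\<Sum>l<Suc p. smult (mconst (a l)) (X l)) + (\<Sum>l<Suc p. smult (mconst (a l)) (X (Suc l)))"
      by (simp only: a ts tau_simps tau_X smult_add_right sum.distrib)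
    also have "(\<Sum>l<Suc p. smult (mconst (a l)) (X (Suc l))) = (\<Sum>l<p. smult (mconst (a l)) (X (Suc l)))"
      by (simp add: X_end)
    also have "\<dots> = (\<Sum>l<Suc p. smult (mconst (if l = 0 then 0 else a (l - 1))) (X l))"
      by (subst sum.lessThan_Suc_shift) simp
    also have "(\<Sum>l<Suc p. smult (mconst (a l)) (X l)) + \<dots> =
      (\<Sum>l<Suc p. smult (mconst (a l + (if l = 0 then 0 else a (l - 1)))) (X l))"
      by (simp only: sum.distrib[symmetric] smult_add_left[symmetric] mconst_simps)
    finally have "tau f = XS (\<lambda>l. a l + (if l = 0 then 0 else a (l - 1)))" unfolding XS_def .
    then show ?thesis by simp
  qed
  have rhoP: "rho f \<in> ?P" if "f \<in> ?P" for f
  proof -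
    have "(tau ^^ n) f \<in> ?P" for n by (induction n) (use that tauP in auto)
    then show ?thesis by (simp only: rho_eq_tau_funpow)
  qed
  have "X 0 = XS (\<lambda>l. if l = 0 then 1 else 0)"
    unfolding XS_def by (subst sum.lessThan_Suc_shift) simp
  then have X0: "[:0, 1:] \<in> ?P" unfolding X_0 by simp
  have "[:mvar 0:] \<in> ?P"
  proof -
    obtain a where a: "rho [:0, 1:] = (\<Sum>l<Suc p. smult (mconst (a l)) (X l))" using rhoP[OF X0] unfolding XS_def by blast
    obtain b where b: "[:0, 1:] = (\<Sum>l<Suc p. smult (mconst (b l)) (X l))" using X0 unfolding XS_def by blast
    have "[:mvar 0:] = rho [:0, 1:] - [:0, 1 :: 'k mpoly:]" by simp
    also have "\<dots> = (\<Sum>l<Suc p. smult (mconst (a l)) (X l)) - (\<Sum>l<Suc p. smult (mconst (b l)) (X l))"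
      by (simp only: a b[symmetric])
    also have "\<dots> = (\<Sum>l<Suc p. smult (mconst (a l - b l)) (X l))"
      by (simp only: diff_conv_add_uminus mconst_simps mconst_uminus smult_add_left smult_minus_left sum.distrib sum_negf)
    finally have "[:mvar 0:] = XS (\<lambda>l. a l - b l)" unfolding XS_def .
    then show ?thesis by simp
  qed
  then have "(rho ^^ j) [:mvar 0:] \<in> ?P" by (induction j) (use rhoP in auto)
  moreover have "(rho ^^ j) [:mvar 0:] = [:(rotA ^^ j) (mvar 0):]" by (induction j) simp_all
  ultimately have "[:mvar j:] \<in> ?P" by (simp only: rotA_funpow_mvar[OF assms])
  then show ?thesis unfolding XS_def by blast
qed

definition coord_form :: "nat \<Rightarrow> nat \<Rightarrow> 'k" where
  "coord_form j = (SOME a. [:mvar j:] = (\<Sum>l<Suc p. smult (mconst (a l)) (X l)))"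

lemma coord_form: "j < p \<Longrightarrow> [:mvar j:] = (\<Sum>l<Suc p. smult (mconst (coord_form j l)) (X l))"
  unfolding coord_form_def by (fact someI_ex[OF mvar_in_X_span])

section \<open>Mutually inverse isomorphisms between the polynomial ring and the model\<close>

definition W :: "nat \<Rightarrow> 'k mpoly" where "W j = (\<Sum>l<Suc p. mconst (coord_form j l) * mvar l)"

definition Phi :: "'k mpoly \<Rightarrow> 'k mpoly poly" where "Phi = meval (\<lambda>a. [:mconst a:]) X"

definition Psi :: "'k mpoly poly \<Rightarrow> 'k mpoly" where "Psi q = poly (map_poly (meval mconst W) q) (mvar 0)"

lemma coeff_hom_const: "coeff_hom (\<lambda>a::'k. [:mconst a:])"
  by unfold_locales (simp_all add: one_pCons)

interpretation const: coeff_hom "\<lambda>a::'k. [:mconst a:]"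
  by (rule coeff_hom_const)

lemma Phi_simps: "Phi (f + g) = Phi f + Phi g" "Phi (f * g) = Phi f * Phi g" "Phi 1 = 1" "Phi 0 = 0"
  "Phi (mconst a) = [:mconst a:]" "Phi (mvar i) = X i" "Phi (sum b I) = (\<Sum>i\<in>I. Phi (b i))"
  by (simp_all add: Phi_def const.meval_add const.meval_mult const.meval_sum)

lemma Phi_scale: "Phi (mconst a * f) = smult (mconst a) (Phi f)"
  by (simp add: Phi_simps)

lemma Phi_S_deg: "f \<in> homogeneous (Suc p) n \<Longrightarrow> Phi f \<in> S_deg n"
  unfolding Phi_def
  by (rule const.meval_graded[where Gr = S_deg and v = "Suc p"]) (auto intro: S_deg_add S_deg_mult S_deg_const homogeneous_mconst X_S_deg[unfolded One_nat_def])

lemma Phi_W: "j < p \<Longrightarrow> Phi (W j) = [:mvar j:]"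
  unfolding W_def Phi_simps(7) Phi_scale Phi_simps(6) by (simp only: coord_form)

lemma coeff_map_meval [simp]: "coeff (map_poly (meval mconst W) q) i = meval mconst W (coeff q i)"
  by (simp add: coeff_map_poly)

lemma map_meval_simps:
  "map_poly (meval mconst W) (f + g) = map_poly (meval mconst W) f + map_poly (meval mconst W) g"
  "map_poly (meval mconst W) (f * g) = map_poly (meval mconst W) f * map_poly (meval mconst W) g"
  "map_poly (meval mconst W) 1 = 1" 
  by (auto intro!: poly_eqI simp: coeff_mult coeff_1 mconst.meval_add mconst.meval_mult mconst.meval_sum)

lemma map_meval_const: "map_poly (meval mconst W) [:a:] = [:meval mconst W a:]"
  by (rule poly_eqI) (simp add: coeff_pCons split: nat.split)

lemma Psi_simps: "Psi (f + g) = Psi f + Psi g" "Psi (f * g) = Psi f * Psi g" "Psi 1 = 1" "Psi 0 = 0"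
  "Psi [:a:] = meval mconst W a"
  by (simp_all add: Psi_def map_meval_simps map_meval_const)

lemma W_homogeneous: "W j \<in> homogeneous (Suc p) 1"
  unfolding W_def by (intro homogeneous_sum homogeneous_scale homogeneous_mvar) simp

lemma Psi_altdef: "degree q \<le> n \<Longrightarrow> Psi q = (\<Sum>i\<le>n. meval mconst W (coeff q i) * mvar 0 ^ i)"
proof -
  assume n: "degree q \<le> n"
  have "degree (map_poly (meval mconst W) q) \<le> n" using degree_map_poly_le n by (rule le_trans)
  from poly_as_sum_of_monoms'[OF this]
  have "Psi q = poly (\<Sum>i\<le>n. monom (meval mconst W (coeff q i)) i) (mvar 0)" by (simp add: Psi_def)
  then show ?thesis by (simp add: poly_sum poly_monom)
qed

lemma Psi_homogeneous: "q \<in> S_deg n \<Longrightarrow> Psi q \<in> homogeneous (Suc p) n"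
proof -
  assume q: "q \<in> S_deg n"
  then have dq: "degree q \<le> n" using S_degD(2) low_degree by blast
  show ?thesis unfolding Psi_altdef[OF dq]
  proof (rule homogeneous_sum)
    fix i assume i: "i \<in> {..n}"
    have "meval mconst W (coeff q i) \<in> homogeneous (Suc p) (n - i)"
      by (rule meval_graded_homogeneous[where v = p]) (use W_homogeneous S_degD(1)[OF q] i in auto)
    moreover have "mvar 0 ^ i \<in> homogeneous (Suc p) (i * 1)" by (intro homogeneous_power homogeneous_mvar) simp
    ultimately have "meval mconst W (coeff q i) * mvar 0 ^ i \<in> homogeneous (Suc p) ((n - i) + i * 1)" by (rule homogeneous_mult)
    then show "meval mconst W (coeff q i) * mvar 0 ^ i \<in> homogeneous (Suc p) n" using i by simp
  qed
qed

lemma Phi_Psi: "q \<in> S_deg n \<Longrightarrow> Phi (Psi q) = q"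
proof -
  assume q: "q \<in> S_deg n"
  then have dq: "degree q \<le> n" using S_degD(2) low_degree by blast
  have pw: "Phi (f ^ k) = Phi f ^ k" for f k by (induction k) (simp_all add: Phi_simps)
  have c: "Phi (meval mconst W (coeff q i)) = [:coeff q i:]" if "i \<le> n" for i
  proof -
    have "Phi (meval mconst W (coeff q i)) = meval (Phi \<circ> mconst) (Phi \<circ> W) (coeff q i)"
      by (rule mconst.meval_comp) (simp_all add: Phi_simps)
    also have "Phi \<circ> mconst = (\<lambda>a. [:mconst a:])" by (auto simp: Phi_simps)
    also have "meval (\<lambda>a. [:mconst a:]) (Phi \<circ> W) (coeff q i) = meval (\<lambda>a. [:mconst a:]) (\<lambda>j. [:mvar j:]) (coeff q i)"
    proof (rule meval_cong)
      fix e j assume "e \<in> keys (coeff q i)" "j \<in> keys e"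
      then have "j < p" using S_degD(1)[OF q that] by (auto simp: homogeneous_def monomials_def)
      then show "(Phi \<circ> W) j = [:mvar j:]" by (simp add: Phi_W)
    qed
    also have "\<dots> = meval ((\<lambda>a. [:a:]) \<circ> mconst) ((\<lambda>a. [:a:]) \<circ> mvar) (coeff q i)" by (simp add: comp_def)
    also have "\<dots> = [:meval mconst mvar (coeff q i):]"
      by (rule mconst.meval_comp[symmetric]) (simp_all add: one_pCons)
    finally show ?thesis by (simp add: meval_mvar_id)
  qed
  have "Phi (Psi q) = (\<Sum>i\<le>n. [:coeff q i:] * [:0, 1:] ^ i)"
    unfolding Psi_altdef[OF dq] Phi_simps(7) by (intro sum.cong refl) (simp add: Phi_simps(2,6) pw X_0 c)
  also have "\<dots> = q" using poly_as_sum_of_monoms'[OF dq] by (simp add: monom_altdef)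
  finally show ?thesis .
qed

text \<open>So far \<open>Psi\<close> is only a right inverse of \<open>Phi\<close>. In degree one
  \<open>Phi\<close> is injective by \<open>X_independent\<close>, so the two are inverse there,
  which settles the variables and then all polynomials.\<close>

lemma Psi_X: "i < Suc p \<Longrightarrow> Psi (X i) = mvar i"
proof -
  assume i: "i < Suc p"
  let ?f = "Psi (X i) - mvar i"
  have h: "?f \<in> homogeneous (Suc p) 1"
    by (rule homogeneous_diff[OF Psi_homogeneous[OF X_S_deg] homogeneous_mvar[OF i]])
  have "Phi ?f + Phi (mvar i) = Phi (Psi (X i))" by (simp flip: Phi_simps(1))
  then have P0: "Phi ?f = 0" using Phi_Psi[OF X_S_deg[of i]] by (simp add: Phi_simps(6))
  have "Phi ?f = (\<Sum>l<Suc p. smult (mconst (lookup ?f (single l 1))) (X l))"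
    by (subst homogeneous_1_expansion[OF h]) (simp only: Phi_simps(7) Phi_scale Phi_simps(6))
  then have "lookup ?f (single l 1) = 0" if "l < Suc p" for l
    using X_independent[of "\<lambda>l. lookup ?f (single l 1)", OF _ that] P0 by simp
  then have "?f = 0" by (subst homogeneous_1_expansion[OF h]) simp
  then show ?thesis by simp
qed

lemma Psi_Phi: "f \<in> homogeneous (Suc p) n \<Longrightarrow> Psi (Phi f) = f"
proof -
  assume f: "f \<in> homogeneous (Suc p) n"
  have "Psi (Phi f) = meval (Psi \<circ> (\<lambda>a. [:mconst a:])) (Psi \<circ> X) f"
    unfolding Phi_def by (rule const.meval_comp) (simp_all add: Psi_simps)
  also have "Psi \<circ> (\<lambda>a. [:mconst a:]) = mconst" by (auto simp: Psi_simps)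
  also have "meval mconst (Psi \<circ> X) f = meval mconst mvar f"
  proof (rule meval_cong)
    fix e j assume "e \<in> keys f" "j \<in> keys e"
    then have "j < Suc p" using f by (auto simp: homogeneous_def monomials_def)
    then show "(Psi \<circ> X) j = mvar j" by (simp add: Psi_X)
  qed
  finally show ?thesis by (simp add: meval_mvar_id)
qed

lemma bij_Phi: "bij_betw Phi (homogeneous (Suc p) n) (S_deg n)"
  by (rule bij_betwI[where g = Psi]) (auto simp: Phi_S_deg Psi_homogeneous Psi_Phi Phi_Psi)

lemma jordan_power_X:
  assumes "i < Suc p"
  shows "(\<Sum>j<Suc p. smult (mconst ((jordan_block (Suc p) (1::'k) ^\<^sub>m k) $$ (i, j))) (X j)) = (tau ^^ k) (X i)"
  using assms
proof (induction k)
  case 0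
  have "(\<Sum>j<Suc p. smult (mconst ((jordan_block (Suc p) (1::'k) ^\<^sub>m 0) $$ (i, j))) (X j)) = (\<Sum>j<Suc p. if j = i then X j else 0)"
    using 0 by (intro sum.cong) (auto simp: jordan_block_def)
  then show ?case using 0 by simp
next
  case (Suc k)
  let ?J = "jordan_block (Suc p) (1::'k)"
  have J: "?J \<in> carrier_mat (Suc p) (Suc p)" "?J ^\<^sub>m k \<in> carrier_mat (Suc p) (Suc p)" by (simp_all add: pow_carrier_mat)
  have tauX: "(\<Sum>j<Suc p. smult (mconst (?J $$ (l, j))) (X j)) = tau (X l)" if "l < Suc p" for l
  proof -
    have "(\<Sum>j<Suc p. smult (mconst (?J $$ (l, j))) (X j)) = (\<Sum>j<Suc p. (if j = l then X j else 0) + (if j = Suc l then X j else 0))"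
      using that by (intro sum.cong) (auto simp: jordan_block_def)
    also have "\<dots> = X l + (if Suc l < Suc p then X (Suc l) else 0)" using that by (simp add: sum.distrib del: sum.lessThan_Suc)
    also have "\<dots> = tau (X l)" using that X_end by (cases "l = p") (auto simp: tau_X)
    finally show ?thesis .
  qed
  have ts: "tau (sum g A) = (\<Sum>x\<in>A. tau (g x))" for g and A :: "nat set"
    by (induction A rule: infinite_finite_induct) (simp_all add: tau_simps)
  have e: "(?J ^\<^sub>m Suc k) $$ (i, j) = (\<Sum>l<Suc p. (?J ^\<^sub>m k) $$ (i, l) * ?J $$ (l, j))" if "j < Suc p" for j
    using J Suc.prems that by (simp add: scalar_prod_def lessThan_atLeast0 del: sum.op_ivl_Suc)
  have "(\<Sum>j<Suc p. smult (mconst ((?J ^\<^sub>m Suc k) $$ (i, j))) (X j))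
    = (\<Sum>j<Suc p. \<Sum>l<Suc p. smult (mconst ((?J ^\<^sub>m k) $$ (i, l))) (smult (mconst (?J $$ (l, j))) (X j)))"
  proof (rule sum.cong[OF refl])
    fix j assume "j \<in> {..<Suc p}"
    then have "j < Suc p" by simp
    have ms: "mconst (sum g A) = (\<Sum>x\<in>A. mconst (g x))" for g :: "nat \<Rightarrow> 'k" and A
      by (induction A rule: infinite_finite_induct) simp_all
    show "smult (mconst ((?J ^\<^sub>m Suc k) $$ (i, j))) (X j) =
      (\<Sum>l<Suc p. smult (mconst ((?J ^\<^sub>m k) $$ (i, l))) (smult (mconst (?J $$ (l, j))) (X j)))"
      unfolding e[OF \<open>j < Suc p\<close>] ms smult_sum by (intro sum.cong) simp_all
  qed
  also have "\<dots> = (\<Sum>l<Suc p. \<Sum>j<Suc p. smult (mconst ((?J ^\<^sub>m k) $$ (i, l))) (smult (mconst (?J $$ (l, j))) (X j)))"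
    by (rule sum.swap)
  also have "\<dots> = (\<Sum>l<Suc p. smult (mconst ((?J ^\<^sub>m k) $$ (i, l))) (tau (X l)))"
    by (intro sum.cong refl) (simp only: tauX[symmetric] lessThan_iff smult_sum2)
  also have "\<dots> = tau (\<Sum>l<Suc p. smult (mconst ((?J ^\<^sub>m k) $$ (i, l))) (X l))"
    by (simp only: ts tau_simps)
  also have "\<dots> = (tau ^^ Suc k) (X i)" using Suc by simp
  finally show ?case .
qed

text \<open>To be used with the least exponents \<open>k\<close> and \<open>k'\<close> of a group
  element and of its inverse, whose sum is known only to be divisible by p^2.\<close>

lemma tau_funpow_eq_rho_funpow:
  assumes "p * p dvd k + k'" shows "(tau ^^ k') f = (rho ^^ k) f"
proof -
  have inv: "(tau ^^ n) ((rho ^^ n) f) = f" for n f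
    by (induction n) (simp_all add: funpow_swap1[of tau] tau_rho)
  obtain m where m: "k + k' = p * p * m" using assms by blast
  have "(rho ^^ (p * p * m)) f = f"
    by (induction m) (simp_all add: rho_funpow_p2 funpow_add)
  then have "(rho ^^ k') ((rho ^^ k) f) = f" using m by (simp add: add.commute flip: funpow_add comp_apply[of "rho ^^ k'"])
  then show ?thesis using inv[of k' "(rho ^^ k) f"] by simp
qed

theorem realizes_sym_dual:
  fixes G :: "('g, 'x) monoid_scheme"
  assumes "group G" and s: "s \<in> carrier G" and gen: "\<And>g. g \<in> carrier G \<Longrightarrow> \<exists>k::nat. g = s [^]\<^bsub>G\<^esub> k"
    and ord: "\<And>k::nat. s [^]\<^bsub>G\<^esub> k = \<one>\<^bsub>G\<^esub> \<longleftrightarrow> p * p dvd k"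
  shows "S.realizes G s (sym_dual G s (p + 1) n) (S_deg n) Phi"
proof -
  interpret G: group G by fact
  let ?M = "sym_dual G s (p + 1) n :: ('k, 'k mpoly, 'g) fg_module"
  have car: "carrier ?M = homogeneous (Suc p) n" using carrier_sym_dual[of G s "p + 1" n] by simp
  have rho: "(\<lambda>x. x + t x) = rho" by auto
  have act: "action ?M g f \<in> homogeneous (Suc p) n \<and> Phi (action ?M g f) = (rho ^^ (LEAST k::nat. g = s [^]\<^bsub>G\<^esub> k)) (Phi f)"
    if g: "g \<in> carrier G" and f: "f \<in> homogeneous (Suc p) n" for g f
  proof -
    let ?k = "LEAST k::nat. g = s [^]\<^bsub>G\<^esub> k" and ?k' = "LEAST k::nat. inv\<^bsub>G\<^esub> g = s [^]\<^bsub>G\<^esub> k"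
    have k: "g = s [^]\<^bsub>G\<^esub> ?k" using gen[OF g] by (rule LeastI_ex)
    have k': "inv\<^bsub>G\<^esub> g = s [^]\<^bsub>G\<^esub> ?k'" using gen[OF G.inv_closed[OF g]] by (rule LeastI_ex)
    have "s [^]\<^bsub>G\<^esub> (?k + ?k') = s [^]\<^bsub>G\<^esub> ?k \<otimes>\<^bsub>G\<^esub> s [^]\<^bsub>G\<^esub> ?k'" by (rule G.nat_pow_mult[OF s, symmetric])
    also have "\<dots> = g \<otimes>\<^bsub>G\<^esub> inv\<^bsub>G\<^esub> g" using k k' by simp
    also have "\<dots> = \<one>\<^bsub>G\<^esub>" by (rule G.r_inv[OF g])
    finally have dvd: "p * p dvd ?k + ?k'" using ord by blast
    have a: "action ?M g f = meval mconst (coord_action G s (Suc p) g) f"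
      by (simp add: sym_dual_def msubst_eq_meval)
    have ch: "coord_action G s (Suc p) g i \<in> homogeneous (Suc p) 1" for i
      unfolding coord_action_def by (intro homogeneous_sum homogeneous_scale homogeneous_mvar) simp
    have "action ?M g f \<in> homogeneous (Suc p) n"
      unfolding a by (rule meval_graded_homogeneous[OF ch f])
    moreover have "Phi (action ?M g f) = (rho ^^ ?k) (Phi f)"
    proof -
      have "Phi (action ?M g f) = meval (Phi \<circ> mconst) (Phi \<circ> coord_action G s (Suc p) g) f"
        unfolding a by (rule mconst.meval_comp) (simp_all add: Phi_simps)
      also have "Phi \<circ> mconst = (\<lambda>a. [:mconst a:])" by (auto simp: Phi_simps)
      also have "meval (\<lambda>a. [:mconst a:]) (Phi \<circ> coord_action G s (Suc p) g) f = meval (\<lambda>a. [:mconst a:]) ((rho ^^ ?k) \<circ> X) f"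
      proof (rule meval_cong)
        fix e i assume "e \<in> keys f" "i \<in> keys e"
        then have i: "i < Suc p" using f by (auto simp: homogeneous_def monomials_def)
        \<comment> \<open>The matrix of the inverse of g is the power \<open>?k'\<close> of the
          block. It acts on the \<open>X j\<close> as that power of \<open>tau\<close>, which is the
          power \<open>?k\<close> of \<open>rho\<close>.\<close>
        have "(Phi \<circ> coord_action G s (Suc p) g) i = (\<Sum>j<Suc p. smult (mconst ((jordan_block (Suc p) (1::'k) ^\<^sub>m ?k') $$ (i, j))) (X j))"
          by (simp only: comp_apply coord_action_def jordan_rep_def Phi_simps(7) Phi_scale Phi_simps(6))
        also have "\<dots> = (rho ^^ ?k) (X i)" unfolding jordan_power_X[OF i] by (rule tau_funpow_eq_rho_funpow[OF dvd])
        finally show "(Phi \<circ> coord_action G s (Suc p) g) i = ((rho ^^ ?k) \<circ> X) i" by simp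
      qed
      also have "\<dots> = meval ((rho ^^ ?k) \<circ> (\<lambda>a. [:mconst a:])) ((rho ^^ ?k) \<circ> X) f" by (simp add: comp_def)
      also have "\<dots> = (rho ^^ ?k) (Phi f)"
        unfolding Phi_def by (rule const.meval_comp[symmetric]) simp_all
      finally show ?thesis .
    qed
    ultimately show ?thesis by blast
  qed
  show ?thesis
    unfolding S.realizes_def rho car
  proof (intro conjI ballI allI)
    show "bij_betw Phi (homogeneous (Suc p) n) (S_deg n)" by (rule bij_Phi)
  qed (use act in \<open>auto simp: sym_dual_def Phi_simps homogeneous_add homogeneous_scale\<close>)
qed

end

section \<open>Multiplicities and generating functions\<close>

lemma count_concat_replicate:
  assumes "distinct xs" "inj_on f (set xs)"
  shows "count (mset (concat (map (\<lambda>i. replicate (a i) (f i)) xs))) m =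
    (if m \<in> f ` set xs then a (the_inv_into (set xs) f m) else 0)"
  using assms
proof (induction xs)
  case (Cons x xs)
  have inj: "inj_on f (insert x (set xs))" and x: "x \<notin> set xs" using Cons.prems by simp_all
  have inv: "the_inv_into (insert x (set xs)) f (f i) = i" if "i \<in> insert x (set xs)" for i
    by (rule the_inv_into_f_f[OF inj that])
  have inv': "the_inv_into (set xs) f (f i) = i" if "i \<in> set xs" for i
    using that inj by (intro the_inv_into_f_f) (auto simp: inj_on_def)
  have ne: "f x \<notin> f ` set xs" using inj x by (auto simp: inj_on_def)
  show ?case
  proof (cases "m \<in> f ` insert x (set xs)")
    case True
    then obtain i where i: "i \<in> insert x (set xs)" "m = f i" by blast
    show ?thesis
    proof (cases "i = x")
      case True
      then show ?thesis using Cons ne inv[of x] i by simp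
    next
      case False
      then have "i \<in> set xs" "f x \<noteq> f i" using i ne by auto
      then show ?thesis using Cons inv[of i] inv'[of i] i by simp
    qed
  next
    case False
    then show ?thesis using Cons by auto
  qed
qed simp

lemma decomp: "(r::nat) < q \<Longrightarrow> (a * q + r) div q = a" "r < q \<Longrightarrow> (a * q + r) mod q = r"
  by simp_all

lemma fps_eq_divide:
  fixes a b q :: "rat fps"
  assumes "a * b = q" "fps_nth b 0 \<noteq> 0" shows "q / b = a"
proof -
  have "q / b = a * b * inverse b" using assms by (simp add: fps_divide_unit)
  also have "\<dots> = a" using assms(2) by (simp add: mult.assoc inverse_mult_eq_1')
  finally show ?thesis .
qed

lemma fps_mult_one_minus_X_power_nth:
  "fps_nth (Abs_fps f * (1 - fps_X ^ k)) n = f n - (if k \<le> n then f (n - k) else (0 :: rat))"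
  by (simp add: ring_distribs fps_X_power_mult_right_nth not_less)

lemma fps_dvd_indicator:
  assumes "k > 0"
  shows "Abs_fps (\<lambda>m. if k dvd m then 1 else 0 :: rat) * (1 - fps_X ^ k) = 1"
proof (rule fps_ext)
  fix n
  show "fps_nth (Abs_fps (\<lambda>m. if k dvd m then 1 else 0 :: rat) * (1 - fps_X ^ k)) n = fps_nth 1 n"
  proof (cases "k \<le> n")
    case True
    then have "k dvd n - k \<longleftrightarrow> k dvd n" by (metis dvd_diffD dvd_diff_nat dvd_refl)
    then show ?thesis using True assms unfolding fps_mult_one_minus_X_power_nth by simp
  next
    case False
    then show ?thesis unfolding fps_mult_one_minus_X_power_nth using nat_dvd_not_less[of n k] by (cases "n = 0") auto
  qed
qed

context cyclic_prime
begin

text \<open>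
  \<open>gam n\<close> and \<open>bet n\<close> below are \<open>\<gamma>\<close> and \<open>\<beta>\<close> in \<open>n = \<alpha> p\<^sup>2 + \<beta> p + \<gamma>\<close>.
\<close>

definition th :: "nat \<Rightarrow> nat \<Rightarrow> nat" where "th n a = (if a \<le> n then theta (n - a) else 0)"

lemma blocks_th: "blocks n k = (if k < p * p then th n (k div p) div p + (if k mod p < th n (k div p) mod p then 1 else 0) else 0)"
  by (simp add: blocks_def th_def)

definition gam :: "nat \<Rightarrow> nat" where "gam n = n mod p"
definition bet :: "nat \<Rightarrow> nat" where "bet n = (n div p) mod p"

lemma bet_less: "bet n < p" and gam_less: "gam n < p"
  using p_gt by (simp_all add: bet_def gam_def)

text \<open>Only a = \<open>gam n\<close> makes n - a divisible by p. Then theta (n - a) is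
  congruent to the number n div p + 1 of layers.\<close>

lemma th_mod: "a < p \<Longrightarrow> th n a mod p = (if a = gam n then Suc (bet n) mod p else 0)"
proof -
  assume a: "a < p"
  have iff: "p dvd n - a \<longleftrightarrow> a = n mod p" if "a \<le> n"
  proof
    assume "p dvd n - a"
    then obtain q where "n - a = p * q" by blast
    then have "n = a + p * q" using that by simp
    then show "a = n mod p" using a by simp
  qed (simp add: minus_mod_eq_mult_div)
  show ?thesis
  proof (cases "a \<le> n")
    case True
    have "(n - n mod p) div p = n div p" using p_gt by (simp add: minus_mod_eq_mult_div)
    then show ?thesis using True iff[OF True] by (simp add: th_def theta_mod gam_def bet_def mod_Suc_eq)
  next
    case False
    then show ?thesis using mod_less_eq_dividend[of n p] by (auto simp: th_def gam_def)
  qed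
qed

lemma card_monomials_mono: "card (monomials p e) \<le> card (monomials p (Suc e))"
proof -
  have "(e + p - 1) choose e \<le> (Suc e + p - 1) choose Suc e"
    using p_gt by (cases p) simp_all
  then show ?thesis using card_monomials[of p] p_gt by simp
qed

text \<open>T_m has the additional layer A_0, and its other layers are at least as large as those of
  T_(m-1).\<close>

lemma theta_less:
  assumes "p dvd m" "m > 0" shows "theta (m - 1) < theta m"
proof -
  obtain q where q: "m = p * Suc q" using assms by (metis dvdE mult_0_right not0_implies_Suc not_gr_zero)
  have "m - 1 = (p - 1) + q * p" using q p_gt by (simp add: algebra_simps)
  then have d1: "(m - 1) div p = q" using p_gt div_mult_self1[of p "p - 1" q] by (simp only:) simp
  have d2: "m div p = Suc q" using q p_gt by simp
  have "theta (m - 1) \<le> (\<Sum>i\<le>q. card (monomials p (m - i * p)))"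
    unfolding theta_def d1
  proof (rule sum_mono)
    fix i assume "i \<in> {..q}"
    then have "i * p \<le> m - 1" using \<open>m - 1 = (p - 1) + q * p\<close> by (metis atMost_iff mult_le_mono1 trans_le_add2)
    then have "m - i * p = Suc (m - 1 - i * p)" using assms(2) by linarith
    then show "card (monomials p (m - 1 - i * p)) \<le> card (monomials p (m - i * p))" using card_monomials_mono by metis
  qed
  also have "\<dots> < theta m" unfolding theta_def d2 using q card_monomials[of p 0] p_gt by (simp add: mult.commute)
  finally show ?thesis .
qed

text \<open>The multiplicity of V_m in degree \<open>n\<close>; the subtraction is exact by
  \<open>blocks_antimono\<close>.\<close>

definition cnt :: "nat \<Rightarrow> nat \<Rightarrow> nat" where
  "cnt n m = (if m = 0 then 0 else blocks n (m - 1) - blocks n m)"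

text \<open>The formula for \<open>blocks\<close> compares values of theta in different degrees and
  does not show this, but its meaning as a number of blocks does.\<close>

lemma blocks_antimono: "blocks n (Suc k) \<le> blocks n k"
proof -
  obtain H l where cb: "S.chain_basis (S_deg n) H l" using ex_chain_basis_S_deg by blast
  then have fin: "finite H" by (simp add: S.chain_basis_def)
  have "card {v\<in>H. Suc k < l v} \<le> card {v\<in>H. k < l v}" using fin by (intro card_mono) auto
  then show ?thesis unfolding S.card_chains_longer[OF S_deg_invariant cb, symmetric] dim_S_deg_blocks .
qed

lemma cnt_eq_0: "m \<notin> {1..p * p} \<Longrightarrow> cnt n m = 0"
  by (auto simp: cnt_def blocks_def)

text \<open>Both block counts belong to the same a = m div p and differ exactly when m mod p is the
  remainder of \<open>th n a\<close> modulo p. By \<open>th_mod\<close> this remainder can be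
  nonzero only for a = \<open>gam n\<close>.\<close>

lemma cnt_not_dvd:
  assumes "\<not> p dvd m" "m < p * p"
  shows "cnt n m = (if m = gam n * p + Suc (bet n) then 1 else 0)"
proof -
  define a where "a = m div p"
  define j where "j = m mod p"
  have m: "m = a * p + j" by (simp add: a_def j_def)
  have j: "0 < j" "j < p" using assms(1) p_gt by (simp_all add: j_def dvd_eq_mod_eq_0)
  have ap: "a < p" using assms(2) by (simp add: a_def less_mult_imp_div_less)
  have m1: "m - 1 = a * p + (j - 1)" using m j by simp
  have d: "(m - 1) div p = a" "(m - 1) mod p = j - 1" "m div p = a" "m mod p = j"
    unfolding m1 using j decomp[of "j - 1" p a] by (simp_all only: a_def[symmetric] j_def[symmetric])
  have "cnt n m = (if j = th n a mod p then 1 else 0)"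
  proof -
    have lt: "m - 1 < p * p" "m \<noteq> 0" using assms by (cases m; auto)+
    have "blocks n (m - 1) = th n a div p + (if j - 1 < th n a mod p then 1 else 0)"
      "blocks n m = th n a div p + (if j < th n a mod p then 1 else 0)"
      unfolding blocks_th d using lt assms(2) by simp_all
    then show ?thesis using lt j by (auto simp: cnt_def)
  qed
  also have "\<dots> = (if m = gam n * p + Suc (bet n) then 1 else 0)"
  proof -
    have "j = th n a mod p \<longleftrightarrow> a = gam n \<and> j = Suc (bet n)"
      using j bet_less[of n] unfolding th_mod[OF ap] by (cases "Suc (bet n) = p") auto
    also have "\<dots> \<longleftrightarrow> m = gam n * p + Suc (bet n)"
    proof
      assume eq: "m = gam n * p + Suc (bet n)"
      have "Suc (bet n) \<noteq> p" using eq assms(1) by (metis dvd_add dvd_refl dvd_triv_right)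
      then have "Suc (bet n) < p" using bet_less[of n] by simp
      from decomp[OF this, of "gam n"] show "a = gam n \<and> j = Suc (bet n)" unfolding a_def j_def eq by simp
    qed (simp add: m)
    finally show ?thesis by simp
  qed
  finally show ?thesis .
qed

text \<open>Here the two block counts belong to the neighbouring values i - 1 and i of a. The first
  carries no remainder term, as no remainder exceeds p - 1; in the second the term asks whether the
  remainder is positive. For i = p the second count is 0, since no block is larger than p^2.\<close>

lemma cnt_mult:
  assumes "1 \<le> i" "i \<le> p"
  shows "of_nat (cnt n (i * p)) = (of_nat (th n (i - 1) div p) :: rat) -
    (if i < p then of_nat (th n i div p) + (if th n i mod p > 0 then 1 else 0) else 0)"
proof -
  obtain i' where i': "i = Suc i'" using assms(1) by (cases i) auto
  have ip: "i * p - 1 = i' * p + (p - 1)" using i' p_gt by simp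
  have d: "(i * p - 1) div p = i'" "(i * p - 1) mod p = p - 1" 
    unfolding ip using p_gt decomp[of "p - 1" p i'] by simp_all
  have lt: "i * p - 1 < p * p"
  proof -
    have "i * p \<le> p * p" using assms(2) by simp
    moreover have "i * p > 0" using p_gt assms(1) by simp
    ultimately show ?thesis by linarith
  qed
  have b1: "blocks n (i * p - 1) = th n (i - 1) div p"
  proof -
    have "\<not> p - 1 < th n i' mod p" using mod_less_divisor[OF p_gt(1), of "th n i'"] by linarith
    then show ?thesis unfolding blocks_th d using lt by (simp only: if_True if_False i' diff_Suc_1 add_0_right)
  qed
  have b2: "blocks n (i * p) = (if i < p then th n i div p + (if th n i mod p > 0 then 1 else 0) else 0)"
    using p_gt by (simp add: blocks_th)
  have "blocks n (Suc (i * p - 1)) \<le> blocks n (i * p - 1)" by (rule blocks_antimono)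
  then have le: "blocks n (i * p) \<le> blocks n (i * p - 1)" using assms p_gt by simp
  have "cnt n (i * p) = blocks n (i * p - 1) - blocks n (i * p)" using assms p_gt by (simp add: cnt_def)
  then have "(of_nat (cnt n (i * p)) :: rat) = of_nat (blocks n (i * p - 1)) - of_nat (blocks n (i * p))"
    using le by (simp add: of_nat_diff)
  then show ?thesis unfolding b1 b2 by simp
qed

lemma summand_dim_eq: "summand_dim p n = gam n * p + Suc (bet n)"
  by (simp add: summand_dim_def gam_def bet_def)

lemma summand_dim_dvd: "p dvd summand_dim p n \<longleftrightarrow> Suc (bet n) = p"
proof
  assume "p dvd summand_dim p n"
  then have "p dvd Suc (bet n)" by (simp add: summand_dim_eq dvd_add_right_iff del: add_Suc_right)
  then show "Suc (bet n) = p" using bet_less[of n] by (metis Suc_leI dvd_imp_le le_antisym zero_less_Suc)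
next
  assume "Suc (bet n) = p"
  then show "p dvd summand_dim p n" by (simp add: summand_dim_eq del: add_Suc_right)
qed

lemma summand_dim_eq_mult:
  "summand_dim p n = i * p \<longleftrightarrow> Suc (bet n) = p \<and> i = Suc (gam n)"
proof
  assume eq: "summand_dim p n = i * p"
  then have b: "Suc (bet n) = p" using summand_dim_dvd by (metis dvd_triv_right)
  then have "i * p = Suc (gam n) * p" using eq by (simp add: summand_dim_eq del: add_Suc_right)
  then show "Suc (bet n) = p \<and> i = Suc (gam n)" using b p_gt by (metis mult_right_cancel not_less0)
next
  assume "Suc (bet n) = p \<and> i = Suc (gam n)"
  then have b: "Suc (bet n) = p" and i: "i = Suc (gam n)" by auto
  show "summand_dim p n = i * p" unfolding summand_dim_eq b i by simp
qed

text \<open>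
  If \<open>\<beta> = p - 1\<close>, then \<open>V\<^bsub>d(n)\<^esub>\<close> is an induced module, and without this lemma there might be no
  multiplicities \<open>a\<^sub>i(n)\<close> at all, so that the description defining them would be empty.
\<close>

lemma cnt_summand_dim: "cnt n (summand_dim p n) \<ge> 1"
proof (cases "Suc (bet n) = p")
  case False
  then have "Suc (bet n) < p" using bet_less[of n] by simp
  then have "summand_dim p n < gam n * p + p" by (simp add: summand_dim_eq)
  also have "\<dots> \<le> p * p" using gam_less[of n] by (metis Suc_leI add.commute mult_Suc mult_le_mono1)
  finally show ?thesis using cnt_not_dvd[of "summand_dim p n" n] False by (simp add: summand_dim_dvd) (simp add: summand_dim_eq)
next
  case True
  define i where "i = Suc (gam n)"
  have i: "1 \<le> i" "i \<le> p" using gam_less[of n] by (auto simp: i_def)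
  have d: "summand_dim p n = i * p" using True i_def summand_dim_eq_mult[of n i] by blast
  have gn: "gam n \<le> n" by (simp add: gam_def)
  define m where "m = n - gam n"
  have pm: "p dvd m" by (simp add: m_def gam_def)
  have m0: "m > 0"
  proof (rule ccontr)
    assume "\<not> m > 0"
    then have "n < p" using gn gam_less[of n] by (simp add: m_def)
    then show False using True p_gt by (simp add: bet_def)
  qed
  have th1: "th n (i - 1) = theta m" using gn by (simp add: th_def i_def m_def)
  have "th n (i - 1) mod p = 0" using th_mod[of "i - 1" n] i True by simp
  then have dv: "p dvd theta m" unfolding th1 by blast
  have "th n (i - 1) div p > 0"
    unfolding th1 div_greater_zero_iff using theta_less[OF pm m0] dvd_imp_le[OF dv] p_gt by simp
  moreover have "th n i div p < th n (i - 1) div p \<and> th n i mod p = 0" if "i < p"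
  proof -
    have "th n i mod p = 0" using th_mod[OF that, of n] by (simp add: i_def)
    moreover have "th n i < th n (i - 1)"
    proof (cases "i \<le> n")
      case True
      then have "th n i = theta (m - 1)" by (simp add: th_def i_def m_def)
      then show ?thesis using theta_less[OF pm m0] th1 by simp
    next
      case False
      then have "th n i = 0" by (simp add: th_def)
      moreover have "th n (i - 1) > 0" using \<open>th n (i - 1) div p > 0\<close> by (cases "th n (i - 1)") auto
      ultimately show ?thesis by simp
    qed
    \<comment> \<open>Both numbers are multiples of p, so the strict inequality passes to the
      quotients.\<close>
    moreover obtain x y where "th n i = p * x" "th n (i - 1) = p * y"
      using calculation(1) \<open>th n (i - 1) mod p = 0\<close> by (meson dvdE mod_0_imp_dvd)
    ultimately show ?thesis using p_gt by simp
  qed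
  ultimately have "(of_nat (cnt n (i * p)) :: rat) > 0" unfolding cnt_mult[OF i] by auto
  then show ?thesis unfolding d by simp
qed

text \<open>The multiplicity of V_(ip) after removal of V_d(n), which is of this form exactly for
  beta = p - 1. The subtraction is exact by \<open>cnt_summand_dim\<close>.\<close>

definition a_val :: "nat \<Rightarrow> nat \<Rightarrow> nat" where
  "a_val n i = (if i \<in> {1..p} then cnt n (i * p) - (if summand_dim p n = i * p then 1 else 0) else 0)"

lemma a_val_cnt: "i \<in> {1..p} \<Longrightarrow> a_val n i + (if summand_dim p n = i * p then 1 else 0) = cnt n (i * p)"
  using cnt_summand_dim[of n] by (auto simp: a_val_def)

lemma summand_dim_bounds: "1 \<le> summand_dim p n" "summand_dim p n \<le> p * p"
proof -
  show "1 \<le> summand_dim p n" by (simp add: summand_dim_def)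
  have "summand_dim p n \<le> gam n * p + p" using bet_less[of n] by (simp add: summand_dim_eq)
  also have "\<dots> \<le> p * p" using gam_less[of n] by (metis Suc_leI add.commute mult_Suc mult_le_mono1)
  finally show "summand_dim p n \<le> p * p" .
qed

text \<open>The left-hand side says that V_d(n) together with \<open>a i\<close> copies of each
  V_(ip) has the Jordan type of degree \<open>n\<close>. So this is existence and uniqueness of the
  multiplicities in one.\<close>

lemma cnt_eq_iff:
  fixes a :: "nat \<Rightarrow> nat"
  assumes "\<And>i. i \<notin> {1..p} \<Longrightarrow> a i = 0"
  shows "(\<forall>m. (if m = summand_dim p n then 1 else 0) + (if p dvd m \<and> m div p \<in> {1..p} then a (m div p) else 0) = cnt n m)
    \<longleftrightarrow> a = a_val n"
proof
  assume h: "\<forall>m. (if m = summand_dim p n then 1 else 0) + (if p dvd m \<and> m div p \<in> {1..p} then a (m div p) else 0) = cnt n m"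
  show "a = a_val n"
  proof
    fix i
    show "a i = a_val n i"
    proof (cases "i \<in> {1..p}")
      case True
      then show ?thesis using spec[OF h, of "i * p"] a_val_cnt[OF True, of n] p_gt by (auto split: if_splits)
    next
      case False
      then show ?thesis using assms by (auto simp: a_val_def)
    qed
  qed
next
  assume a: "a = a_val n"
  show "\<forall>m. (if m = summand_dim p n then 1 else 0) + (if p dvd m \<and> m div p \<in> {1..p} then a (m div p) else 0) = cnt n m"
  proof
    fix m
    consider (dvd) i where "i \<in> {1..p}" "m = i * p" | (out) "m \<notin> {1..p * p}" | (nd) "\<not> p dvd m" "m < p * p"
    proof (cases "m \<in> {1..p * p}")
      case True
      show ?thesis
      proof (cases "p dvd m")
        case True
        then obtain i where "m = i * p" by (metis dvdE mult.commute)
        moreover have "i \<in> {1..p}"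
        proof -
          have "i * p \<le> p * p" "i * p \<noteq> 0" using \<open>m \<in> {1..p * p}\<close> calculation by auto
          then have "i \<le> p" "i \<noteq> 0" using p_gt mult_le_cancel2[of i p p] by auto
          then show ?thesis by simp
        qed
        ultimately show ?thesis using that(1) by blast
      next
        case False
        then show ?thesis using True that(3) by (metis atLeastAtMost_iff dvd_triv_left le_neq_implies_less)
      qed
    qed (use that(2) in blast)
    then show "(if m = summand_dim p n then 1 else 0) + (if p dvd m \<and> m div p \<in> {1..p} then a (m div p) else 0) = cnt n m"
    proof cases
      case dvd
      then show ?thesis using a_val_cnt[OF dvd(1), of n] p_gt a by (auto split: if_splits)
    next
      case out
      have "\<not> (p dvd m \<and> m div p \<in> {1..p})"
      proof
        assume *: "p dvd m \<and> m div p \<in> {1..p}"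
        then obtain i where i: "m = p * i" by blast
        then have "i \<in> {1..p}" using * p_gt by simp
        then show False using out i p_gt by simp
      qed
      then show ?thesis using out cnt_eq_0[OF out] summand_dim_bounds[of n] by auto
    next
      case nd
      then show ?thesis using cnt_not_dvd[OF nd] by (simp add: summand_dim_eq)
    qed
  qed
qed

section \<open>From isomorphisms to multiplicities\<close>

lemma fg_iso_sym_dual_iff:
  fixes G :: "('g, 'x) monoid_scheme"
  assumes "group G" and s: "s \<in> carrier G" and gen: "\<And>g. g \<in> carrier G \<Longrightarrow> \<exists>k::nat. g = s [^]\<^bsub>G\<^esub> k"
    and ord: "\<And>k::nat. s [^]\<^bsub>G\<^esub> k = \<one>\<^bsub>G\<^esub> \<longleftrightarrow> p * p dvd k" and L1: "\<And>m. m \<in> set L \<Longrightarrow> m \<ge> 1"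
  shows "fg_iso G (sym_dual G s (p + 1) n :: ('k, 'k mpoly, 'g) fg_module) (direct_sum (map (jordan_module G s) L))
    \<longleftrightarrow> (\<forall>m. count (mset L) m = cnt n m)"
proof -
  interpret G: group G by fact
  have "s \<noteq> \<one>\<^bsub>G\<^esub>" using ord[of 1] s p_gt by auto
  \<comment> \<open>The exponent assigned to the generator itself has to be 1, so that it acts by
    the Jordan block.\<close>
  have least: "(LEAST k::nat. s = s [^]\<^bsub>G\<^esub> k) = 1"
  proof (rule Least_equality)
    fix y :: nat assume y: "s = s [^]\<^bsub>G\<^esub> y"
    show "1 \<le> y"
    proof (rule ccontr)
      assume "\<not> 1 \<le> y"
      then have "y = 0" by simp
      then show False using y \<open>s \<noteq> \<one>\<^bsub>G\<^esub>\<close> by simp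
    qed
  qed (use s in simp)
  obtain H l where cb: "S.chain_basis (S_deg n) H l" using ex_chain_basis_S_deg by blast
  have "count (image_mset l (mset_set H)) m = cnt n m" for m
    unfolding S.count_chain_lengths[OF S_deg_invariant cb] dim_S_deg_blocks cnt_def ..
  moreover have "fg_iso G (sym_dual G s (p + 1) n :: ('k, 'k mpoly, 'g) fg_module) (direct_sum (map (jordan_module G s) L))
    \<longleftrightarrow> mset L = image_mset l (mset_set H)"
    by (rule S.fg_iso_direct_sum_iff[OF realizes_sym_dual[OF assms(1-4)] S_deg_invariant cb s least L1])
  ultimately show ?thesis unfolding multiset_eq_iff by simp
qed

lemma a_mult_eq:
  fixes G :: "('g, 'x) monoid_scheme"
  assumes "group G" and s: "s \<in> carrier G" and gen: "\<And>g. g \<in> carrier G \<Longrightarrow> \<exists>k::nat. g = s [^]\<^bsub>G\<^esub> k"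
    and ord: "\<And>k::nat. s [^]\<^bsub>G\<^esub> k = \<one>\<^bsub>G\<^esub> \<longleftrightarrow> p * p dvd k"
  shows "a_mult TYPE('k) G s p n = a_val n"
proof -
  have iff: "fg_iso G (sym_dual G s (p + 1) n :: ('k, 'k mpoly, 'g) fg_module)
          (direct_sum (jordan_module G s (summand_dim p n) #
             concat (map (\<lambda>i. replicate (a i) (jordan_module G s (i * p))) [1..<p + 1]))) \<longleftrightarrow> a = a_val n"
    if a: "\<forall>i. i \<notin> {1..p} \<longrightarrow> a i = 0" for a
  proof -
    define L where "L = summand_dim p n # concat (map (\<lambda>i. replicate (a i) (i * p)) [1..<p + 1])"
    have L: "jordan_module G s (summand_dim p n) # concat (map (\<lambda>i. replicate (a i) (jordan_module G s (i * p))) [1..<p + 1])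
      = map (jordan_module G s) L"
      by (simp add: L_def map_concat comp_def del: upt_Suc)
    have L1: "m \<ge> 1" if "m \<in> set L" for m using that summand_dim_bounds[of n] p_gt by (auto simp: L_def)
    have inj: "inj_on (\<lambda>i. i * p) (set [1..<p + 1])" using p_gt by (auto simp: inj_on_def)
    have set: "set [1..<p + 1] = {1..p}" by auto
    have "count (mset L) m = (if m = summand_dim p n then 1 else 0) + (if p dvd m \<and> m div p \<in> {1..p} then a (m div p) else 0)" for m
    proof -
      have "(if m \<in> (\<lambda>i. i * p) ` set [1..<p + 1] then a (the_inv_into (set [1..<p + 1]) (\<lambda>i. i * p) m) else 0)
        = (if p dvd m \<and> m div p \<in> {1..p} then a (m div p) else 0)"
      proof (cases "m \<in> (\<lambda>i. i * p) ` set [1..<p + 1]")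
        case True
        then obtain i where i: "i \<in> set [1..<p + 1]" "m = i * p" by blast
        then have "the_inv_into (set [1..<p + 1]) (\<lambda>i. i * p) m = i" using the_inv_into_f_f[OF inj i(1)] by simp
        then show ?thesis using i p_gt unfolding set by auto
      next
        case False
        have nd: "\<not> (p dvd m \<and> m div p \<in> {1..p})"
        proof
          assume *: "p dvd m \<and> m div p \<in> {1..p}"
          then have "m = (m div p) * p" by simp
          then show False using * False unfolding set by (metis imageI)
        qed
        show ?thesis by (simp only: False nd if_False)
      qed
      then show ?thesis using count_concat_replicate[OF _ inj, of a m] by (auto simp: L_def simp del: upt_Suc)
    qed
    moreover have "fg_iso G (sym_dual G s (p + 1) n :: ('k, 'k mpoly, 'g) fg_module) (direct_sum (map (jordan_module G s) L))
      \<longleftrightarrow> (\<forall>m. count (mset L) m = cnt n m)" by (rule fg_iso_sym_dual_iff[OF assms L1])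
    ultimately show ?thesis unfolding L using cnt_eq_iff[of a n] a by (simp only:) blast
  qed
  have "\<forall>i. i \<notin> {1..p} \<longrightarrow> a_val n i = 0" by (auto simp: a_val_def)
  then show ?thesis unfolding a_mult_def using iff by (intro the_equality) auto
qed

lemma b_mult_eq:
  fixes G :: "('g, 'x) monoid_scheme"
  assumes "group G" and s: "s \<in> carrier G" and gen: "\<And>g. g \<in> carrier G \<Longrightarrow> \<exists>k::nat. g = s [^]\<^bsub>G\<^esub> k"
    and ord: "\<And>k::nat. s [^]\<^bsub>G\<^esub> k = \<one>\<^bsub>G\<^esub> \<longleftrightarrow> p * p dvd k"
  shows "b_mult TYPE('k) G s p n i = cnt n (i * p)"
proof -
  have iff: "fg_iso G (sym_dual G s (p + 1) n :: ('k, 'k mpoly, 'g) fg_module)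
      (direct_sum (concat (map (\<lambda>m. replicate (c m) (jordan_module G s m)) [1..<p\<^sup>2 + 1]))) \<longleftrightarrow> c = cnt n"
    if c: "\<forall>m. m \<notin> {1..p\<^sup>2} \<longrightarrow> c m = 0" for c
  proof -
    define L where "L = concat (map (\<lambda>i. replicate (c i) i) [1..<p\<^sup>2 + 1])"
    have L: "concat (map (\<lambda>m. replicate (c m) (jordan_module G s m)) [1..<p\<^sup>2 + 1]) = map (jordan_module G s) L"
      by (simp add: L_def map_concat comp_def del: upt_Suc)
    have L1: "m \<ge> 1" if "m \<in> set L" for m using that by (auto simp: L_def)
    have set: "set [1..<p\<^sup>2 + 1] = {1..p\<^sup>2}" by auto
    have "count (mset L) m = c m" for m
    proof -
      have "count (mset L) m = (if m \<in> (\<lambda>i. i) ` set [1..<p\<^sup>2 + 1] then c (the_inv_into (set [1..<p\<^sup>2 + 1]) (\<lambda>i. i) m) else 0)"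
        unfolding L_def by (rule count_concat_replicate) (simp_all del: upt_Suc)
      also have "\<dots> = c m"
        using c the_inv_into_f_f[of "\<lambda>i. i" "set [1..<p\<^sup>2 + 1]" m] unfolding set by auto
      finally show ?thesis .
    qed
    moreover have "fg_iso G (sym_dual G s (p + 1) n :: ('k, 'k mpoly, 'g) fg_module) (direct_sum (map (jordan_module G s) L))
      \<longleftrightarrow> (\<forall>m. count (mset L) m = cnt n m)" by (rule fg_iso_sym_dual_iff[OF assms L1])
    ultimately show ?thesis unfolding L fun_eq_iff by (simp only:)
  qed
  have "\<forall>m. m \<notin> {1..p\<^sup>2} \<longrightarrow> cnt n m = 0" using cnt_eq_0 by (auto simp: power2_eq_square)
  then have "summand_mult G s p (sym_dual G s (p + 1) n :: ('k, 'k mpoly, 'g) fg_module) = cnt n"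
    unfolding summand_mult_def using iff by (intro the_equality) auto
  then show ?thesis by (simp add: b_mult_def)
qed

section \<open>Generating functions\<close>

definition ones :: "nat \<Rightarrow> nat" where "ones m = (if p dvd m then 1 else 0)"
text \<open>Marks the degrees in which T_m is free although p divides m: the number of its layers is
  then a multiple of p.\<close>

definition full :: "nat \<Rightarrow> nat" where "full m = (if p dvd m \<and> Suc (bet m) = p then 1 else 0)"
text \<open>For p dividing m, the number of layers modulo p with representatives 1 to p in place of
  0 to p - 1. Its generating function is the fraction with the factor p + 1 in the theorem;
  \<open>full\<close> makes up for the change of representatives.\<close>

definition rem :: "nat \<Rightarrow> nat" where "rem m = (if p dvd m then Suc (bet m) else 0)"

lemma theta_div: "(of_nat (theta m div p) :: rat) = (of_nat (theta m) - of_nat (rem m)) / of_nat p + of_nat (full m)"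
proof -
  have "theta m mod p + p * full m = rem m"
    using bet_less[of m] by (auto simp: theta_mod full_def rem_def bet_def mod_Suc)
  then have "theta m + p * full m = p * (theta m div p) + rem m"
    using mult_div_mod_eq[of p "theta m"] by linarith
  then have "(of_nat (theta m) + of_nat p * of_nat (full m) :: rat) = of_nat p * of_nat (theta m div p) + of_nat (rem m)"
    by (metis of_nat_add of_nat_mult)
  then show ?thesis using p_gt by (simp add: field_simps)
qed

lemma theta_mod_pos: "(if theta m mod p > 0 then 1 else 0 :: rat) = of_nat (ones m) - of_nat (full m)"
  using bet_less[of m] by (auto simp: theta_mod full_def ones_def bet_def mod_Suc)

abbreviation gf :: "(nat \<Rightarrow> nat) \<Rightarrow> rat fps" where "gf f \<equiv> Abs_fps (\<lambda>n. of_nat (f n))"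

lemma X_power_gf_nth: "fps_nth (fps_X ^ k * Abs_fps f) n = (if k \<le> n then f (n - k) else (0 :: rat))"
  by (simp add: fps_X_power_mult_nth not_less)

definition Q :: "rat fps" where "Q = fps_const (1 / of_nat p) * (gf theta - gf rem) + gf full"

lemma Q_nth: "fps_nth Q m = of_nat (theta m div p)"
  by (simp add: Q_def theta_div diff_divide_distrib)

lemma b_gf:
  assumes "1 \<le> i" "i \<le> p"
  shows "gf (\<lambda>n. cnt n (i * p)) = fps_X ^ (i - 1) * Q - (if i < p then fps_X ^ i * (Q + gf ones - gf full) else 0)"
proof (rule fps_ext)
  fix n
  have q1: "fps_nth (fps_X ^ k * Q) n = of_nat (th n k div p)" for k
    by (simp add: fps_X_power_mult_nth Q_nth th_def)
  have q2: "fps_nth (fps_X ^ k * (Q + gf ones - gf full)) n = of_nat (th n k div p) + (if th n k mod p > 0 then 1 else 0)" for k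
    using theta_mod_pos[of "n - k"] by (simp add: fps_X_power_mult_nth Q_nth th_def)
  show "fps_nth (gf (\<lambda>n. cnt n (i * p))) n =
    fps_nth (fps_X ^ (i - 1) * Q - (if i < p then fps_X ^ i * (Q + gf ones - gf full) else 0)) n"
    using cnt_mult[OF assms, of n] q1[of "i - 1"] q2[of i] by (cases "i < p") simp_all
qed

text \<open>V_d(n) = V_(ip) means beta = p - 1 and gamma = i - 1. Subtracting gamma from n leaves
  alpha and beta unchanged, so these are the degrees marked by \<open>full\<close>, shifted by i -
  1.\<close>

lemma full_shift: "(if summand_dim p n = i * p then 1 else 0 :: rat) = fps_nth (fps_X ^ (i - 1) * gf full) n"
  if i: "1 \<le> i" "i \<le> p"
proof -
  have "summand_dim p n = i * p \<longleftrightarrow> i - 1 \<le> n \<and> p dvd n - (i - 1) \<and> Suc (bet (n - (i - 1))) = p"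
  proof
    assume "summand_dim p n = i * p"
    then have b: "Suc (bet n) = p" "i - 1 = n mod p" by (auto simp: summand_dim_eq_mult gam_def)
    have "(n - n mod p) div p = n div p" using p_gt by (simp add: minus_mod_eq_mult_div)
    then show "i - 1 \<le> n \<and> p dvd n - (i - 1) \<and> Suc (bet (n - (i - 1))) = p" using b by (simp add: bet_def)
  next
    assume *: "i - 1 \<le> n \<and> p dvd n - (i - 1) \<and> Suc (bet (n - (i - 1))) = p"
    then obtain q where q: "n - (i - 1) = p * q" by blast
    have ip: "i - 1 < p" using i p_gt by simp
    have "n = (n - (i - 1)) + (i - 1)" using * by simp
    then have n: "n = q * p + (i - 1)" unfolding q by (simp only: mult.commute)
    have "n mod p = i - 1" "n div p = q" unfolding n using decomp[OF ip, of q] by simp_all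
    moreover have "(n - (i - 1)) div p = q" unfolding q using p_gt by simp
    ultimately show "summand_dim p n = i * p" unfolding summand_dim_eq_mult using * i by (simp add: bet_def gam_def)
  qed
  then show ?thesis by (simp add: X_power_gf_nth full_def)
qed

lemma a_gf:
  assumes "1 \<le> i" "i \<le> p"
  shows "gf (\<lambda>n. a_val n i) = gf (\<lambda>n. cnt n (i * p)) - fps_X ^ (i - 1) * gf full"
proof (rule fps_ext)
  fix n
  have "(of_nat (a_val n i) :: rat) + (if summand_dim p n = i * p then 1 else 0) = of_nat (cnt n (i * p))"
    using a_val_cnt[of i n, symmetric] assms by simp
  then show "fps_nth (gf (\<lambda>n. a_val n i)) n = fps_nth (gf (\<lambda>n. cnt n (i * p)) - fps_X ^ (i - 1) * gf full) n"
    unfolding full_shift[OF assms] by simp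
qed

lemma ones_gf: "gf ones * (1 - fps_X ^ p) = 1"
proof -
  have "gf ones = Abs_fps (\<lambda>m. if p dvd m then 1 else 0)" by (rule fps_ext) (simp add: ones_def)
  then show ?thesis using fps_dvd_indicator[OF p_gt(1)] by simp
qed

text \<open>The conditions beta = p - 1 and gamma = 0 mean that m is p^2 - p plus a multiple of
  p^2.\<close>

lemma full_gf: "gf full * (1 - fps_X ^ (p * p)) = fps_X ^ (p * p - p)"
proof -
  have "gf full = fps_X ^ (p * p - p) * Abs_fps (\<lambda>m. if p * p dvd m then 1 else 0)"
  proof (rule fps_ext)
    fix m
    have iff: "p dvd m \<and> Suc (bet m) = p \<longleftrightarrow> p * p - p \<le> m \<and> p * p dvd m - (p * p - p)"
    proof
      assume *: "p dvd m \<and> Suc (bet m) = p"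
      then obtain k where k: "m = p * k" by blast
      then have "k mod p = p - 1" using * p_gt by (auto simp: bet_def)
      then have "k = (k div p) * p + (p - 1)" using div_mult_mod_eq[of k p] by simp
      then have "m = p * ((k div p) * p + (p - 1))" using k by simp
      also have "\<dots> = (p * p) * (k div p) + (p * p - p)" by (simp add: algebra_simps diff_mult_distrib2)
      finally show "p * p - p \<le> m \<and> p * p dvd m - (p * p - p)" by (metis diff_add_inverse2 dvd_triv_left le_add2)
    next
      assume *: "p * p - p \<le> m \<and> p * p dvd m - (p * p - p)"
      then obtain q where "m - (p * p - p) = p * p * q" by blast
      then have "m = p * p * q + (p * p - p)" using * by simp
      also have "\<dots> = p * (q * p + (p - 1))" by (simp add: algebra_simps diff_mult_distrib2)
      finally have m: "m = p * (q * p + (p - 1))" .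
      then have "m div p = q * p + (p - 1)" using p_gt by simp
      then have "bet m = p - 1" using decomp(2)[of "p - 1" p q] p_gt by (simp add: bet_def)
      then show "p dvd m \<and> Suc (bet m) = p" using m p_gt by simp
    qed
    show "fps_nth (gf full) m = fps_nth (fps_X ^ (p * p - p) * Abs_fps (\<lambda>m. if p * p dvd m then 1 else 0)) m"
      unfolding X_power_gf_nth using iff by (simp add: full_def)
  qed
  then show ?thesis using fps_dvd_indicator[of "p * p"] p_gt by (simp add: mult.assoc)
qed

text \<open>Along the multiples of p, \<open>rem\<close> grows by 1 at each step, except that it
  falls from p to 1 at the positive multiples of p^2. So the factor 1 - x^p leaves the indicator of
  the multiples of p minus p times that of the positive multiples of p^2.\<close>

lemma rem_gf:
  "gf rem * (1 - fps_X ^ p) * (1 - fps_X ^ p) * (1 - fps_X ^ (p * p)) =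
    1 - of_nat (p + 1) * fps_X ^ (p * p) + of_nat p * fps_X ^ (p * p + p)"
proof -
  let ?I = "Abs_fps (\<lambda>m. if p * p dvd m then 1 else 0 :: rat)"
  have e: "gf rem * (1 - fps_X ^ p) = gf ones - of_nat p * (fps_X ^ (p * p) * ?I)"
  proof (rule fps_ext)
    fix m
    have r: "fps_nth (gf ones - of_nat p * (fps_X ^ (p * p) * ?I)) m =
      of_nat (ones m) - of_nat p * (if p * p \<le> m then if p * p dvd m - p * p then 1 else 0 else 0)"
      unfolding fps_sub_nth fps_mult_of_nat_nth X_power_gf_nth by simp
    show "fps_nth (gf rem * (1 - fps_X ^ p)) m = fps_nth (gf ones - of_nat p * (fps_X ^ (p * p) * ?I)) m"
      unfolding r fps_mult_one_minus_X_power_nth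
    proof (cases "p dvd m")
      case False
      have "\<not> p * p dvd m - p * p" if "p * p \<le> m"
        using False that by (metis dvd_diffD dvd_mult_left dvd_triv_left)
      moreover have "\<not> p dvd m - p" if "p \<le> m" using False that by (metis dvd_diffD dvd_refl)
      ultimately show "of_nat (rem m) - (if p \<le> m then of_nat (rem (m - p)) else 0) =
        (of_nat (ones m) - of_nat p * (if p * p \<le> m then if p * p dvd m - p * p then 1 else 0 else 0) :: rat)"
        using False by (simp add: rem_def ones_def)
    next
      case True
      then obtain k where k: "m = p * k" by blast
      have R: "rem (p * j) = Suc (j mod p)" for j using p_gt by (simp add: rem_def bet_def)
      have O: "ones m = 1" using True by (simp add: ones_def)
      have C: "(p * p \<le> m \<and> p * p dvd m - p * p) \<longleftrightarrow> k > 0 \<and> p dvd k"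
      proof
        assume *: "p * p \<le> m \<and> p * p dvd m - p * p"
        then have "p * p dvd m" by (metis dvd_diffD dvd_refl)
        then have "p dvd k" using p_gt unfolding k nat_mult_dvd_cancel_disj by simp
        moreover have "k \<noteq> 0" using * k p_gt by auto
        ultimately show "k > 0 \<and> p dvd k" by simp
      next
        assume *: "k > 0 \<and> p dvd k"
        then have "p \<le> k" by (simp add: dvd_imp_le)
        then show "p * p \<le> m \<and> p * p dvd m - p * p" using * k by (simp add: dvd_diff_nat mult_dvd_mono)
      qed
      show "of_nat (rem m) - (if p \<le> m then of_nat (rem (m - p)) else 0) =
        (of_nat (ones m) - of_nat p * (if p * p \<le> m then if p * p dvd m - p * p then 1 else 0 else 0) :: rat)"
      proof (cases k)
        case 0
        then show ?thesis using k R[of 0] O p_gt by simp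
      next
        case (Suc k')
        have mp: "p \<le> m" "m - p = p * k'" using k Suc by simp_all
        have "(of_nat (rem m) :: rat) - of_nat (rem (m - p)) = of_nat (k mod p) - of_nat (k' mod p)"
        proof -
          have "rem m = Suc (k mod p)" by (simp only: k R)
          moreover have "rem (m - p) = Suc (k' mod p)" by (simp only: mp(2) R)
          ultimately show ?thesis by simp
        qed
        also have "\<dots> = 1 - of_nat p * (if p dvd k then 1 else 0)"
        proof (cases "Suc (k' mod p) = p")
          case True
          then have "k mod p = 0" unfolding Suc by (simp add: mod_Suc)
          moreover have "(of_nat p :: rat) = of_nat (k' mod p) + 1" using True by (metis of_nat_Suc add.commute)
          ultimately show ?thesis by (simp add: dvd_eq_mod_eq_0)
        next
          case False
          then have "k mod p = Suc (k' mod p)" unfolding Suc by (simp add: mod_Suc)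
          then show ?thesis by (simp add: dvd_eq_mod_eq_0)
        qed
        also have "(if p dvd k then 1 else 0 :: rat) = (if p * p \<le> m then if p * p dvd m - p * p then 1 else 0 else 0)"
          using C Suc by auto
        finally show ?thesis using mp(1) O by simp
      qed
    qed
  qed
  have I: "?I * (1 - fps_X ^ (p * p)) = 1" using fps_dvd_indicator[of "p * p"] p_gt by simp
  have "gf rem * (1 - fps_X ^ p) * (1 - fps_X ^ p) * (1 - fps_X ^ (p * p)) =
    (gf ones * (1 - fps_X ^ p)) * (1 - fps_X ^ (p * p)) -
    of_nat p * (fps_X ^ (p * p) * (?I * (1 - fps_X ^ (p * p)))) * (1 - fps_X ^ p)"
    unfolding e by (simp only: algebra_simps)
  also have "\<dots> = (1 - fps_X ^ (p * p)) - of_nat p * fps_X ^ (p * p) * (1 - fps_X ^ p)"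
    unfolding ones_gf I by simp
  finally show ?thesis by (simp add: algebra_simps power_add)
qed

text \<open>theta n - theta (n - p) is the dimension of A_n, which is a coefficient of 1 / (1 -
  x)^p.\<close>

lemma theta_gf: "gf theta * (1 - fps_X ^ p) * (1 - fps_X) ^ p = 1"
proof -
  have "gf theta * (1 - fps_X ^ p) = Abs_fps (\<lambda>n. of_nat ((p + n - 1) choose n))"
  proof (rule fps_ext)
    fix n
    have "theta n = ((p + n - 1) choose n) + (if p \<le> n then theta (n - p) else 0)"
    proof (cases "p \<le> n")
      case True
      have d: "n div p = Suc ((n - p) div p)" using True p_gt by (simp add: le_div_geq)
      have "theta n = card (monomials p n) + (\<Sum>i\<le>(n - p) div p. card (monomials p (n - Suc i * p)))"
        unfolding theta_def d by (subst sum.atMost_Suc_shift) simp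
      then show ?thesis using True card_monomials[of p n] p_gt by (simp add: theta_def add.commute)
    next
      case False
      then show ?thesis using card_monomials[of p n] p_gt by (simp add: theta_def add.commute)
    qed
    then show "fps_nth (gf theta * (1 - fps_X ^ p)) n = fps_nth (Abs_fps (\<lambda>n. of_nat ((p + n - 1) choose n))) n"
      unfolding fps_mult_one_minus_X_power_nth by simp
  qed
  also have "\<dots> * (1 - fps_X) ^ p = 1"
  proof -
    have "inverse ((1 - fps_X) ^ p) = Abs_fps (\<lambda>n. of_nat ((p + n - 1) choose n) :: rat)"
      using one_minus_const_fps_X_neg_power'[of p "1 :: rat"] p_gt by simp
    moreover have "inverse ((1 - fps_X) ^ p) * (1 - fps_X :: rat fps) ^ p = 1"
      by (rule inverse_mult_eq_1) (simp add: fps_power_zeroth)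
    ultimately show ?thesis by simp
  qed
  finally show ?thesis .
qed

lemma kappa: "fps_const (1 / of_nat p :: rat) * of_nat p = 1"
  using p_gt by (simp flip: fps_of_nat)

text \<open>This and the next lemmas turn the quotients of the theorem into products with the
  generating functions above, after which only ring identities remain.\<close>

lemma divide_ones: "f / (1 - fps_X ^ p) = f * gf ones"
  by (rule fps_eq_divide) (use p_gt ones_gf in \<open>simp_all add: mult.assoc\<close>)

lemma divide_theta: "f / (1 - fps_X) ^ p = f * (gf theta * (1 - fps_X ^ p))"
  by (rule fps_eq_divide) (use theta_gf in \<open>simp_all add: mult.assoc fps_power_zeroth\<close>)

lemma divide_rem:
  "f * (1 - of_nat (p + 1) * fps_X ^ p\<^sup>2 + of_nat p * fps_X ^ (p\<^sup>2 + p)) / ((1 - fps_X ^ p) * (1 - fps_X ^ p\<^sup>2))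
    = f * (gf rem * (1 - fps_X ^ p))"
  by (rule fps_eq_divide)
    (use p_gt in \<open>simp_all only: rem_gf[symmetric] power2_eq_square mult.assoc, simp_all\<close>)

lemma divide_p_ones: "f / (of_nat p * (1 - fps_X ^ p)) = f * (fps_const (1 / of_nat p) * gf ones)"
proof (rule fps_eq_divide)
  have "f * (fps_const (1 / of_nat p) * gf ones) * (of_nat p * (1 - fps_X ^ p))
    = f * (fps_const (1 / of_nat p) * of_nat p) * (gf ones * (1 - fps_X ^ p))" by (simp only: mult_ac)
  then show "f * (fps_const (1 / of_nat p) * gf ones) * (of_nat p * (1 - fps_X ^ p)) = f"
    unfolding kappa ones_gf by simp
  show "fps_nth (of_nat p * (1 - fps_X ^ p) :: rat fps) 0 \<noteq> 0" using p_gt by simp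
qed

lemma divide_full: "1 \<le> i \<Longrightarrow> fps_X ^ (p\<^sup>2 - p + i - 1) / (1 - fps_X ^ p\<^sup>2) = fps_X ^ (i - 1) * gf full"
proof (rule fps_eq_divide)
  assume i: "1 \<le> i"
  have e: "p\<^sup>2 - p + i - 1 = (i - 1) + (p * p - p)" using i by (simp add: power2_eq_square)
  show "fps_X ^ (i - 1) * gf full * (1 - fps_X ^ p\<^sup>2) = fps_X ^ (p\<^sup>2 - p + i - 1)"
    unfolding e power_add full_gf[symmetric] by (simp only: mult.assoc power2_eq_square)
  show "fps_nth (1 - fps_X ^ p\<^sup>2 :: rat fps) 0 \<noteq> 0" using p_gt by simp
qed

text \<open>The terms in \<open>gf full\<close> cancel: the one inside \<open>Q\<close> against the
  removal of V_d(n), and likewise in the part multiplied by x. What is left depends on i only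
  through the power of x.\<close>

lemma a_gf_less:
  assumes "1 \<le> i" "i < p"
  shows "gf (\<lambda>n. a_val n i) = fps_X ^ (i - 1) *
    ((1 - fps_X) * (fps_const (1 / of_nat p) * (gf theta - gf rem)) - fps_X * gf ones)"
proof -
  have e: "(fps_X :: rat fps) ^ i = fps_X ^ (i - 1) * fps_X" using assms(1) by (cases i) (simp_all add: mult.commute)
  have "gf (\<lambda>n. a_val n i) = fps_X ^ (i - 1) * Q - fps_X ^ (i - 1) * fps_X * (Q + gf ones - gf full) - fps_X ^ (i - 1) * gf full"
    using a_gf[of i] b_gf[of i] assms by (simp add: e)
  also have "\<dots> = fps_X ^ (i - 1) * (Q - fps_X * (Q + gf ones - gf full) - gf full)"
    by (simp only: right_diff_distrib mult.assoc)
  also have "Q - fps_X * (Q + gf ones - gf full) - gf full =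
    (1 - fps_X) * (fps_const (1 / of_nat p) * (gf theta - gf rem)) - fps_X * gf ones"
    unfolding Q_def by (simp only: ring_distribs mult_1_left diff_diff_eq2 diff_diff_eq) (simp add: algebra_simps)
  finally show ?thesis .
qed

text \<open>For i = p there are no larger blocks to subtract, which is why A_p does not continue the
  pattern of the other A_i.\<close>

lemma a_gf_p: "gf (\<lambda>n. a_val n p) = fps_X ^ (p - 1) * (fps_const (1 / of_nat p) * (gf theta - gf rem))"
  using a_gf[of p] b_gf[of p] p_gt by (simp add: Q_def distrib_left)

text \<open>\<open>divide_theta\<close> and \<open>divide_rem\<close> each leave a factor 1 - x^p,
  and both are cancelled by the one factor \<open>gf ones\<close> of the prefactor.\<close>

lemma ones_cancel: "k * gf ones * (a * (1 - fps_X ^ p) - b * (1 - fps_X ^ p)) = k * (a - b)"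
proof -
  have "k * gf ones * (a * (1 - fps_X ^ p) - b * (1 - fps_X ^ p)) = k * (a - b) * (gf ones * (1 - fps_X ^ p))"
    by (simp only: left_diff_distrib[symmetric] mult_ac)
  then show ?thesis unfolding ones_gf by simp
qed

lemma series_a_1:
  "gf (\<lambda>n. a_val n 1) = - fps_X / (1 - fps_X ^ p) + (1 - fps_X) / (of_nat p * (1 - fps_X ^ p)) *
     (1 / (1 - fps_X) ^ p - (1 - of_nat (p + 1) * fps_X ^ p\<^sup>2 + of_nat p * fps_X ^ (p\<^sup>2 + p)) /
        ((1 - fps_X ^ p) * (1 - fps_X ^ p\<^sup>2)))"
  unfolding divide_ones divide_theta divide_p_ones divide_rem[of 1, unfolded mult_1_left] mult_1_left
    mult.assoc[symmetric, of "1 - fps_X" "fps_const (1 / of_nat p)"] ones_cancel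
  using a_gf_less[of 1] p_gt by (simp add: mult.assoc)

lemma series_a_p:
  "gf (\<lambda>n. a_val n p) = 1 / (of_nat p * (1 - fps_X ^ p)) *
     (fps_X ^ (p - 1) / (1 - fps_X) ^ p -
      (fps_X ^ (p - 1) - of_nat (p + 1) * fps_X ^ (p\<^sup>2 + p - 1) + of_nat p * fps_X ^ (p\<^sup>2 + 2 * p - 1)) /
        ((1 - fps_X ^ p) * (1 - fps_X ^ p\<^sup>2)))"
proof -
  have e: "p\<^sup>2 + p - 1 = (p - 1) + p\<^sup>2" "p\<^sup>2 + 2 * p - 1 = (p - 1) + (p\<^sup>2 + p)" using p_gt by simp_all
  have n: "fps_X ^ (p - 1) - of_nat (p + 1) * fps_X ^ (p\<^sup>2 + p - 1) + of_nat p * fps_X ^ (p\<^sup>2 + 2 * p - 1)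
    = fps_X ^ (p - 1) * (1 - of_nat (p + 1) * fps_X ^ p\<^sup>2 + of_nat p * fps_X ^ (p\<^sup>2 + p) :: rat fps)"
    unfolding e power_add by (simp only: ring_distribs mult_1_right mult_1_left mult_ac)
  show ?thesis
    unfolding n divide_rem divide_theta divide_p_ones mult_1_left mult.assoc[symmetric, of "fps_X ^ (p - 1)" "gf _"] ones_cancel a_gf_p
    by (simp only: right_diff_distrib mult_ac)
qed

end

theorem mainTheorem6:
  fixes G :: "('g, 'x) monoid_scheme" and s :: 'g and p :: nat
  defines "A \<equiv> A_series TYPE('k :: field) G s p"
    and "B \<equiv> B_series TYPE('k :: field) G s p"
    and "x \<equiv> (fps_X :: rat fps)"
  assumes "prime p"
    and "CHAR('k) = p"
    and "group G"
    and "G \<cong> integer_mod_group (p\<^sup>2)"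
    and "s \<in> carrier G" and "generate G {s} = carrier G"
  shows "(A 1 = - x / (1 - x ^ p) +
           (1 - x) / (of_nat p * (1 - x ^ p)) *
           (1 / (1 - x) ^ p -
            (1 - of_nat (p + 1) * x ^ (p\<^sup>2) + of_nat p * x ^ (p\<^sup>2 + p)) /
            ((1 - x ^ p) * (1 - x ^ (p\<^sup>2))))) \<and>
    (\<forall>i \<in> {1..p - 1}. A i = x ^ (i - 1) * A 1) \<and>
    (A p = 1 / (of_nat p * (1 - x ^ p)) *
           (x ^ (p - 1) / (1 - x) ^ p -
            (x ^ (p - 1) - of_nat (p + 1) * x ^ (p\<^sup>2 + p - 1) + of_nat p * x ^ (p\<^sup>2 + 2 * p - 1)) /
            ((1 - x ^ p) * (1 - x ^ (p\<^sup>2))))) \<and>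
    (\<forall>i \<in> {1..p}. B i = A i + x ^ (p\<^sup>2 - p + i - 1) / (1 - x ^ (p\<^sup>2)))"
proof -
  interpret G: group G by fact
  interpret cyclic_prime p "TYPE('k)" by unfold_locales fact+
  have card: "card (carrier G) = p * p"
    using iso_same_card[OF assms(7)] p_gt by (simp add: carrier_integer_mod_group power2_eq_square nat_mult_distrib)
  then have fin: "finite (carrier G)" using p_gt by (intro card_ge_0_finite) simp
  have ord: "s [^]\<^bsub>G\<^esub> k = \<one>\<^bsub>G\<^esub> \<longleftrightarrow> p * p dvd k" for k :: nat
    using G.pow_eq_id[OF assms(8), of k] G.generate_pow_card[OF assms(8)] assms(9) card by simp
  have gen: "\<exists>k::nat. g = s [^]\<^bsub>G\<^esub> k" if "g \<in> carrier G" for g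
    using that G.generate_pow_on_finite_carrier[OF fin assms(8)] assms(9) by auto
  have A: "A i = Abs_fps (\<lambda>n. of_nat (a_val n i))" for i
  proof -
    have "a_mult TYPE('k) G s p n = a_val n" for n by (rule a_mult_eq[OF assms(6,8) gen ord])
    then show ?thesis by (simp add: A_def A_series_def)
  qed
  have B: "B i = Abs_fps (\<lambda>n. of_nat (cnt n (i * p)))" for i
  proof -
    have "b_mult TYPE('k) G s p n i = cnt n (i * p)" for n by (rule b_mult_eq[OF assms(6,8) gen ord])
    then show ?thesis by (simp add: B_def B_series_def)
  qed
  have "A i = x ^ (i - 1) * A 1" if "i \<in> {1..p - 1}" for i
  proof -
    have i: "1 \<le> i" "i < p" using that p_gt by auto
    show ?thesis unfolding A x_def a_gf_less[OF i] a_gf_less[OF order_refl p_gt(3)] by simp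
  qed
  \<comment> \<open>The difference of B_i and A_i is V_d(n) itself, counted in the degrees where it
    equals V_(ip).\<close>
  moreover have "B i = A i + x ^ (p\<^sup>2 - p + i - 1) / (1 - x ^ (p\<^sup>2))" if "i \<in> {1..p}" for i
  proof -
    have i: "1 \<le> i" "i \<le> p" using that by auto
    show ?thesis unfolding A B x_def divide_full[OF i(1)] a_gf[OF i] by simp
  qed
  ultimately show ?thesis using series_a_1 series_a_p unfolding A x_def by blast
qed

end
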